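(* For every $h\in L^2(0,\infty)$, $$h(x)=\int_0^\infty K(x,y)\,h(y)\,dy,\qquad K(x,y)=\frac1\pi\int_0^\infty\operatorname{Re}\Big\{a(s)w(s,x)w(s,y)+\overline{w(s,x)}\,w(s,y)\Big\}\,ds,$$ in the sense of the eigenfunction expansion of $A=-\frac{d^2}{dx^2}+P(x)$: $h(x)=\lim_{S\to\infty}\frac1\pi\int_0^S\int_0^\infty\operatorname{Re}\{a(s)w(s,x)w(s,y)+\overline{w(s,x)}w(s,y)\}h(y)\,dy\,ds$, where the inner integral is the $L^2$-limit of integrals over compact subintervals of $(0,\infty)$ and the limit in $S$ is taken in $L^2(0,\infty)$.
   Context: $P(x)=\frac{e^{4x}+10e^{2x}+1}{4(e^{2x}-1)^2}$. For $s\ge0$, $x>0$: $a(s)=-\dfrac{\Gamma(1-is)\Gamma(\frac32+is)}{\Gamma(1+is)\Gamma(\frac32-is)}$ and $w(s,x)=\dfrac{e^{(1-is)x}}{\sqrt{e^{2x}-1}}\,{}_2F_1(-\tfrac12,-\tfrac12+is;1+is;e^{-2x})$ (Gauss hypergeometric function). *)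

theory Defs
  imports "HOL-Analysis.Analysis"
begin

text \<open>Potential of the operator A = -d^2/dx^2 + P(x) (context only).\<close>
definition P :: "real \<Rightarrow> real" where
  "P x = (exp (4*x) + 10 * exp (2*x) + 1) / (4 * (exp (2*x) - 1)^2)"

text \<open>Gauss hypergeometric function as its power series (used only for 0 < z < 1).\<close>
definition hyp2F1 :: "complex \<Rightarrow> complex \<Rightarrow> complex \<Rightarrow> complex \<Rightarrow> complex" where
  "hyp2F1 a b c z =
     (\<Sum>n. pochhammer a n * pochhammer b n / (pochhammer c n * of_nat (fact n)) * z ^ n)"

definition coef_a :: "real \<Rightarrow> complex" where
  "coef_a s = - (Gamma (1 - \<i> * of_real s) * Gamma (3/2 + \<i> * of_real s)) /
                 (Gamma (1 + \<i> * of_real s) * Gamma (3/2 - \<i> * of_real s))"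

definition wfun :: "real \<Rightarrow> real \<Rightarrow> complex" where
  "wfun s x = exp ((1 - \<i> * of_real s) * of_real x) / of_real (sqrt (exp (2*x) - 1)) *
              hyp2F1 (-1/2) (-1/2 + \<i> * of_real s) (1 + \<i> * of_real s) (of_real (exp (-2*x)))"

definition kerA :: "real \<Rightarrow> real \<Rightarrow> real \<Rightarrow> real" where
  "kerA s x y = Re (coef_a s * wfun s x * wfun s y + cnj (wfun s x) * wfun s y)"

end

theory Submission
  imports Defs "HOL-Complex_Analysis.Complex_Analysis" "HOL-Real_Asymp.Real_Asymp"
begin

text \<open>
  Since \<open>P x = 1/4 + 3 / (4 * sinh x ^ 2)\<close>, the functions \<open>w(s, \<cdot>)\<close> are Jost solutions of
  \<open>- u'' + 3 / (4 * sinh x ^ 2) * u = s\<^sup>2 * u\<close>, and \<open>a w + cnj w\<close> is the solution regular at 0.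
  As \<open>a = b\<^sup>2\<close> with \<open>\<bar>b\<bar> = 1\<close>, the kernel is \<open>\<psi>(s, x) * \<psi>(s, y) / 2\<close> with the real function
  \<open>\<psi> = 2 * Re (b w)\<close>. Everything reduces to the Parseval identity
  \<open>\<integral> \<bar>\<integral> \<psi>(s, y) g(y) dy\<bar>\<^sup>2 ds = 2 * pi * \<integral> \<bar>g\<bar>\<^sup>2\<close> for bounded \<open>g\<close> with compact support in \<open>(0, \<infinity>)\<close>:
  it makes the transform an isometry, so its adjoint is a left inverse.

  To prove it, put \<open>\<sigma> = \<i> s\<close> and integrate \<open>(a w + cnj w)(x) w(y) / (\<kappa>\<^sup>2 - \<sigma>\<^sup>2)\<close> over the boundary of
  \<open>[0, M + 1/2] \<times> [-T, T]\<close>. The poles of the two summands at the positive integers cancel, and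
  for \<open>\<kappa> = N + 1/2\<close> the residue at \<open>\<kappa>\<close> is explicit because \<open>a(\<kappa>) = 0\<close>. This evaluates
  \<open>\<integral> \<psi>(s, x) \<psi>(s, y) * \<kappa>\<^sup>2 / (s\<^sup>2 + \<kappa>\<^sup>2) ds\<close> as \<open>2 * pi\<close> times a kernel which is uniformly asymptotic to
  the approximate identity \<open>\<kappa> / 2 * exp (- \<kappa> * \<bar>x - y\<bar>)\<close>; monotone convergence as \<open>N\<close> grows finishes the proof.
\<close>

section \<open>Coefficients of the Jost series\<close>

text \<open>Two limits are taken in a fixed order. For fixed M the height T goes to infinity, so on
  the horizontal sides a bound C(M) * (1 + |\<sigma>|) is enough against the quadratic denominator.
  Then M grows, so on the right side the bound must be independent of M; this is the delicate point.
  It rests on half-integer abscissas, which stay at distance 1/2 from the poles, on a recursion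
  \<sigma> -> \<sigma> + 1 for \<open>scat\<close> with factors 1 + O(|\<sigma>|^-2), and on x <= y,
  which lets the decay of one solution absorb the growth of the other. The same coefficient bound,
  read at the point -\<kappa>, makes the resolvent asymptotics uniform. The step from isometry to
  inversion: if T multiplies squared norms by 2 pi, so does at most its adjoint, and for k = T g cut
  to [0, S] the square of the norm of g - (adjoint of k) / (2 pi), when expanded, is at most |g|^2 -
  |k|^2 / (2 pi), which tends to 0. Eigenfunctions are bounded in s only away from x = 0, so
  functions supported in some [\<delta>, R] with \<delta> > 0 come first.\<close>

definition half_coeff :: "nat \<Rightarrow> real" where
  "half_coeff n = pochhammer (-1/2) n / fact n"

text \<open>The hypergeometric coefficient is \<open>half_coeff n * jost_coeff n \<sigma>\<close>.
  The first factor is free of \<sigma> and bounded by 1, so every estimate in \<sigma> concerns this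
  quotient, which carries the poles at negative integers.\<close>

definition jost_coeff :: "nat \<Rightarrow> complex \<Rightarrow> complex" where
  "jost_coeff n \<sigma> = pochhammer (\<sigma> - 1/2) n / pochhammer (1 + \<sigma>) n"

definition jost_series :: "complex \<Rightarrow> real \<Rightarrow> complex" where
  "jost_series \<sigma> z = (\<Sum>n. of_real (half_coeff n) * jost_coeff n \<sigma> * of_real z ^ n)"

text \<open>The factor exp x of \<open>wfun\<close> cancels in sqrt (exp (2*x) - 1) = exp x * sqrt
  (1 - exp (-2*x)). The remaining root is the value of the series when every
  \<open>jost_coeff\<close> is 1; hence \<open>jost \<sigma> x * exp (\<sigma> x)\<close> tends to 1
  along suitable \<sigma> going to infinity.\<close>

definition jost :: "complex \<Rightarrow> real \<Rightarrow> complex" where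
  "jost \<sigma> x = exp (- \<sigma> * of_real x) * jost_series \<sigma> (exp (-2*x)) / of_real (sqrt (1 - exp (-2*x)))"

lemma wfun_eq_jost:
  assumes "x > 0"
  shows "wfun s x = jost (\<i> * of_real s) x"
proof -
  have "exp (2*x) - 1 = exp (2*x) * (1 - exp (-2*x))"
    by (simp add: algebra_simps flip: exp_add)
  hence "sqrt (exp (2*x) - 1) = sqrt (exp x ^ 2) * sqrt (1 - exp (-2*x))"
    by (simp add: real_sqrt_mult flip: exp_of_nat_mult)
  hence *: "sqrt (exp (2*x) - 1) = exp x * sqrt (1 - exp (-2*x))"
    by simp
  have "exp ((1 - \<i> * of_real s) * complex_of_real x) = of_real (exp x) * exp (- (\<i> * of_real s) * of_real x)"
    by (simp add: algebra_simps exp_diff exp_minus exp_of_real divide_inverse)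
  moreover have "hyp2F1 (-1/2) (-1/2 + \<i> * of_real s) (1 + \<i> * of_real s) (of_real (exp (-2*x))) =
      jost_series (\<i> * of_real s) (exp (-2*x))"
    unfolding hyp2F1_def jost_series_def half_coeff_def jost_coeff_def
    by (intro suminf_cong) (simp add: pochhammer_of_real[symmetric] algebra_simps)
  moreover have "exp x * sqrt (1 - exp (-2*x)) \<noteq> 0"
    using assms by simp
  ultimately show ?thesis
    unfolding wfun_def jost_def * by (simp add: field_simps)
qed

lemma half_coeff_Suc: "half_coeff (Suc n) = half_coeff n * ((real n - 1/2) / (real n + 1))"
  by (simp add: half_coeff_def pochhammer_Suc field_simps)

lemma abs_half_coeff_le: "\<bar>half_coeff n\<bar> \<le> 1"
proof (induction n)
  case 0
  then show ?case by (simp add: half_coeff_def)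
next
  case (Suc n)
  have "\<bar>(real n - 1/2) / (real n + 1)\<bar> \<le> 1"
    by (auto simp: abs_le_iff field_simps)
  with Suc show ?case
    unfolding half_coeff_Suc abs_mult by (intro mult_le_one) auto
qed

lemma jost_coeff_0 [simp]: "jost_coeff 0 \<sigma> = 1"
  by (simp add: jost_coeff_def)

lemma jost_coeff_Suc:
  "jost_coeff (Suc n) \<sigma> = jost_coeff n \<sigma> * ((\<sigma> + of_nat n - 1/2) / (\<sigma> + of_nat n + 1))"
  by (simp add: jost_coeff_def pochhammer_Suc algebra_simps)

lemma norm_quot_le_one:
  fixes w v :: complex
  assumes "Im w = Im v" "\<bar>Re w\<bar> \<le> \<bar>Re v\<bar>"
  shows "norm (w / v) \<le> 1"
proof -
  have "norm w \<le> norm v"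
    unfolding cmod_def using assms power_mono[OF assms(2), of 2] by simp
  thus ?thesis by (auto simp: norm_divide divide_le_eq_1)
qed

text \<open>The next factor has its zero at \<sigma> + n = 1/2 and its pole at -1; to the right of
  their midpoint -1/4 the zero is at least as near as the pole. This is the origin of the bounds
  -1/4 below.\<close>

lemma norm_jost_coeff_step:
  assumes "Re \<sigma> + real n \<ge> -1/4"
  shows "norm (jost_coeff (Suc n) \<sigma>) \<le> norm (jost_coeff n \<sigma>)"
proof -
  have "norm ((\<sigma> + of_nat n - 1/2) / (\<sigma> + of_nat n + 1)) \<le> 1"
    by (rule norm_quot_le_one) (use assms in auto)
  thus ?thesis
    unfolding jost_coeff_Suc norm_mult by (simp add: mult_left_le)
qed

lemma norm_jost_coeff_le_one:
  assumes "Re \<sigma> \<ge> -1/4"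
  shows "norm (jost_coeff n \<sigma>) \<le> 1"
proof (induction n)
  case (Suc n)
  then show ?case using norm_jost_coeff_step[of \<sigma> n] assms by simp
qed simp

text \<open>Only the first L factors can exceed 1. Each of them is 1 - (3/2) / (\<sigma> + n + 1)
  with a denominator of modulus at least 1, hence at most 5/2.\<close>

lemma norm_jost_coeff_horizontal:
  assumes "\<bar>Im \<sigma>\<bar> \<ge> 1" "Re \<sigma> \<ge> - real L"
  shows "norm (jost_coeff n \<sigma>) \<le> (5/2) ^ L"
proof -
  have *: "norm (jost_coeff n \<sigma>) \<le> (5/2) ^ (min n L)" for n
  proof (induction n)
    case (Suc n)
    show ?case
    proof (cases "n < L")
      case True
      have "\<sigma> + of_nat n + 1 \<noteq> 0"
        using assms by (auto simp: complex_eq_iff)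
      hence "(\<sigma> + of_nat n - 1/2) / (\<sigma> + of_nat n + 1) = 1 - (3/2) / (\<sigma> + of_nat n + 1)"
        by (subst diff_divide_eq_iff) (auto simp: algebra_simps)
      also have "norm \<dots> \<le> 1 + norm ((3/2) / (\<sigma> + of_nat n + 1))"
        using norm_triangle_ineq4[of 1 "(3/2) / (\<sigma> + of_nat n + 1)"] by simp
      also have "norm (\<sigma> + of_nat n + 1) \<ge> 1"
        using abs_Im_le_cmod[of "\<sigma> + of_nat n + 1"] assms by simp
      hence "norm ((3/2) / (\<sigma> + of_nat n + 1)) \<le> 3/2"
        unfolding norm_divide by (intro divide_le_eq[THEN iffD2]) auto
      finally have "norm ((\<sigma> + of_nat n - 1/2) / (\<sigma> + of_nat n + 1)) \<le> 5/2" by simp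
      moreover have "norm (jost_coeff n \<sigma>) \<le> (5/2) ^ n"
        using Suc True by (simp add: min_def)
      ultimately have "norm (jost_coeff (Suc n) \<sigma>) \<le> (5/2) ^ n * (5/2)"
        unfolding jost_coeff_Suc norm_mult by (intro mult_mono) auto
      with True show ?thesis by (simp add: min_def)
    next
      case False
      with Suc show ?thesis using norm_jost_coeff_step[of \<sigma> n] assms
        by (auto simp: min_def split: if_splits)
    qed
  qed simp
  have "norm (jost_coeff n \<sigma>) \<le> (5/2) ^ (min n L)" by (rule *)
  also have "\<dots> \<le> (5/2) ^ L" by (intro power_increasing) auto
  finally show ?thesis .
qed

text \<open>Complement to \<open>norm_quot_le_one\<close>: when the quotient of the real parts is at
  least 1 in modulus, a common imaginary part only pulls the modulus towards 1.\<close>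

lemma norm_quot_le_quot_Re:
  fixes w v :: complex
  assumes "Im w = Im v" "\<bar>Re v\<bar> \<le> \<bar>Re w\<bar>" "Re v \<noteq> 0"
  shows "norm (w / v) \<le> \<bar>Re w\<bar> / \<bar>Re v\<bar>"
proof -
  have pos: "norm v > 0" using assms(3) by auto
  have "(Re w)\<^sup>2 \<ge> (Re v)\<^sup>2" using assms(2) by (simp add: abs_le_square_iff)
  hence "(Im w)\<^sup>2 * (Re v)\<^sup>2 \<le> (Im w)\<^sup>2 * (Re w)\<^sup>2"
    by (intro mult_left_mono) auto
  hence "(norm w * \<bar>Re v\<bar>)\<^sup>2 \<le> (\<bar>Re w\<bar> * norm v)\<^sup>2"
    using assms(1) by (simp add: power_mult_distrib cmod_power2 algebra_simps)
  hence "norm w * \<bar>Re v\<bar> \<le> \<bar>Re w\<bar> * norm v"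
    by (rule power2_le_imp_le) simp
  thus ?thesis using pos assms(3) by (simp add: norm_divide field_simps)
qed

text \<open>On the lines halfway between the poles the factors of the coefficient are dominated by the
  telescoping quotients \<open>((j + 1) / j)\<^sup>2\<close>.\<close>
lemma norm_jost_coeff_vertical:
  assumes "Re \<sigma> = - (real M + 1/2)"
  shows "norm (jost_coeff n \<sigma>) \<le> 2 * (real n + 1)\<^sup>2"
proof -
  have 1: "norm (jost_coeff n \<sigma>) \<le> ((real M + 1) / (real M + 1 - real n))\<^sup>2" if "n \<le> M" for n
    using that
  proof (induction n)
    case (Suc n)
    define j where "j = real M - real n"
    have j: "j \<ge> 1" using Suc.prems by (simp add: j_def)
    have "norm ((\<sigma> + of_nat n - 1/2) / (\<sigma> + of_nat n + 1)) \<le>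
        \<bar>Re (\<sigma> + of_nat n - 1/2)\<bar> / \<bar>Re (\<sigma> + of_nat n + 1)\<bar>"
      by (rule norm_quot_le_quot_Re) (use assms j in \<open>auto simp: j_def\<close>)
    also have "\<dots> = (j + 1) / (j - 1/2)"
      using assms j by (simp add: j_def)
    also have "\<dots> \<le> ((j + 1) / j)\<^sup>2"
    proof -
      \<comment> \<open>(j+1) * (j - 1/2) = j^2 + (j-1)/2, so this is where j >= 1 is used.\<close>
      have "(j+1) * (j * j) \<le> (j+1) * ((j+1) * (j - 1/2))"
        using j by (intro mult_left_mono) (auto simp: algebra_simps)
      thus ?thesis using j by (simp add: power2_eq_square field_simps)
    qed
    finally have a: "norm ((\<sigma> + of_nat n - 1/2) / (\<sigma> + of_nat n + 1)) \<le> ((j + 1) / j)\<^sup>2" .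
    have "norm (jost_coeff (Suc n) \<sigma>) \<le> ((real M + 1) / (j + 1))\<^sup>2 * ((j + 1) / j)\<^sup>2"
      unfolding jost_coeff_Suc norm_mult
      using a Suc.IH Suc.prems by (intro mult_mono) (auto simp: j_def algebra_simps)
    also have "\<dots> = ((real M + 1) / j)\<^sup>2"
      using j by (simp add: power_divide)
    finally show ?case by (simp add: j_def)
  qed simp
  \<comment> \<open>The factor n = M lies next to the pole: its real parts are -1 and 1/2, which is
    the source of the constant 2.\<close>
  have 2: "norm (jost_coeff (Suc M) \<sigma>) \<le> 2 * (real M + 1)\<^sup>2"
  proof -
    have "norm ((\<sigma> + of_nat M - 1/2) / (\<sigma> + of_nat M + 1)) \<le>
        \<bar>Re (\<sigma> + of_nat M - 1/2)\<bar> / \<bar>Re (\<sigma> + of_nat M + 1)\<bar>"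
      by (rule norm_quot_le_quot_Re) (use assms in auto)
    hence "norm ((\<sigma> + of_nat M - 1/2) / (\<sigma> + of_nat M + 1)) \<le> 2"
      using assms by simp
    hence "norm (jost_coeff (Suc M) \<sigma>) \<le> (real M + 1)\<^sup>2 * 2"
      unfolding jost_coeff_Suc norm_mult using 1[of M] by (intro mult_mono) auto
    thus ?thesis by simp
  qed
  \<comment> \<open>From here on Re \<sigma> + n >= 1/2, so the moduli no longer grow.\<close>
  have 3: "norm (jost_coeff (Suc M + k) \<sigma>) \<le> 2 * (real M + 1)\<^sup>2" for k
  proof (induction k)
    case (Suc k)
    then show ?case using norm_jost_coeff_step[of \<sigma> "Suc M + k"] assms by simp
  qed (use 2 in simp)
  show ?thesis
  proof (cases "n \<le> M")
    case True
    \<comment> \<open>(n+1) * (M+1-n) = M + 1 + n * (M-n); this removes M from the bound.\<close>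
    have "0 \<le> real n * (real M - real n)" using True by simp
    hence "(real M + 1) / (real M + 1 - real n) \<le> real n + 1"
      using True by (simp add: field_simps)
    hence "((real M + 1) / (real M + 1 - real n))\<^sup>2 \<le> (real n + 1)\<^sup>2"
      using True by (intro power_mono) auto
    with 1[OF True] have "norm (jost_coeff n \<sigma>) \<le> (real n + 1)\<^sup>2" by linarith
    thus ?thesis using zero_le_power2[of "real n + 1"] by linarith
  next
    case False
    then obtain k where k: "n = Suc M + k"
      by (metis add_Suc less_iff_Suc_add not_le)
    have "2 * (real M + 1)\<^sup>2 \<le> 2 * (real n + 1)\<^sup>2"
      using k by (intro mult_left_mono power_mono) auto
    with 3[of k] show ?thesis unfolding k by linarith
  qed
qed

section \<open>Summation and limits of the Jost series\<close>

text \<open>Two termwise derivatives of the geometric series have the coefficients (n+1) * (n+2),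
  which dominate (n+1)^2.\<close>

lemma summable_square_power:
  fixes z :: real
  assumes "0 \<le> z" "z < 1"
  shows "summable (\<lambda>n. 2 * (real n + 1)\<^sup>2 * z ^ n)"
proof -
  have 1: "summable (\<lambda>n. 1 * x ^ n)" if "norm x < 1" for x :: real
    using that by (simp add: summable_geometric)
  have 2: "summable (\<lambda>n. diffs (\<lambda>_. 1) n * x ^ n)" if "norm x < 1" for x :: real
    by (rule termdiff_converges[OF that]) (use 1 in auto)
  have "summable (\<lambda>n. diffs (diffs (\<lambda>_. 1)) n * z ^ n)"
    by (rule termdiff_converges[of z 1]) (use assms 2 in auto)
  hence "summable (\<lambda>n. 2 * (diffs (diffs (\<lambda>_. 1)) n * z ^ n))"
    by (rule summable_mult)
  moreover have "norm (2 * (real n + 1)\<^sup>2 * z ^ n) \<le> 2 * (diffs (diffs (\<lambda>_. 1)) n * z ^ n)" for n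
    using assms by (auto simp: diffs_def power2_eq_square mult.assoc intro!: mult_mono)
  ultimately show ?thesis by (rule summable_comparison_test'[where N = 0])
qed

lemma norm_jost_series_le:
  assumes "0 \<le> z" "z \<le> z0" "\<And>n. norm (jost_coeff n \<sigma>) \<le> B n" "summable (\<lambda>n. B n * z0 ^ n)"
  shows "summable (\<lambda>n. of_real (half_coeff n) * jost_coeff n \<sigma> * of_real z ^ n)"
    and "norm (jost_series \<sigma> z) \<le> (\<Sum>n. B n * z0 ^ n)"
proof -
  have *: "norm (of_real (half_coeff n) * jost_coeff n \<sigma> * of_real z ^ n) \<le> B n * z0 ^ n" for n
  proof -
    have "norm (of_real (half_coeff n) * jost_coeff n \<sigma> * of_real z ^ n) =
        \<bar>half_coeff n\<bar> * norm (jost_coeff n \<sigma>) * z ^ n"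
      using assms by (simp add: norm_mult norm_power)
    also have "\<dots> \<le> 1 * B n * z0 ^ n"
      using assms abs_half_coeff_le order_trans[OF norm_ge_zero assms(3)]
      by (intro mult_mono power_mono) auto
    finally show ?thesis by simp
  qed
  show "summable (\<lambda>n. of_real (half_coeff n) * jost_coeff n \<sigma> * of_real z ^ n)"
    by (rule summable_comparison_test'[OF assms(4), where N = 0]) (use * in auto)
  have s: "summable (\<lambda>n. norm (of_real (half_coeff n) * jost_coeff n \<sigma> * of_real z ^ n))"
    by (rule summable_comparison_test'[OF assms(4), where N = 0]) (use * in auto)
  show "norm (jost_series \<sigma> z) \<le> (\<Sum>n. B n * z0 ^ n)"
    unfolding jost_series_def
    using summable_norm[OF s] suminf_le[OF * s assms(4)] by linarith
qed

text \<open>Binomial series at -z: the sign (-1)^n of the binomial coefficient cancels against that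
  of (-z)^n.\<close>

lemma half_coeff_sums:
  assumes "0 \<le> z" "z < 1"
  shows "(\<lambda>n. half_coeff n * z ^ n) sums sqrt (1 - z)"
proof -
  have "(\<lambda>n. ((1/2) gchoose n) * (-z) ^ n) sums sqrt (1 + (-z))"
    by (rule sqrt_series) (use assms in auto)
  moreover have "((1/2) gchoose n) * (-z) ^ n = half_coeff n * z ^ n" for n
  proof -
    have "((1/2::real) gchoose n) * (-z) ^ n = ((-1) ^ n * (-1) ^ n) * half_coeff n * z ^ n"
      by (subst power_minus) (simp add: gbinomial_pochhammer half_coeff_def)
    also have "(-1::real) ^ n * (-1) ^ n = 1"
      by (simp flip: power_mult_distrib)
    finally show ?thesis by simp
  qed
  ultimately show ?thesis by simp
qed

lemma norm_jost_coeff_minus_one_le: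
  assumes "norm (jost_coeff n \<sigma>) \<le> 2 * (real n + 1)\<^sup>2"
  shows "norm (jost_coeff n \<sigma> - 1) \<le> 2 * (2 * (real n + 1)\<^sup>2)"
proof -
  have "norm (jost_coeff n \<sigma> - 1) \<le> norm (jost_coeff n \<sigma>) + 1"
    using norm_triangle_ineq4[of "jost_coeff n \<sigma>" 1] by simp
  moreover have "(real n + 1)\<^sup>2 \<ge> 1"
    by (rule one_le_power) simp
  ultimately show ?thesis using assms by linarith
qed

text \<open>The root is the same series with every \<open>jost_coeff\<close> replaced by 1, so the
  difference is estimated termwise. The right side depends on z0 only, which later gives uniformity
  in x.\<close>

lemma jost_series_diff_sqrt_le:
  assumes "0 \<le> z" "z \<le> z0" "z0 < 1" "\<And>n. norm (jost_coeff n \<sigma>) \<le> 2 * (real n + 1)\<^sup>2"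
  shows "norm (jost_series \<sigma> z - of_real (sqrt (1 - z))) \<le> (\<Sum>n. norm (jost_coeff n \<sigma> - 1) * z0 ^ n)"
proof -
  have s1: "(\<lambda>n. of_real (half_coeff n) * jost_coeff n \<sigma> * of_real z ^ n) sums jost_series \<sigma> z"
    unfolding jost_series_def
    by (rule summable_sums, rule norm_jost_series_le(1)[OF assms(1) order_refl assms(4)])
       (use assms summable_square_power in auto)
  have s2: "(\<lambda>n. of_real (half_coeff n * z ^ n)) sums (of_real (sqrt (1 - z)) :: complex)"
    using half_coeff_sums[of z] assms by (simp only: sums_of_real_iff)
  have s3: "(\<lambda>n. of_real (half_coeff n) * (jost_coeff n \<sigma> - 1) * of_real z ^ n) sums
      (jost_series \<sigma> z - of_real (sqrt (1 - z)))"
    using sums_diff[OF s1 s2] by (simp add: algebra_simps)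
  have *: "norm (of_real (half_coeff n) * (jost_coeff n \<sigma> - 1) * of_real z ^ n) \<le>
      norm (jost_coeff n \<sigma> - 1) * z0 ^ n" for n
  proof -
    have "\<bar>half_coeff n\<bar> * norm (jost_coeff n \<sigma> - 1) * z ^ n \<le> 1 * norm (jost_coeff n \<sigma> - 1) * z0 ^ n"
      using assms abs_half_coeff_le by (intro mult_mono power_mono) auto
    thus ?thesis using assms by (simp add: norm_mult norm_power)
  qed
  have "norm (jost_coeff n \<sigma> - 1) * z0 ^ n \<le> 2 * (2 * (real n + 1)\<^sup>2 * z0 ^ n)" for n
    using mult_right_mono[OF norm_jost_coeff_minus_one_le[OF assms(4)], of "z0 ^ n"] assms(1,2)
    by (simp add: mult.assoc)
  hence le: "norm (norm (jost_coeff n \<sigma> - 1) * z0 ^ n) \<le> 2 * (2 * (real n + 1)\<^sup>2 * z0 ^ n)" for n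
    using assms(1,2) by simp
  have sm: "summable (\<lambda>n. norm (jost_coeff n \<sigma> - 1) * z0 ^ n)"
    by (rule summable_comparison_test'[where N = 0, OF _ le])
       (intro summable_mult summable_square_power order_trans[OF assms(1,2)] assms(3))
  have s: "summable (\<lambda>n. norm (of_real (half_coeff n) * (jost_coeff n \<sigma> - 1) * of_real z ^ n))"
    by (rule summable_comparison_test'[OF sm, where N = 0]) (use * in auto)
  show ?thesis
    using summable_norm[OF s] suminf_le[OF * s sm] s3 by (simp add: sums_iff)
qed

text \<open>Each factor is 1 - (3/2) / (\<sigma> + n + 1), and there are n of them.\<close>

lemma jost_coeff_tendsto_one:
  assumes "filterlim (\<lambda>N. norm (f N)) at_top F"
  shows "((\<lambda>N. jost_coeff n (f N)) \<longlongrightarrow> 1) F"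
proof (induction n)
  case (Suc n)
  have inf: "filterlim f at_infinity F"
    using assms by (rule filterlim_norm_at_top_imp_at_infinity)
  have "filterlim (\<lambda>N. (of_nat n + 1) + f N) at_infinity F"
    by (rule tendsto_add_filterlim_at_infinity[OF tendsto_const inf])
  hence i: "filterlim (\<lambda>N. f N + of_nat n + 1) at_infinity F"
    by (simp add: algebra_simps)
  have "((\<lambda>N. (3/2) / (f N + of_nat n + 1)) \<longlongrightarrow> 0) F"
    by (rule tendsto_divide_0[OF tendsto_const i])
  hence "((\<lambda>N. 1 - (3/2) / (f N + of_nat n + 1)) \<longlongrightarrow> 1 - 0) F"
    by (intro tendsto_intros)
  moreover have "eventually (\<lambda>N. f N + of_nat n + 1 \<noteq> 0) F"
    using filterlim_at_infinity_imp_eventually_ne[OF i, of 0] .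
  hence "eventually (\<lambda>N. 1 - (3/2) / (f N + of_nat n + 1) =
      (f N + of_nat n - 1/2) / (f N + of_nat n + 1)) F"
    by eventually_elim (subst diff_divide_eq_iff, auto simp: algebra_simps)
  ultimately have "((\<lambda>N. (f N + of_nat n - 1/2) / (f N + of_nat n + 1)) \<longlongrightarrow> 1) F"
    by (simp add: Lim_transform_eventually)
  from tendsto_mult[OF Suc this] show ?case by (simp add: jost_coeff_Suc)
qed simp

text \<open>Dominated convergence for series: every term tends to 0, and the quadratic bound,
  uniform in N, is the majorant.\<close>

lemma jost_coeff_error_tendsto_0:
  fixes f :: "nat \<Rightarrow> complex"
  assumes "0 \<le> z" "z < 1" "filterlim (\<lambda>N. norm (f N)) at_top sequentially"
    "\<And>n N. norm (jost_coeff n (f N)) \<le> 2 * (real n + 1)\<^sup>2"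
  shows "(\<lambda>N. \<Sum>n. norm (jost_coeff n (f N) - 1) * z ^ n) \<longlonglongrightarrow> 0"
proof -
  have *: "norm (norm (jost_coeff n (f N) - 1) * z ^ n) \<le> 2 * (2 * (real n + 1)\<^sup>2 * z ^ n)" for n N
    using mult_right_mono[OF norm_jost_coeff_minus_one_le[OF assms(4)], of "z ^ n"] assms(1)
    by (simp add: mult.assoc)
  have "((\<lambda>N. \<Sum>n. norm (jost_coeff n (f N) - 1) * z ^ n) \<longlongrightarrow> (\<Sum>n::nat. 0)) sequentially"
  proof (rule tannerys_theorem[THEN conjunct2, THEN conjunct2])
    show "summable (\<lambda>n. 2 * (2 * (real n + 1)\<^sup>2 * z ^ n))"
      by (intro summable_mult summable_square_power assms)
    show "eventually (\<lambda>(n, N). norm (norm (jost_coeff n (f N) - 1) * z ^ n) \<le>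
        2 * (2 * (real n + 1)\<^sup>2 * z ^ n)) (at_top \<times>\<^sub>F sequentially)"
      by (rule always_eventually) (use * in auto)
    show "((\<lambda>N. norm (jost_coeff n (f N) - 1) * z ^ n) \<longlongrightarrow> 0) sequentially" for n
    proof -
      have "((\<lambda>N. norm (jost_coeff n (f N) - 1) * z ^ n) \<longlongrightarrow> norm (1 - 1 :: complex) * z ^ n) sequentially"
        by (intro tendsto_intros jost_coeff_tendsto_one assms)
      thus ?thesis by simp
    qed
  qed simp
  thus ?thesis by simp
qed

section \<open>The scattering coefficient\<close>

text \<open>Euler's limit formulas for Gamma z * Gamma 1 and Gamma (1/2) * Gamma (z + 1/2) are
  compared factor by factor; sqrt pi is Gamma (1/2). This takes the place of Stirling's formula in
  the bounds for Gamma quotients.\<close>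

lemma norm_Gamma_le_Gamma_plus_half:
  fixes z :: complex
  assumes "Re z \<ge> 1/2"
  shows "norm (Gamma z) \<le> sqrt pi * norm (Gamma (z + 1/2))"
proof -
  have poch: "norm (pochhammer (z + 1/2) n) * norm (pochhammer (1/2 :: complex) n) \<le>
      norm (pochhammer z n) * norm (pochhammer (1 :: complex) n)" for n
  proof (induction n)
    case (Suc n)
    have *: "norm (z + 1/2 + of_nat n) * norm (1/2 + of_nat n :: complex) \<le>
        norm (z + of_nat n) * norm (1 + of_nat n :: complex)"
    proof -
      \<comment> \<open>The inequality (r + 1/2) * (n + 1/2) <= r * (n + 1) is equivalent to r >= n
        + 1/2, which is where Re z >= 1/2 enters.\<close>
      define r where "r = norm (z + of_nat n)"
      have "r \<ge> 1/2 + real n"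
        using complex_Re_le_cmod[of "z + of_nat n"] assms by (simp add: r_def)
      moreover have "norm (z + 1/2 + of_nat n) \<le> r + 1/2"
        using norm_triangle_ineq[of "z + of_nat n" "1/2"] by (simp add: r_def algebra_simps)
      hence "norm (z + 1/2 + of_nat n) * (1/2 + real n) \<le> (r + 1/2) * (1/2 + real n)"
        by (intro mult_right_mono) auto
      ultimately have "norm (z + 1/2 + of_nat n) * (1/2 + real n) \<le> r * (1 + real n)"
        by (simp add: algebra_simps)
      moreover have "norm (1/2 + of_nat n :: complex) = 1/2 + real n"
        using norm_of_real[of "1/2 + real n", where 'a = complex] by simp
      moreover have "norm (1 + of_nat n :: complex) = 1 + real n"
        using norm_of_real[of "1 + real n", where 'a = complex] by simp
      ultimately show ?thesis by (simp add: r_def)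
    qed
    from mult_mono[OF Suc *] show ?case
      by (simp add: pochhammer_Suc norm_mult mult_ac)
  qed simp
  have nz: "pochhammer w n \<noteq> 0" if "Re w > 0" for w :: complex and n
  proof
    assume "pochhammer w n = 0"
    then obtain k where "w = - of_nat k" by (auto simp: pochhammer_eq_0_iff)
    thus False using that by simp
  qed
  have series: "norm (Gamma_series z n) * norm (Gamma_series 1 n :: complex) \<le>
      norm (Gamma_series (1/2) n :: complex) * norm (Gamma_series (z + 1/2) n)" for n
  proof -
    \<comment> \<open>The powers of n balance: n^z * n = n^(1/2) * n^(z + 1/2).\<close>
    have "norm (exp (z * of_real (ln (real n)))) * norm (exp (1 * of_real (ln (real n)) :: complex)) =
        norm (exp (1/2 * of_real (ln (real n)) :: complex)) * norm (exp ((z + 1/2) * of_real (ln (real n))))"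
      by (simp add: algebra_simps flip: exp_add)
    moreover have "1 / (norm (pochhammer z (n+1)) * norm (pochhammer (1 :: complex) (n+1))) \<le>
        1 / (norm (pochhammer (1/2 :: complex) (n+1)) * norm (pochhammer (z + 1/2) (n+1)))"
      using poch[of "n+1"] nz[of "z + 1/2" "n+1"] nz[of "1/2" "n+1"] nz[of z "n+1"] nz[of 1 "n+1"] assms
      by (intro divide_left_mono) (auto simp: mult_ac)
    ultimately have "(fact n * fact n) * (norm (exp (z * of_real (ln (real n)))) * norm (exp (1 * of_real (ln (real n)) :: complex))) *
        (1 / (norm (pochhammer z (n+1)) * norm (pochhammer (1 :: complex) (n+1)))) \<le>
        (fact n * fact n) * (norm (exp (1/2 * of_real (ln (real n)) :: complex)) * norm (exp ((z + 1/2) * of_real (ln (real n))))) *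
        (1 / (norm (pochhammer (1/2 :: complex) (n+1)) * norm (pochhammer (z + 1/2) (n+1))))"
      by (simp only:) (intro mult_left_mono, auto)
    thus ?thesis
      unfolding Gamma_series_def norm_mult norm_divide norm_fact by (simp only: times_divide_eq_right times_divide_eq_left mult_1_right mult_1_left divide_divide_eq_left mult_ac of_real_of_nat_eq)
  qed
  have "(\<lambda>n. norm (Gamma_series z n) * norm (Gamma_series 1 n :: complex)) \<longlonglongrightarrow>
      norm (Gamma z) * norm (Gamma 1 :: complex)"
    by (intro tendsto_intros)
  moreover have "(\<lambda>n. norm (Gamma_series (1/2) n :: complex) * norm (Gamma_series (z + 1/2) n)) \<longlonglongrightarrow>
      norm (Gamma (1/2) :: complex) * norm (Gamma (z + 1/2))"
    by (intro tendsto_intros)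
  ultimately have "norm (Gamma z) * norm (Gamma 1 :: complex) \<le>
      norm (Gamma (1/2) :: complex) * norm (Gamma (z + 1/2))"
    by (rule LIMSEQ_le) (use series in auto)
  thus ?thesis by (simp add: Gamma_one_half_complex)
qed

text \<open>Continuation of \<open>coef_a\<close> from \<sigma> = i s. The denominators become
  entire factors \<open>rGamma\<close>, so zeros of the coefficient are found by evaluation and
  poles can come only from the two Gamma factors.\<close>

definition scat :: "complex \<Rightarrow> complex" where
  "scat \<sigma> = - (Gamma (1 - \<sigma>) * Gamma (3/2 + \<sigma>) * rGamma (1 + \<sigma>) * rGamma (3/2 - \<sigma>))"

lemma coef_a_eq_scat: "coef_a s = scat (\<i> * of_real s)"
  unfolding coef_a_def scat_def rGamma_inverse_Gamma
  by (simp only: divide_inverse inverse_mult_distrib minus_mult_left mult.assoc)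

lemma Gamma_mult_rGamma:
  fixes z :: complex
  assumes "Re z > 0"
  shows "Gamma z * rGamma z = 1"
proof -
  have "z \<notin> \<int>\<^sub>\<le>\<^sub>0" using assms by (auto elim!: nonpos_Ints_cases)
  thus ?thesis by (simp add: rGamma_inverse_Gamma Gamma_eq_zero_iff)
qed

text \<open>The Gamma recursion gives the factor (\<sigma> + 3/2) * (\<sigma> - 1/2) / (\<sigma> *
  (\<sigma> + 1)). Written as 1 + O(|\<sigma>|^-2), it shows that products over arbitrarily many
  shifts stay bounded.\<close>

lemma scat_plus_one:
  assumes "Re \<sigma> > -1" "\<sigma> \<notin> \<int>"
  shows "scat (\<sigma> + 1) = scat \<sigma> * (1 - (3/4) / (\<sigma> * (\<sigma> + 1)))"
proof -
  have nz: "\<sigma> \<noteq> 0" "\<sigma> + 1 \<noteq> 0"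
    using assms by (auto simp: add_eq_0_iff2)
  have "- \<sigma> \<notin> \<int>\<^sub>\<le>\<^sub>0" using assms nonpos_Ints_subset_Ints by (metis Ints_minus add.inverse_inverse subsetD)
  hence 1: "Gamma (1 - \<sigma>) = - \<sigma> * Gamma (- \<sigma>)"
    using Gamma_plus1[of "-\<sigma>"] by (simp add: add.commute)
  have "3/2 + \<sigma> \<notin> \<int>\<^sub>\<le>\<^sub>0" using assms by (auto elim!: nonpos_Ints_cases simp: complex_eq_iff)
  hence 2: "Gamma (3/2 + (\<sigma> + 1)) = (3/2 + \<sigma>) * Gamma (3/2 + \<sigma>)"
    using Gamma_plus1[of "3/2 + \<sigma>"] by (simp add: add.assoc)
  have 3: "rGamma (1 + \<sigma>) = (1 + \<sigma>) * rGamma (1 + (\<sigma> + 1))"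
    using rGamma_plus1[of "1 + \<sigma>"] by (simp add: add.assoc)
  have 4: "rGamma (3/2 - (\<sigma> + 1)) = (1/2 - \<sigma>) * rGamma (3/2 - \<sigma>)"
    using rGamma_plus1[of "1/2 - \<sigma>"] by (simp add: algebra_simps)
  have 5: "1 - (3/4) / (\<sigma> * (\<sigma> + 1)) = (\<sigma> + 3/2) * (\<sigma> - 1/2) / (\<sigma> * (\<sigma> + 1))"
  proof -
    have "(\<sigma> + 3/2) * (\<sigma> - 1/2) = \<sigma> * (\<sigma> + 1) - 3/4"
      by (simp add: field_simps)
    thus ?thesis using nz by (simp add: diff_divide_distrib)
  qed
  have "scat \<sigma> * (\<sigma> + 3/2) * (\<sigma> - 1/2) = scat (\<sigma> + 1) * (\<sigma> * (\<sigma> + 1))"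
  proof -
    have eq: "Gamma (1 - (\<sigma> + 1)) = Gamma (- \<sigma>)" by simp
    have "- (- \<sigma> * A * B * ((1 + \<sigma>) * C) * E) * (\<sigma> + 3/2) * (\<sigma> - 1/2) =
        - (A * ((3/2 + \<sigma>) * B) * C * ((1/2 - \<sigma>) * E)) * (\<sigma> * (\<sigma> + 1))" for A B C E
      by algebra
    thus ?thesis unfolding scat_def 2 4 eq unfolding 1 3 .
  qed
  hence "scat (\<sigma> + 1) = scat \<sigma> * (\<sigma> + 3/2) * (\<sigma> - 1/2) / (\<sigma> * (\<sigma> + 1))"
    using nz by (subst eq_divide_eq) auto
  thus ?thesis unfolding 5 by (simp add: mult.assoc)
qed

text \<open>On this line conjugation pairs the Gamma factors: their moduli cancel and |1 + i t| /
  |1/2 + i t| <= 2 remains.\<close>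

lemma norm_scat_half: "norm (scat (1/2 + \<i> * of_real t)) \<le> 2"
proof -
  define u where "u = \<i> * complex_of_real t"
  have "1/2 + u \<notin> \<int>\<^sub>\<le>\<^sub>0" "1 + u \<notin> \<int>\<^sub>\<le>\<^sub>0"
    by (auto elim!: nonpos_Ints_cases simp: complex_eq_iff u_def)
  hence 1: "Gamma (2 + u) = (1 + u) * Gamma (1 + u)" "Gamma (3/2 + u) = (1/2 + u) * Gamma (1/2 + u)"
    using Gamma_plus1[of "1 + u"] Gamma_plus1[of "1/2 + u"] by (simp_all add: algebra_simps)
  have nz: "Gamma (1 + u) \<noteq> 0" "Gamma (1/2 + u) \<noteq> 0"
    using Gamma_mult_rGamma[of "1 + u"] Gamma_mult_rGamma[of "1/2 + u"] by (auto simp: u_def)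
  have n: "norm (Gamma (1/2 - u)) = norm (Gamma (1/2 + u))" "norm (Gamma (1 - u)) = norm (Gamma (1 + u))"
    using complex_mod_cnj[of "Gamma (1/2 + u)"] complex_mod_cnj[of "Gamma (1 + u)"]
    by (simp_all add: u_def cnj_Gamma)
  have "norm (scat (1/2 + u)) = norm (1 + u) / norm (1/2 + u)"
  proof -
    have "norm (scat (1/2 + u)) =
        norm (Gamma (1/2 - u)) * norm (Gamma (2 + u)) * norm (rGamma (3/2 + u)) * norm (rGamma (1 - u))"
      unfolding scat_def norm_minus_cancel norm_mult by (simp add: algebra_simps)
    also have "\<dots> = norm (Gamma (1/2 + u)) * (norm (1 + u) * norm (Gamma (1 + u))) *
        inverse (norm (1/2 + u) * norm (Gamma (1/2 + u))) * inverse (norm (Gamma (1 + u)))"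
      unfolding rGamma_inverse_Gamma norm_inverse 1 n norm_mult by simp
    also have "\<dots> = norm (1 + u) / norm (1/2 + u)"
    proof -
      have "G * (a * H) * inverse (b * G) * inverse H = a / b" if "G \<noteq> 0" "H \<noteq> 0" for G H a b :: real
        using that by (simp add: field_simps)
      thus ?thesis using nz by simp
    qed
    finally show ?thesis .
  qed
  also have "norm (1 + u) \<le> norm (2 * (1/2 + u))"
    unfolding cmod_def by (intro real_sqrt_le_mono) (auto simp: u_def power2_eq_square)
  hence "norm (1 + u) \<le> 2 * norm (1/2 + u)"
    by (simp only: norm_mult) simp
  hence "norm (1 + u) / norm (1/2 + u) \<le> 2"
    by (simp add: divide_le_eq)
  finally show ?thesis by (simp add: u_def)
qed

text \<open>Starting at Re \<sigma> = 1/2, each unit shift costs a factor at most exp d with d =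
  (3/4) * (1/(M + 1/2) - 1/(M + 3/2)); the sum of the d telescopes and stays below 3/2.\<close>

lemma norm_scat_vertical: "norm (scat (of_nat M + 1/2 + \<i> * of_real t)) \<le> 2 * exp (3/2)"
proof -
  have "norm (scat (of_nat M + 1/2 + \<i> * of_real t)) \<le> 2 * exp (3/4 * (2 - 1 / (real M + 1/2)))"
  proof (induction M)
    case 0
    then show ?case using norm_scat_half[of t] by simp
  next
    case (Suc M)
    define \<sigma> where "\<sigma> = of_nat M + 1/2 + \<i> * complex_of_real t"
    have "\<sigma> \<notin> \<int>"
    proof
      assume "\<sigma> \<in> \<int>"
      then obtain k where "\<sigma> = of_int k" by (auto elim: Ints_cases)
      hence "real M + 1/2 = of_int k" by (simp add: \<sigma>_def complex_eq_iff)
      hence "2 * int M + 1 = 2 * k" by linarith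
      thus False by presburger
    qed
    hence eq: "scat (\<sigma> + 1) = scat \<sigma> * (1 - (3/4) / (\<sigma> * (\<sigma> + 1)))"
      by (intro scat_plus_one) (auto simp: \<sigma>_def)
    define d where "d = (3/4) / ((real M + 1/2) * (real M + 3/2))"
    have r: "norm \<sigma> \<ge> real M + 1/2" "norm (\<sigma> + 1) \<ge> real M + 3/2"
      using complex_Re_le_cmod[of \<sigma>] complex_Re_le_cmod[of "\<sigma> + 1"] by (auto simp: \<sigma>_def)
    have "norm ((3/4) / (\<sigma> * (\<sigma> + 1))) = (3/4) / (norm \<sigma> * norm (\<sigma> + 1))"
      unfolding norm_divide norm_mult by simp
    also have "\<dots> \<le> d"
      unfolding d_def using r by (intro divide_left_mono mult_mono mult_pos_pos) auto
    finally have "norm (1 - (3/4) / (\<sigma> * (\<sigma> + 1))) \<le> 1 + d"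
      using norm_triangle_ineq4[of 1 "(3/4) / (\<sigma> * (\<sigma> + 1))"] by simp
    also have "\<dots> \<le> exp d" by (rule exp_ge_add_one_self)
    finally have "norm (scat (\<sigma> + 1)) \<le> 2 * exp (3/4 * (2 - 1 / (real M + 1/2))) * exp d"
      unfolding eq norm_mult using Suc by (intro mult_mono) (auto simp: \<sigma>_def)
    also have "\<dots> = 2 * exp (3/4 * (2 - 1 / (real M + 1/2)) + d)"
      by (simp add: exp_add)
    also have "3/4 * (2 - 1 / (real M + 1/2)) + d = 3/4 * (2 - 1 / (real (Suc M) + 1/2))"
      unfolding d_def by (simp add: divide_simps) (simp add: algebra_simps)
    finally show ?case by (simp add: \<sigma>_def add_ac)
  qed
  also have "\<dots> \<le> 2 * exp (3/2)" by simp
  finally show ?thesis .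
qed

text \<open>The arguments in \<open>Gamma (1 - \<sigma>)\<close>,
  \<open>rGamma (3/2 - \<sigma>)\<close> and in \<open>Gamma (3/2 + \<sigma>)\<close>,
  \<open>rGamma (1 + \<sigma>)\<close> differ by 1/2. In the second pair the numerator has the
  larger argument, so a further half step up to 2 + \<sigma> is taken, which leaves the factor 1 +
  \<sigma>.\<close>

lemma norm_scat_strip:
  assumes "\<bar>Re \<sigma>\<bar> \<le> 1/2"
  shows "norm (scat \<sigma>) \<le> pi * (1 + norm \<sigma>)"
proof -
  have "norm (Gamma (1 - \<sigma>)) \<le> sqrt pi * norm (Gamma (3/2 - \<sigma>))"
    using norm_Gamma_le_Gamma_plus_half[of "1 - \<sigma>"] assms by (simp add: algebra_simps)
  hence "norm (Gamma (1 - \<sigma>)) * norm (rGamma (3/2 - \<sigma>)) \<le>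
      sqrt pi * norm (Gamma (3/2 - \<sigma>)) * norm (rGamma (3/2 - \<sigma>))"
    by (rule mult_right_mono) auto
  also have "\<dots> = sqrt pi"
    using Gamma_mult_rGamma[of "3/2 - \<sigma>"] assms by (simp add: mult.assoc flip: norm_mult)
  finally have 1: "norm (Gamma (1 - \<sigma>)) * norm (rGamma (3/2 - \<sigma>)) \<le> sqrt pi" .
  have nz: "1 + \<sigma> \<notin> \<int>\<^sub>\<le>\<^sub>0" using assms by (auto elim!: nonpos_Ints_cases simp: complex_eq_iff)
  have "norm (Gamma (3/2 + \<sigma>)) \<le> sqrt pi * norm (Gamma (2 + \<sigma>))"
    using norm_Gamma_le_Gamma_plus_half[of "3/2 + \<sigma>"] assms by (simp add: algebra_simps)
  also have "Gamma (2 + \<sigma>) = (1 + \<sigma>) * Gamma (1 + \<sigma>)"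
    using Gamma_plus1[OF nz] by (simp add: algebra_simps)
  finally have "norm (Gamma (3/2 + \<sigma>)) * norm (rGamma (1 + \<sigma>)) \<le>
      sqrt pi * norm ((1 + \<sigma>) * Gamma (1 + \<sigma>)) * norm (rGamma (1 + \<sigma>))"
    by (rule mult_right_mono) auto
  also have "\<dots> = sqrt pi * norm (1 + \<sigma>)"
    using Gamma_mult_rGamma[of "1 + \<sigma>"] assms by (simp add: mult.assoc flip: norm_mult)
  also have "\<dots> \<le> sqrt pi * (1 + norm \<sigma>)"
    using norm_triangle_ineq[of 1 \<sigma>] by (intro mult_left_mono) auto
  finally have 2: "norm (Gamma (3/2 + \<sigma>)) * norm (rGamma (1 + \<sigma>)) \<le> sqrt pi * (1 + norm \<sigma>)" .
  have "sqrt pi * (sqrt pi * (1 + norm \<sigma>)) = pi * (1 + norm \<sigma>)"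
    by (simp flip: mult.assoc)
  with mult_mono[OF 1 2] show ?thesis
    unfolding scat_def norm_minus_cancel norm_mult by (simp add: mult_ac)
qed

text \<open>At distance at least 1 from the real axis a unit shift multiplies by at most 1 + 3/4 <=
  2. Growth in m is harmless because m stays fixed while the height of the contour tends to
  infinity.\<close>

lemma norm_scat_horizontal:
  assumes "\<bar>Im \<sigma>\<bar> \<ge> 1" "Re \<sigma> \<ge> -1/2" "Re \<sigma> \<le> real m + 1/2"
  shows "norm (scat \<sigma>) \<le> 2 ^ m * (pi * (1 + norm \<sigma>))"
  using assms
proof (induction m arbitrary: \<sigma>)
  case 0
  then show ?case using norm_scat_strip[of \<sigma>] by simp
next
  case (Suc m)
  show ?case
  proof (cases "Re \<sigma> \<le> 1/2")
    case True
    have "norm (scat \<sigma>) \<le> 1 * (pi * (1 + norm \<sigma>))"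
      using norm_scat_strip[of \<sigma>] True Suc.prems by simp
    also have "\<dots> \<le> 2 ^ Suc m * (pi * (1 + norm \<sigma>))"
      by (intro mult_right_mono one_le_power) auto
    finally show ?thesis .
  next
    case False
    define \<tau> where "\<tau> = \<sigma> - 1"
    have \<sigma>: "\<sigma> = \<tau> + 1" by (simp add: \<tau>_def)
    have \<tau>: "\<bar>Im \<tau>\<bar> \<ge> 1" "Re \<tau> \<ge> -1/2" "Re \<tau> \<le> real m + 1/2"
      using Suc.prems False by (auto simp: \<tau>_def)
    have "\<tau> \<notin> \<int>" using \<tau>(1) by (auto elim!: Ints_cases)
    hence eq: "scat \<sigma> = scat \<tau> * (1 - (3/4) / (\<tau> * (\<tau> + 1)))"
      unfolding \<sigma> using \<tau> by (intro scat_plus_one) auto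
    have r: "norm \<tau> \<ge> 1" "norm (\<tau> + 1) \<ge> 1"
      using abs_Im_le_cmod[of \<tau>] abs_Im_le_cmod[of "\<tau> + 1"] \<tau> by auto
    hence "norm \<tau> * norm (\<tau> + 1) \<ge> 1 * 1"
      by (intro mult_mono) auto
    hence "norm ((3/4) / (\<tau> * (\<tau> + 1))) \<le> 3/4"
      unfolding norm_divide norm_mult by (intro divide_le_eq[THEN iffD2]) auto
    hence b: "norm (1 - (3/4) / (\<tau> * (\<tau> + 1))) \<le> 2"
      using norm_triangle_ineq4[of 1 "(3/4) / (\<tau> * (\<tau> + 1))"] by simp
    have "(Re \<tau>)\<^sup>2 \<le> (Re \<sigma>)\<^sup>2"
      unfolding abs_le_square_iff[symmetric] using \<tau> by (auto simp: \<sigma>)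
    hence "norm \<tau> \<le> norm \<sigma>"
      unfolding cmod_def by (simp add: \<sigma>)
    hence "norm (scat \<tau>) \<le> 2 ^ m * (pi * (1 + norm \<sigma>))"
      by (intro order_trans[OF Suc.IH[OF \<tau>]] mult_left_mono) auto
    hence "norm (scat \<sigma>) \<le> 2 ^ m * (pi * (1 + norm \<sigma>)) * 2"
      unfolding eq norm_mult using b by (intro mult_mono) auto
    thus ?thesis by simp
  qed
qed

text \<open>3/2 - \<sigma> = 1 - N is a pole of Gamma; for N = 0 it would be the regular point
  1.\<close>

lemma scat_zero: "N \<ge> 1 \<Longrightarrow> scat (of_nat N + 1/2) = 0"
proof -
  assume "N \<ge> 1"
  hence "(3/2 - (of_nat N + 1/2)) = - (of_nat (N - 1) :: complex)"
    by (simp add: of_nat_diff)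
  hence "rGamma (3/2 - (of_nat N + 1/2) :: complex) = 0"
    by (simp only: rGamma_eq_zero_iff) simp
  thus ?thesis by (simp add: scat_def)
qed

section \<open>Analytic continuation of the regular solution\<close>

text \<open>Coefficients of the regularised hypergeometric function: the factor rGamma (1 +
  \<sigma>) removes the poles of \<open>jost_coeff\<close>, so each coefficient is entire in
  \<sigma>.\<close>

definition reg_coeff :: "nat \<Rightarrow> complex \<Rightarrow> complex" where
  "reg_coeff n \<sigma> = pochhammer (\<sigma> - 1/2) n * rGamma (1 + \<sigma> + of_nat n)"

definition reg_series :: "complex \<Rightarrow> real \<Rightarrow> complex" where
  "reg_series \<sigma> z = (\<Sum>n. of_real (half_coeff n) * reg_coeff n \<sigma> * of_real z ^ n)"

lemma reg_coeff_eq_jost_coeff: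
  assumes "1 + \<sigma> \<notin> \<int>\<^sub>\<le>\<^sub>0"
  shows "reg_coeff n \<sigma> = rGamma (1 + \<sigma>) * jost_coeff n \<sigma>"
proof -
  have "pochhammer (1 + \<sigma>) n \<noteq> 0"
    using assms by (auto dest: pochhammer_eq_0_imp_nonpos_Int)
  thus ?thesis
    using pochhammer_rGamma[of "1 + \<sigma>" n] by (simp add: reg_coeff_def jost_coeff_def)
qed

lemma norm_reg_coeff_step:
  assumes "Re \<sigma> + real n > -1/4"
  shows "norm (reg_coeff (Suc n) \<sigma>) \<le> norm (reg_coeff n \<sigma>)"
proof -
  have nz: "\<sigma> + of_nat n + 1 \<noteq> 0" using assms by (auto simp: complex_eq_iff)
  have "rGamma (1 + \<sigma> + of_nat n) = (\<sigma> + of_nat n + 1) * rGamma (1 + \<sigma> + of_nat (Suc n))"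
    using rGamma_plus1[of "1 + \<sigma> + of_nat n"] by (simp add: add_ac)
  moreover have "p * (\<sigma> - 1/2 + of_nat n) * r =
      p * ((\<sigma> + of_nat n + 1) * r) * ((\<sigma> + of_nat n - 1/2) / (\<sigma> + of_nat n + 1))" for p r
  proof -
    have "\<sigma> - 1/2 + of_nat n = \<sigma> + of_nat n - 1/2" by simp
    thus ?thesis using nz by simp
  qed
  ultimately have "reg_coeff (Suc n) \<sigma> = reg_coeff n \<sigma> * ((\<sigma> + of_nat n - 1/2) / (\<sigma> + of_nat n + 1))"
    by (simp only: reg_coeff_def pochhammer_Suc)
  moreover have "norm ((\<sigma> + of_nat n - 1/2) / (\<sigma> + of_nat n + 1)) \<le> 1"
    by (rule norm_quot_le_one) (use assms in auto)
  ultimately show ?thesis by (simp only: norm_mult mult_left_le norm_ge_zero)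
qed

lemma holomorphic_pochhammer [holomorphic_intros]:
  "f holomorphic_on A \<Longrightarrow> (\<lambda>z. pochhammer (f z) n) holomorphic_on A"
  unfolding pochhammer_prod by (intro holomorphic_intros)

lemma holomorphic_reg_coeff: "reg_coeff n holomorphic_on A"
  unfolding reg_coeff_def by (intro holomorphic_intros)

text \<open>The coefficients up to an index m beyond |Re a| + r are bounded by compactness of the
  disc; after m their moduli decrease. Hence one bound serves for all n.\<close>

lemma reg_coeff_bounded:
  obtains K where "\<And>n \<sigma>. \<sigma> \<in> cball a r \<Longrightarrow> norm (reg_coeff n \<sigma>) \<le> K"
proof -
  have "\<exists>K. \<forall>\<sigma>\<in>cball a r. norm (reg_coeff n \<sigma>) \<le> K" for n
  proof -
    have "compact (reg_coeff n ` cball a r)"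
      by (intro compact_continuous_image holomorphic_on_imp_continuous_on holomorphic_reg_coeff) auto
    thus ?thesis using compact_imp_bounded bounded_iff by (metis imageI)
  qed
  then obtain K where K: "\<And>n \<sigma>. \<sigma> \<in> cball a r \<Longrightarrow> norm (reg_coeff n \<sigma>) \<le> K n"
    by metis
  obtain m :: nat where m: "real m > \<bar>Re a\<bar> + r" using reals_Archimedean2 by blast
  define B where "B = (\<Sum>j\<le>m. \<bar>K j\<bar>)"
  have KB: "K j \<le> B" if "j \<le> m" for j
    using member_le_sum[of j "{..m}" "\<lambda>j. \<bar>K j\<bar>"] that by (auto simp: B_def)
  have "norm (reg_coeff n \<sigma>) \<le> B" if s: "\<sigma> \<in> cball a r" for n \<sigma>
  proof (cases "n \<le> m")
    case True
    thus ?thesis using K[OF s, of n] KB[of n] by linarith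
  next
    case False
    have "\<bar>Re (a - \<sigma>)\<bar> \<le> r"
      using abs_Re_le_cmod[of "a - \<sigma>"] s by (simp add: dist_norm)
    hence re: "Re \<sigma> + real m > -1/4" using m by auto
    have "norm (reg_coeff (m + k) \<sigma>) \<le> B" for k
    proof (induction k)
      case 0
      then show ?case using K[OF s, of m] KB[of m] by simp
    next
      case (Suc k)
      thus ?case using norm_reg_coeff_step[of \<sigma> "m + k"] re by simp
    qed
    from this[of "n - m"] show ?thesis using False by simp
  qed
  thus ?thesis using that by blast
qed

lemma holomorphic_reg_series:
  assumes "0 \<le> z" "z < 1"
  shows "(\<lambda>\<sigma>. reg_series \<sigma> z) holomorphic_on UNIV"
proof (rule holomorphic_uniform_sequence)
  show "(\<lambda>\<sigma>. \<Sum>n<N. of_real (half_coeff n) * reg_coeff n \<sigma> * of_real z ^ n) holomorphic_on UNIV" for N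
    by (intro holomorphic_intros holomorphic_reg_coeff)
  fix a :: complex
  obtain K where K: "\<And>n \<sigma>. \<sigma> \<in> cball a 1 \<Longrightarrow> norm (reg_coeff n \<sigma>) \<le> K"
    using reg_coeff_bounded by blast
  have "uniform_limit (cball a 1) (\<lambda>N \<sigma>. \<Sum>n<N. of_real (half_coeff n) * reg_coeff n \<sigma> * of_real z ^ n)
      (\<lambda>\<sigma>. \<Sum>n. of_real (half_coeff n) * reg_coeff n \<sigma> * of_real z ^ n) sequentially"
  proof (rule Weierstrass_m_test)
    show "summable (\<lambda>n. K * z ^ n)"
      using assms by (intro summable_mult summable_geometric) auto
    fix n \<sigma> assume s: "\<sigma> \<in> cball a 1"
    have "\<bar>half_coeff n\<bar> * norm (reg_coeff n \<sigma>) * z ^ n \<le> 1 * K * z ^ n"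
      using assms K[OF s, of n] abs_half_coeff_le order_trans[OF norm_ge_zero K[OF s, of n]]
      by (intro mult_mono) auto
    thus "norm (of_real (half_coeff n) * reg_coeff n \<sigma> * of_real z ^ n) \<le> K * z ^ n"
      using assms by (simp add: norm_mult norm_power)
  qed
  thus "\<exists>d>0. cball a d \<subseteq> UNIV \<and> uniform_limit (cball a d)
      (\<lambda>N \<sigma>. \<Sum>n<N. of_real (half_coeff n) * reg_coeff n \<sigma> * of_real z ^ n) (\<lambda>\<sigma>. reg_series \<sigma> z) sequentially"
    unfolding reg_series_def by (intro exI[of _ 1]) auto
qed auto

lemma reg_series_summable:
  assumes "0 \<le> z" "z < 1"
  shows "summable (\<lambda>n. of_real (half_coeff n) * reg_coeff n \<sigma> * of_real z ^ n)"
proof -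
  obtain K where K: "\<And>n s. s \<in> cball \<sigma> 1 \<Longrightarrow> norm (reg_coeff n s) \<le> K"
    using reg_coeff_bounded by blast
  have "norm (reg_coeff n \<sigma>) \<le> K" for n by (rule K) simp
  note K = this
  show ?thesis
  proof (rule summable_comparison_test')
    show "summable (\<lambda>n. K * z ^ n)"
      using assms by (intro summable_mult summable_geometric) auto
    fix n :: nat
    have "\<bar>half_coeff n\<bar> * norm (reg_coeff n \<sigma>) * z ^ n \<le> 1 * K * z ^ n"
      using assms K[of n] abs_half_coeff_le order_trans[OF norm_ge_zero K[of n]]
      by (intro mult_mono) auto
    thus "norm (of_real (half_coeff n) * reg_coeff n \<sigma> * of_real z ^ n) \<le> K * z ^ n"
      using assms by (simp add: norm_mult norm_power)
  qed
qed

lemma jost_series_eq_reg_series: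
  assumes "0 \<le> z" "z < 1" "1 + \<sigma> \<notin> \<int>\<^sub>\<le>\<^sub>0"
  shows "jost_series \<sigma> z = Gamma (1 + \<sigma>) * reg_series \<sigma> z"
proof -
  have nz: "Gamma (1 + \<sigma>) \<noteq> 0" using assms by (simp add: Gamma_eq_zero_iff)
  have "jost_coeff n \<sigma> = Gamma (1 + \<sigma>) * reg_coeff n \<sigma>" for n
    unfolding reg_coeff_eq_jost_coeff[OF assms(3)] rGamma_inverse_Gamma using nz by simp
  hence "jost_series \<sigma> z = (\<Sum>n. Gamma (1 + \<sigma>) * (of_real (half_coeff n) * reg_coeff n \<sigma> * of_real z ^ n))"
    unfolding jost_series_def by (intro suminf_cong) (simp add: mult_ac)
  also have "\<dots> = Gamma (1 + \<sigma>) * reg_series \<sigma> z"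
    unfolding reg_series_def by (rule suminf_mult[OF reg_series_summable[OF assms(1,2)]])
  finally show ?thesis .
qed

lemma jost_eq_reg_series:
  assumes "x > 0" "1 + \<sigma> \<notin> \<int>\<^sub>\<le>\<^sub>0"
  shows "jost \<sigma> x = Gamma (1 + \<sigma>) * (exp (- \<sigma> * of_real x) * reg_series \<sigma> (exp (-2*x))) /
      of_real (sqrt (1 - exp (-2*x)))"
  unfolding jost_def using assms by (subst jost_series_eq_reg_series) auto

text \<open>The solution that is regular at the origin is \<open>reg_sol \<sigma> x / rGamma (1 - \<sigma>)\<close>, up to a factor
  depending on \<open>x\<close> only; both numerator and denominator vanish at the positive integers.\<close>
definition reg_sol :: "complex \<Rightarrow> real \<Rightarrow> complex" where
  "reg_sol \<sigma> x = exp (\<sigma> * of_real x) * reg_series (-\<sigma>) (exp (-2*x)) -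
     Gamma (3/2 + \<sigma>) * rGamma (3/2 - \<sigma>) * (exp (- \<sigma> * of_real x) * reg_series \<sigma> (exp (-2*x)))"

text \<open>The rGamma (1 + \<sigma>) in \<open>scat\<close> cancels the Gamma (1 + \<sigma>) of
  \<open>jost\<close>, so the poles at positive integers are all collected in the common factor
  Gamma (1 - \<sigma>), written as a division by \<open>rGamma\<close>.\<close>

lemma regular_combination_eq:
  assumes "x > 0" "Re \<sigma> > -1/4" "1 - \<sigma> \<notin> \<int>\<^sub>\<le>\<^sub>0"
  shows "jost (-\<sigma>) x + scat \<sigma> * jost \<sigma> x = reg_sol \<sigma> x / rGamma (1 - \<sigma>) / of_real (sqrt (1 - exp (-2*x)))"
proof -
  have *: "1 + \<sigma> \<notin> \<int>\<^sub>\<le>\<^sub>0" using assms by (auto elim!: nonpos_Ints_cases simp: complex_eq_iff)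
  have "Gamma (1 + \<sigma>) * rGamma (1 + \<sigma>) = 1"
    by (rule Gamma_mult_rGamma) (use assms in auto)
  hence "scat \<sigma> * Gamma (1 + \<sigma>) = - (Gamma (1 - \<sigma>) * (Gamma (3/2 + \<sigma>) * rGamma (3/2 - \<sigma>)))"
    by (simp add: scat_def mult_ac)
  hence s: "scat \<sigma> * (Gamma (1 + \<sigma>) * w) = - (Gamma (1 - \<sigma>) * (Gamma (3/2 + \<sigma>) * rGamma (3/2 - \<sigma>) * w))" for w
    by (simp add: mult_ac)
  have g: "w / rGamma (1 - \<sigma>) = Gamma (1 - \<sigma>) * w" for w
    by (simp only: rGamma_inverse_Gamma divide_inverse inverse_inverse_eq mult.commute)
  have "jost (-\<sigma>) x = Gamma (1 - \<sigma>) * (exp (\<sigma> * of_real x) * reg_series (-\<sigma>) (exp (-2*x))) /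
      of_real (sqrt (1 - exp (-2*x)))"
    using jost_eq_reg_series[of x "-\<sigma>"] assms by simp
  moreover have "scat \<sigma> * jost \<sigma> x = - (Gamma (1 - \<sigma>) * (Gamma (3/2 + \<sigma>) * rGamma (3/2 - \<sigma>) *
      (exp (- \<sigma> * of_real x) * reg_series \<sigma> (exp (-2*x))))) / of_real (sqrt (1 - exp (-2*x)))"
    unfolding jost_eq_reg_series[OF assms(1) *] times_divide_eq_right s ..
  ultimately show ?thesis
    unfolding g reg_sol_def
    by (simp only: right_diff_distrib diff_divide_distrib minus_divide_left[symmetric] add_uminus_conv_diff)
qed

text \<open>The left side arises from shifting the regularised series at -m by m terms, the right
  side is the coefficient in \<open>reg_sol\<close>. Reversing each Pochhammer symbol costs a sign
  (-1)^m, and the two signs cancel.\<close>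

lemma pochhammer_shift:
  "pochhammer (-1/2 :: complex) m * pochhammer (- of_nat m - 1/2) m = Gamma (3/2 + of_nat m) * rGamma (3/2 - of_nat m)"
proof -
  have "pochhammer (- of_nat m - 1/2 :: complex) m = (-1) ^ m * pochhammer (3/2) m"
    using pochhammer_minus[of "of_nat m + 1/2 :: complex" m] by simp
  also have "pochhammer (3/2 :: complex) m = Gamma (3/2 + of_nat m) / Gamma (3/2)"
    by (rule pochhammer_Gamma) (auto elim!: nonpos_Ints_cases simp: complex_eq_iff)
  finally have 1: "pochhammer (- of_nat m - 1/2 :: complex) m = (-1) ^ m * (Gamma (3/2 + of_nat m) / Gamma (3/2))" .
  have "pochhammer (-1/2 :: complex) m = (-1) ^ m * pochhammer (3/2 - of_nat m) m"
    using pochhammer_minus[of "1/2 :: complex" m] by (simp add: algebra_simps)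
  hence 2: "pochhammer (-1/2 :: complex) m * rGamma (3/2) = (-1) ^ m * rGamma (3/2 - of_nat m)"
    using pochhammer_rGamma[of "3/2 - of_nat m :: complex" m] by simp
  have "pochhammer (-1/2 :: complex) m * pochhammer (- of_nat m - 1/2) m =
      (pochhammer (-1/2 :: complex) m * rGamma (3/2)) * ((-1) ^ m * Gamma (3/2 + of_nat m))"
  proof -
    have "p * (e * (G / H)) = (p * inverse H) * (e * G)" for p e G H :: complex
      by (simp add: divide_inverse mult_ac)
    thus ?thesis unfolding 1 rGamma_inverse_Gamma .
  qed
  also have "\<dots> = ((-1) ^ m * (-1) ^ m) * (Gamma (3/2 + of_nat m) * rGamma (3/2 - of_nat m))"
    unfolding 2 by (simp only: mult_ac)
  also have "(-1) ^ m * (-1 :: complex) ^ m = 1" by (simp flip: power_mult_distrib)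
  finally show ?thesis by simp
qed

text \<open>When the lower parameter is 1 - m, the regularised series loses its first m terms and
  the rest is a multiple of the series at +m. The two solutions become proportional, and
  \<open>reg_sol\<close> is the combination that then vanishes.\<close>

lemma reg_sol_of_nat:
  assumes "x > 0" "m \<ge> 1"
  shows "reg_sol (of_nat m) x = 0"
proof -
  define z where "z = exp (-2*x)"
  have z: "0 \<le> z" "z < 1" using assms by (auto simp: z_def)
  define C where "C = Gamma (3/2 + of_nat m) * rGamma (3/2 - of_nat m :: complex)"
  define f where "f = (\<lambda>n. of_real (half_coeff n) * reg_coeff n (- of_nat m) * complex_of_real z ^ n)"
  have zero: "f n = 0" if "n < m" for n
  proof -
    have "1 + - of_nat m + of_nat n = - (of_nat (m - 1 - n) :: complex)"
      using that by (simp add: of_nat_diff)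
    hence "rGamma (1 + - of_nat m + of_nat n :: complex) = 0"
      by (simp only: rGamma_eq_zero_iff) simp
    thus ?thesis by (simp add: f_def reg_coeff_def)
  qed
  have shift: "f (k + m) = (C * of_real z ^ m) * (of_real (half_coeff k) * reg_coeff k (of_nat m) * of_real z ^ k)" for k
  proof -
    have hc: "of_real (half_coeff n) = pochhammer (-1/2 :: complex) n / fact n" for n
      by (simp add: half_coeff_def pochhammer_of_real[symmetric])
    have r1: "rGamma (1 + - of_nat m + of_nat (m + k) :: complex) = 1 / fact k"
      using Gamma_fact[of k, where 'a = complex] by (simp add: rGamma_inverse_Gamma inverse_eq_divide)
    have r2: "rGamma (1 + of_nat m + of_nat k :: complex) = 1 / fact (m + k)"
      using Gamma_fact[of "m + k", where 'a = complex] by (simp add: rGamma_inverse_Gamma inverse_eq_divide add_ac)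
    have "f (k + m) = (pochhammer (-1/2) (m + k) / fact (m + k)) *
        (pochhammer (- of_nat m - 1/2) (m + k) * (1 / fact k)) * of_real z ^ (m + k)"
      by (simp only: f_def hc reg_coeff_def r1 add.commute[of k m])
    also have "pochhammer (-1/2 :: complex) (m + k) = pochhammer (-1/2) m * pochhammer (of_nat m - 1/2) k"
    proof -
      have "-1/2 + of_nat m = (of_nat m - 1/2 :: complex)" by simp
      thus ?thesis by (simp only: pochhammer_product')
    qed
    also have "pochhammer (- of_nat m - 1/2 :: complex) (m + k) = pochhammer (- of_nat m - 1/2) m * pochhammer (-1/2) k"
    proof -
      have "- of_nat m - 1/2 + of_nat m = (-1/2 :: complex)" by simp
      thus ?thesis by (simp only: pochhammer_product')
    qed
    also have "pochhammer (-1/2) m * pochhammer (of_nat m - 1/2) k / fact (m + k) *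
        (pochhammer (- of_nat m - 1/2) m * pochhammer (-1/2) k * (1 / fact k)) * complex_of_real z ^ (m + k) =
        (pochhammer (-1/2) m * pochhammer (- of_nat m - 1/2) m) * of_real z ^ m *
        (pochhammer (-1/2) k / fact k * (pochhammer (of_nat m - 1/2) k * (1 / fact (m + k))) * of_real z ^ k)"
      by (simp add: power_add mult_ac)
    also have "\<dots> = (C * of_real z ^ m) * (of_real (half_coeff k) * reg_coeff k (of_nat m) * of_real z ^ k)"
      by (simp only: hc reg_coeff_def r2 C_def pochhammer_shift)
    finally show ?thesis .
  qed
  have sf: "summable f" unfolding f_def by (rule reg_series_summable[OF z])
  have "reg_series (- of_nat m) z = (\<Sum>k. f (k + m)) + (\<Sum>n<m. f n)"
    unfolding reg_series_def f_def[symmetric] by (rule suminf_split_initial_segment[OF sf])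
  also have "(\<Sum>n<m. f n) = 0" using zero by simp
  also have "(\<Sum>k. f (k + m)) = (C * of_real z ^ m) * reg_series (of_nat m) z"
    unfolding shift reg_series_def by (rule suminf_mult[OF reg_series_summable[OF z]])
  finally have eq: "reg_series (- of_nat m) z = (C * of_real z ^ m) * reg_series (of_nat m) z" by simp
  \<comment> \<open>The power z^m = exp (-2 m x) produced by the shift turns exp (m x) into exp (-m
    x).\<close>
  have "exp (of_nat m * complex_of_real x) * of_real z ^ m = exp (- of_nat m * of_real x)"
  proof -
    have "z ^ m = exp (real m * (-2*x))"
      unfolding z_def by (rule exp_of_nat_mult[symmetric])
    hence "complex_of_real z ^ m = exp (of_nat m * of_real (-2*x))"
      by (simp flip: of_real_power exp_of_real)
    thus ?thesis by (simp add: algebra_simps flip: exp_add)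
  qed
  thus ?thesis
    unfolding reg_sol_def z_def[symmetric] eq by (simp add: C_def mult_ac)
qed

lemma holomorphic_reg_sol:
  assumes "x > 0"
  shows "(\<lambda>\<sigma>. reg_sol \<sigma> x) holomorphic_on {\<sigma>. Re \<sigma> > -1/4}"
proof -
  have h: "(\<lambda>\<sigma>. reg_series \<sigma> (exp (-2*x))) holomorphic_on UNIV"
    by (rule holomorphic_reg_series) (use assms in auto)
  have h1: "(\<lambda>\<sigma>. reg_series \<sigma> (exp (-2*x))) holomorphic_on {\<sigma>. Re \<sigma> > -1/4}"
    by (rule holomorphic_on_subset[OF h]) auto
  have "((\<lambda>\<sigma>. reg_series \<sigma> (exp (-2*x))) \<circ> uminus) holomorphic_on {\<sigma>. Re \<sigma> > -1/4}"
    by (rule holomorphic_on_compose_gen[OF _ h]) (auto intro: holomorphic_intros)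
  hence h2: "(\<lambda>\<sigma>. reg_series (-\<sigma>) (exp (-2*x))) holomorphic_on {\<sigma>. Re \<sigma> > -1/4}"
    by (simp add: o_def)
  show ?thesis unfolding reg_sol_def
    by (intro holomorphic_intros h1 h2) (auto elim!: nonpos_Ints_cases simp: complex_eq_iff)
qed

lemma holomorphic_jost:
  assumes "x > 0"
  shows "(\<lambda>\<sigma>. jost \<sigma> x) holomorphic_on {\<sigma>. Re \<sigma> > -1/4}"
proof -
  have h: "(\<lambda>\<sigma>. reg_series \<sigma> (exp (-2*x))) holomorphic_on {\<sigma>. Re \<sigma> > -1/4}"
    by (rule holomorphic_on_subset[OF holomorphic_reg_series]) (use assms in auto)
  have n: "1 + \<sigma> \<notin> \<int>\<^sub>\<le>\<^sub>0" if "\<sigma> \<in> {\<sigma>. Re \<sigma> > -1/4}" for \<sigma>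
    using that by (auto elim!: nonpos_Ints_cases simp: complex_eq_iff)
  have "(\<lambda>\<sigma>. Gamma (1 + \<sigma>) * (exp (- \<sigma> * of_real x) * reg_series \<sigma> (exp (-2*x))) /
      of_real (sqrt (1 - exp (-2*x)))) holomorphic_on {\<sigma>. Re \<sigma> > -1/4}"
    using assms n by (intro holomorphic_intros h) auto
  thus ?thesis
    by (rule holomorphic_transform) (use n assms in \<open>auto simp: jost_eq_reg_series\<close>)
qed

text \<open>Solution regular at 0, taken at x, times decaying solution, taken at y: for x <= y this
  is the resolvent kernel up to normalisation, continued in \<sigma>.\<close>

definition green_integrand :: "real \<Rightarrow> real \<Rightarrow> complex \<Rightarrow> complex" where
  "green_integrand x y \<sigma> = (jost (-\<sigma>) x + scat \<sigma> * jost \<sigma> x) * jost \<sigma> y"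

text \<open>At the integers 1..M the formula for \<open>green_integrand\<close> only has the default
  values of Gamma and division at poles, so a holomorphic g is constructed by removing the
  singularities: the zero of \<open>reg_sol\<close> cancels that of rGamma (1 - \<sigma>).\<close>

lemma green_integrand_extends:
  assumes "x > 0" "y > 0"
  obtains g where "g holomorphic_on {\<sigma>. Re \<sigma> > -1/4 \<and> Re \<sigma> < real M + 1}"
    "\<And>\<sigma>. Re \<sigma> > -1/4 \<Longrightarrow> Re \<sigma> < real M + 1 \<Longrightarrow> \<sigma> \<notin> of_nat ` {1..M} \<Longrightarrow> g \<sigma> = green_integrand x y \<sigma>"
proof -
  define S where "S = {\<sigma>. Re \<sigma> > -1/4 \<and> Re \<sigma> < real M + 1}"
  define X :: "complex set" where "X = of_nat ` {1..M}"
  define f where "f \<sigma> = reg_sol \<sigma> x / rGamma (1 - \<sigma>) / of_real (sqrt (1 - exp (-2*x))) * jost \<sigma> y" for \<sigma>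
  have opS: "open S"
    unfolding S_def by (intro open_Collect_conj open_halfspace_Re_gt open_halfspace_Re_lt)
  have np: "1 - \<sigma> \<notin> \<int>\<^sub>\<le>\<^sub>0" if "\<sigma> \<in> S - X" for \<sigma>
  proof
    assume "1 - \<sigma> \<in> \<int>\<^sub>\<le>\<^sub>0"
    then obtain k where k: "1 - \<sigma> = - of_nat k" by (auto elim!: nonpos_Ints_cases')
    hence s: "\<sigma> = of_nat (Suc k)" by (simp add: algebra_simps)
    hence "Suc k \<in> {1..M}" using that by (auto simp: S_def)
    thus False using that s unfolding X_def by blast
  qed
  have hs: "(\<lambda>\<sigma>. reg_sol \<sigma> x) holomorphic_on S" "(\<lambda>\<sigma>. jost \<sigma> y) holomorphic_on S"
    by (rule holomorphic_on_subset[OF holomorphic_reg_sol] holomorphic_on_subset[OF holomorphic_jost];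
        use assms in \<open>auto simp: S_def\<close>)+
  have hr: "(\<lambda>\<sigma>. rGamma (1 - \<sigma>)) holomorphic_on S"
    by (intro holomorphic_intros)
  have "\<exists>g. g holomorphic_on S \<and> (\<forall>\<sigma>\<in>S - X. g \<sigma> = f \<sigma>)"
  proof (rule removable_singularities)
    show "finite X" by (simp add: X_def)
    show "X \<subseteq> interior S" using opS by (auto simp: interior_open X_def S_def)
    show "f holomorphic_on S - X" unfolding f_def
      using np assms by (intro holomorphic_intros holomorphic_on_subset[OF hs(1)] holomorphic_on_subset[OF hs(2)])
         (auto simp: rGamma_eq_zero_iff)
    fix a assume "a \<in> X"
    then obtain m where m: "a = of_nat m" "m \<in> {1..M}" by (auto simp: X_def)
    have aS: "a \<in> S" using m by (auto simp: S_def)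
    define k where "k = m - 1"
    have ak: "1 - a = - of_nat k" using m by (simp add: k_def of_nat_diff)
    \<comment> \<open>The derivative of \<open>rGamma\<close> at -k is (-1)^k * k!, hence the zero
      is simple and l'Hopital's rule gives a finite limit.\<close>
    have "((\<lambda>\<sigma>. rGamma (1 - \<sigma>)) has_field_derivative ((-1) ^ k * fact k) * (0 - 1)) (at a)"
    proof (rule DERIV_chain2[where f = rGamma and g = "\<lambda>\<sigma>. 1 - \<sigma>"])
      show "(rGamma has_field_derivative ((-1) ^ k * fact k)) (at (1 - a))"
        unfolding ak by (rule has_field_derivative_rGamma_nonpos_int)
    qed (intro derivative_intros)
    moreover have "((\<lambda>\<sigma>. reg_sol \<sigma> x) has_field_derivative deriv (\<lambda>\<sigma>. reg_sol \<sigma> x) a) (at a)"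
      using hs(1) opS aS by (rule holomorphic_derivI)
    moreover have "reg_sol a x = 0" using reg_sol_of_nat[of x m] assms m by simp
    moreover have "rGamma (1 - a) = 0" unfolding ak by (simp add: rGamma_eq_zero_iff)
    ultimately have l: "((\<lambda>\<sigma>. reg_sol \<sigma> x / rGamma (1 - \<sigma>)) \<longlongrightarrow>
        deriv (\<lambda>\<sigma>. reg_sol \<sigma> x) a / (((-1) ^ k * fact k) * (0 - 1))) (at a)"
      by (intro lhopital_complex_simple[where z = a]) auto
    have "isCont (\<lambda>\<sigma>. jost \<sigma> y) a"
      using holomorphic_on_imp_continuous_on[OF hs(2)] opS aS continuous_on_eq_continuous_at by blast
    hence j: "((\<lambda>\<sigma>. jost \<sigma> y) \<longlongrightarrow> jost a y) (at a)" by (simp add: isCont_def)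
    have "(f \<longlongrightarrow> deriv (\<lambda>\<sigma>. reg_sol \<sigma> x) a / (((-1) ^ k * fact k) * (0 - 1)) /
        of_real (sqrt (1 - exp (-2*x))) * jost a y) (at a)"
      unfolding f_def by (rule tendsto_mult[OF tendsto_divide[OF l tendsto_const] j]) (use assms in auto)
    hence "((\<lambda>\<sigma>. f \<sigma> / 1) \<longlongrightarrow> deriv (\<lambda>\<sigma>. reg_sol \<sigma> x) a / (((-1) ^ k * fact k) * (0 - 1)) /
        of_real (sqrt (1 - exp (-2*x))) * jost a y) (at a)" by simp
    thus "f \<in> O[at a](\<lambda>_. 1)" by (rule bigoI_tendsto) auto
  qed
  then obtain g where g: "g holomorphic_on S" "\<forall>\<sigma>\<in>S - X. g \<sigma> = f \<sigma>" by blast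
  show ?thesis
  proof (rule that)
    show "g holomorphic_on {\<sigma>. Re \<sigma> > -1/4 \<and> Re \<sigma> < real M + 1}" using g(1) by (simp add: S_def)
    fix \<sigma> assume "Re \<sigma> > -1/4" "Re \<sigma> < real M + 1" "\<sigma> \<notin> of_nat ` {1..M}"
    hence s: "\<sigma> \<in> S - X" by (auto simp: S_def X_def)
    hence "g \<sigma> = f \<sigma>" using g(2) by blast
    also have "\<dots> = green_integrand x y \<sigma>"
      unfolding f_def green_integrand_def using regular_combination_eq[of x \<sigma>] np[OF s] s assms
      by (simp add: S_def)
    finally show "g \<sigma> = green_integrand x y \<sigma>" .
  qed
qed

section \<open>Bounds for the contour integral\<close>

lemma norm_jost_le:
  assumes "x > 0" "\<And>n. norm (jost_coeff n \<sigma>) \<le> B n" "summable (\<lambda>n. B n * exp (-2*x) ^ n)"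
  shows "norm (jost \<sigma> x) \<le> exp (- Re \<sigma> * x) * ((\<Sum>n. B n * exp (-2*x) ^ n) / sqrt (1 - exp (-2*x)))"
proof -
  have "norm (jost \<sigma> x) = exp (- Re \<sigma> * x) * (norm (jost_series \<sigma> (exp (-2*x))) / sqrt (1 - exp (-2*x)))"
    using assms(1) by (simp add: jost_def norm_mult norm_divide)
  also have "\<dots> \<le> exp (- Re \<sigma> * x) * ((\<Sum>n. B n * exp (-2*x) ^ n) / sqrt (1 - exp (-2*x)))"
    using norm_jost_series_le(2)[OF _ order_refl assms(2,3)] assms(1)
    by (intro mult_left_mono divide_right_mono) auto
  finally show ?thesis .
qed

text \<open>The \<open>1 *\<close> fits \<open>norm_jost_le\<close> with constant majorant. This
  bound and \<open>jost_bound'\<close> are free of M, as the limit M to infinity requires.\<close>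

definition jost_bound :: "real \<Rightarrow> real" where
  "jost_bound x = (\<Sum>n. 1 * exp (-2*x) ^ n) / sqrt (1 - exp (-2*x))"

definition jost_bound' :: "real \<Rightarrow> real" where
  "jost_bound' x = (\<Sum>n. (2 * (real n + 1)\<^sup>2) * exp (-2*x) ^ n) / sqrt (1 - exp (-2*x))"

lemma norm_jost_right:
  assumes "x > 0" "Re \<sigma> \<ge> -1/4"
  shows "norm (jost \<sigma> x) \<le> exp (- Re \<sigma> * x) * jost_bound x"
  unfolding jost_bound_def
  by (rule norm_jost_le) (use assms norm_jost_coeff_le_one in \<open>auto intro!: summable_geometric\<close>)

lemma norm_jost_left_vertical:
  assumes "x > 0" "Re \<sigma> = real M + 1/2"
  shows "norm (jost (-\<sigma>) x) \<le> exp (Re \<sigma> * x) * jost_bound' x"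
proof -
  have "norm (jost (-\<sigma>) x) \<le> exp (- Re (-\<sigma>) * x) * jost_bound' x"
    unfolding jost_bound'_def using assms
    by (intro norm_jost_le norm_jost_coeff_vertical summable_square_power) auto
  thus ?thesis by simp
qed

lemma norm_jost_left_horizontal:
  assumes "x > 0" "\<bar>Im \<sigma>\<bar> \<ge> 1" "Re \<sigma> \<le> real L"
  shows "norm (jost (-\<sigma>) x) \<le> exp (Re \<sigma> * x) * ((\<Sum>n. (5/2) ^ L * exp (-2*x) ^ n) / sqrt (1 - exp (-2*x)))"
proof -
  have "norm (jost (-\<sigma>) x) \<le> exp (- Re (-\<sigma>) * x) * ((\<Sum>n. (5/2) ^ L * exp (-2*x) ^ n) / sqrt (1 - exp (-2*x)))"
    using assms by (intro norm_jost_le norm_jost_coeff_horizontal summable_mult summable_geometric) auto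
  thus ?thesis by simp
qed

lemma jost_bound_nonneg: "x > 0 \<Longrightarrow> jost_bound x \<ge> 0"
  using order_trans[OF norm_ge_zero norm_jost_right[of x 0]] by simp

lemma jost_bound'_nonneg: "x > 0 \<Longrightarrow> jost_bound' x \<ge> 0"
  using order_trans[OF norm_ge_zero norm_jost_left_vertical[of x "1/2" 0]]
  by (simp add: zero_le_mult_iff)

text \<open>The growth exp (L x) of the first factor is absorbed by the decay exp (-L y) of the
  second, since x <= y. What remains does not depend on M.\<close>

lemma green_integrand_vertical:
  assumes "0 < x" "x \<le> y" "Re \<sigma> = real M + 1/2"
  shows "norm (green_integrand x y \<sigma>) \<le> (jost_bound' x + 2 * exp (3/2) * jost_bound x) * jost_bound y"
proof -
  define L where "L = real M + 1/2"
  have L: "L \<ge> 0" "Re \<sigma> = L" using assms by (auto simp: L_def)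
  have "\<sigma> = of_nat M + 1/2 + \<i> * of_real (Im \<sigma>)"
    using assms by (auto simp: complex_eq_iff)
  hence sc: "norm (scat \<sigma>) \<le> 2 * exp (3/2)" using norm_scat_vertical by metis
  have 1: "norm (jost (-\<sigma>) x) \<le> exp (L * x) * jost_bound' x"
    using norm_jost_left_vertical[of x \<sigma> M] assms L by simp
  have j: "norm (jost \<sigma> x) \<le> exp (- L * x) * jost_bound x" "norm (jost \<sigma> y) \<le> exp (- L * y) * jost_bound y"
    using norm_jost_right[of x \<sigma>] norm_jost_right[of y \<sigma>] assms L by auto
  have "norm (scat \<sigma> * jost \<sigma> x) \<le> (2 * exp (3/2)) * (exp (- L * x) * jost_bound x)"
    unfolding norm_mult using sc j by (intro mult_mono) auto
  also have "\<dots> \<le> (2 * exp (3/2)) * (exp (L * x) * jost_bound x)"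
    using L assms jost_bound_nonneg[of x] by (intro mult_left_mono mult_right_mono) auto
  finally have "norm (jost (-\<sigma>) x + scat \<sigma> * jost \<sigma> x) \<le>
      exp (L * x) * (jost_bound' x + 2 * exp (3/2) * jost_bound x)"
    using 1 norm_triangle_ineq[of "jost (-\<sigma>) x" "scat \<sigma> * jost \<sigma> x"] by (simp add: algebra_simps)
  hence "norm (green_integrand x y \<sigma>) \<le>
      (exp (L * x) * (jost_bound' x + 2 * exp (3/2) * jost_bound x)) * (exp (- L * y) * jost_bound y)"
    unfolding green_integrand_def norm_mult using j jost_bound_nonneg[of x] jost_bound'_nonneg[of x] assms
    by (intro mult_mono) auto
  also have "\<dots> = (exp (L * x) * exp (- L * y)) * ((jost_bound' x + 2 * exp (3/2) * jost_bound x) * jost_bound y)"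
    by (simp only: mult_ac)
  also have "exp (L * x) * exp (- L * y) \<le> 1"
    using L assms by (simp add: mult_left_mono flip: exp_add)
  hence "(exp (L * x) * exp (- L * y)) * ((jost_bound' x + 2 * exp (3/2) * jost_bound x) * jost_bound y) \<le>
      1 * ((jost_bound' x + 2 * exp (3/2) * jost_bound x) * jost_bound y)"
    using jost_bound_nonneg[of x] jost_bound_nonneg[of y] jost_bound'_nonneg[of x] assms
    by (intro mult_right_mono) auto
  finally show ?thesis by simp
qed

text \<open>C may depend on M here, because M is fixed while T grows. The linear factor comes from
  \<open>scat\<close> and is beaten by the denominator of order T^2.\<close>

lemma green_integrand_horizontal:
  assumes "0 < x" "0 < y"
  obtains C where "C \<ge> 0" "\<And>\<sigma>. \<bar>Im \<sigma>\<bar> \<ge> 1 \<Longrightarrow> 0 \<le> Re \<sigma> \<Longrightarrow> Re \<sigma> \<le> real M + 1/2 \<Longrightarrow>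
      norm (green_integrand x y \<sigma>) \<le> C * (1 + norm \<sigma>)"
proof -
  \<comment> \<open>M + 1 rounds the abscissa M + 1/2 up to a natural number, as
    \<open>norm_jost_left_horizontal\<close> expects.\<close>
  define A where "A = exp ((real M + 1) * x) * ((\<Sum>n. (5/2) ^ (M + 1) * exp (-2*x) ^ n) / sqrt (1 - exp (-2*x)))"
  have s: "summable (\<lambda>n. (5/2) ^ (M + 1) * exp (-2*x) ^ n :: real)"
    using assms by (intro summable_mult summable_geometric) auto
  have A0: "(\<Sum>n. (5/2) ^ (M + 1) * exp (-2*x) ^ n) / sqrt (1 - exp (-2*x)) \<ge> 0"
    using s by (intro divide_nonneg_nonneg suminf_nonneg) auto
  have A: "A \<ge> 0" unfolding A_def by (rule mult_nonneg_nonneg[OF _ A0]) simp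
  define B where "B = 2 ^ M * pi * jost_bound x"
  have B: "B \<ge> 0" unfolding B_def using jost_bound_nonneg assms by simp
  define C where "C = (A + B) * jost_bound y"
  have C: "C \<ge> 0" unfolding C_def using A B jost_bound_nonneg assms by simp
  have "norm (green_integrand x y \<sigma>) \<le> C * (1 + norm \<sigma>)"
    if \<sigma>: "\<bar>Im \<sigma>\<bar> \<ge> 1" "0 \<le> Re \<sigma>" "Re \<sigma> \<le> real M + 1/2" for \<sigma>
  proof -
    have "norm (jost (-\<sigma>) x) \<le> exp (Re \<sigma> * x) * ((\<Sum>n. (5/2) ^ (M+1) * exp (-2*x) ^ n) / sqrt (1 - exp (-2*x)))"
      by (rule norm_jost_left_horizontal) (use \<sigma> assms in auto)
    also have "\<dots> \<le> A"
      unfolding A_def using A0 \<sigma> assms by (intro mult_right_mono) auto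
    also have "\<dots> \<le> A * (1 + norm \<sigma>)" using A by (simp add: mult_le_cancel_left1)
    finally have 1: "norm (jost (-\<sigma>) x) \<le> A * (1 + norm \<sigma>)" .
    have j: "norm (jost \<sigma> u) \<le> jost_bound u" if "u > 0" for u
    proof -
      have "norm (jost \<sigma> u) \<le> exp (- Re \<sigma> * u) * jost_bound u"
        by (rule norm_jost_right) (use \<sigma> that in auto)
      also have "\<dots> \<le> 1 * jost_bound u"
        using \<sigma> that jost_bound_nonneg[OF that] by (intro mult_right_mono) auto
      finally show ?thesis by simp
    qed
    have "norm (scat \<sigma> * jost \<sigma> x) \<le> (2 ^ M * (pi * (1 + norm \<sigma>))) * jost_bound x"
      unfolding norm_mult using norm_scat_horizontal[of \<sigma> M] \<sigma> j[of x] assms by (intro mult_mono) auto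
    hence 2: "norm (scat \<sigma> * jost \<sigma> x) \<le> B * (1 + norm \<sigma>)" by (simp add: B_def mult_ac)
    have "norm (jost (-\<sigma>) x + scat \<sigma> * jost \<sigma> x) \<le> (A + B) * (1 + norm \<sigma>)"
      using norm_triangle_ineq[of "jost (-\<sigma>) x" "scat \<sigma> * jost \<sigma> x"] 1 2 by (simp add: algebra_simps)
    hence "norm (green_integrand x y \<sigma>) \<le> ((A + B) * (1 + norm \<sigma>)) * jost_bound y"
      unfolding green_integrand_def norm_mult using j[of y] assms A B by (intro mult_mono) auto
    thus ?thesis by (simp add: C_def mult_ac)
  qed
  with C show ?thesis using that by blast
qed

section \<open>Conjugation symmetry and the kernel on the imaginary axis\<close>

lemma cnj_jost_coeff: "cnj (jost_coeff n \<sigma>) = jost_coeff n (cnj \<sigma>)"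
  by (induction n) (simp_all add: jost_coeff_Suc)

lemma cnj_jost:
  assumes "x > 0" "Re \<sigma> \<ge> -1/4"
  shows "cnj (jost \<sigma> x) = jost (cnj \<sigma>) x"
proof -
  have "(\<lambda>n. of_real (half_coeff n) * jost_coeff n \<sigma> * of_real (exp (-2*x)) ^ n) sums jost_series \<sigma> (exp (-2*x))"
    unfolding jost_series_def
    by (rule summable_sums, rule norm_jost_series_le(1)[where z0 = "exp (-2*x)" and B = "\<lambda>_. 1"])
       (use assms norm_jost_coeff_le_one in \<open>auto intro!: summable_geometric\<close>)
  hence "(\<lambda>n. cnj (of_real (half_coeff n) * jost_coeff n \<sigma> * of_real (exp (-2*x)) ^ n)) sums cnj (jost_series \<sigma> (exp (-2*x)))"
    by (simp only: sums_cnj)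
  hence "cnj (jost_series \<sigma> (exp (-2*x))) = jost_series (cnj \<sigma>) (exp (-2*x))"
    by (simp add: jost_series_def sums_iff cnj_jost_coeff)
  thus ?thesis by (simp add: jost_def exp_cnj)
qed

lemma cnj_scat: "cnj (scat \<sigma>) = scat (cnj \<sigma>)"
  by (simp add: scat_def cnj_Gamma cnj_rGamma)

text \<open>On the imaginary axis -\<sigma> is the conjugate of \<sigma>, so
  \<open>cnj (wfun t x)\<close> is the continued function \<open>jost (-\<sigma>) x\<close>.\<close>

lemma kerA_eq_green_integrand:
  assumes "x > 0" "y > 0"
  shows "kerA t x y = Re (green_integrand x y (\<i> * of_real t))"
proof -
  have "cnj (wfun t x) = jost (- (\<i> * of_real t)) x"
    using assms by (simp add: wfun_eq_jost cnj_jost)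
  thus ?thesis
    using assms by (simp add: kerA_def green_integrand_def coef_a_eq_scat wfun_eq_jost algebra_simps)
qed

text \<open>Conjugation reverses t and keeps the real part. This folds the integral over [-T, T]
  into twice the one over [0, T].\<close>

lemma kerA_minus:
  assumes "x > 0" "y > 0"
  shows "kerA (-t) x y = kerA t x y"
proof -
  have "cnj (green_integrand x y (\<i> * of_real t)) = green_integrand x y (\<i> * of_real (-t))"
    using assms cnj_jost[of x "- (\<i> * of_real t)"]
    by (simp add: green_integrand_def cnj_jost cnj_scat)
  thus ?thesis using assms by (metis complex_cnj_cancel_iff kerA_eq_green_integrand complex_cnj(1) cnj.sel(1))
qed

lemma continuous_on_kerA:
  assumes "x > 0" "y > 0"
  shows "continuous_on UNIV (\<lambda>t. kerA t x y)"
proof -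
  obtain g where g: "g holomorphic_on {\<sigma>. Re \<sigma> > -1/4 \<and> Re \<sigma> < real 0 + 1}"
    "\<And>\<sigma>. Re \<sigma> > -1/4 \<Longrightarrow> Re \<sigma> < real 0 + 1 \<Longrightarrow> \<sigma> \<notin> of_nat ` {1..0} \<Longrightarrow> g \<sigma> = green_integrand x y \<sigma>"
    using green_integrand_extends[OF assms] by metis
  have "kerA t x y = Re (g (\<i> * of_real t))" for t
    using g(2)[of "\<i> * of_real t"] assms by (simp add: kerA_eq_green_integrand)
  moreover have "continuous_on UNIV (\<lambda>t. Re (g (\<i> * complex_of_real t)))"
    by (intro continuous_intros continuous_on_compose2[OF holomorphic_on_imp_continuous_on[OF g(1)]]) auto
  ultimately show ?thesis by simp
qed

lemma integral_inverse_square_le: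
  fixes c :: real
  assumes "c > 0" "T \<ge> 0"
  shows "(\<lambda>t. 1 / (c\<^sup>2 + t\<^sup>2)) integrable_on {-T..T}" "integral {-T..T} (\<lambda>t. 1 / (c\<^sup>2 + t\<^sup>2)) \<le> pi / c"
proof -
  have d: "((\<lambda>t. arctan (t / c) / c) has_vector_derivative 1 / (c\<^sup>2 + t\<^sup>2)) (at t within {-T..T})" for t
  proof -
    have "((\<lambda>t. arctan (t / c) / c) has_real_derivative (1 / (1 + (t / c)\<^sup>2) * (1 / c)) / c) (at t within {-T..T})"
      using assms by (auto intro!: derivative_eq_intros simp: inverse_eq_divide)
    moreover have "(1 / (1 + (t / c)\<^sup>2) * (1 / c)) / c = 1 / (c\<^sup>2 + t\<^sup>2)"
    proof -
      have "(1 + (t / c)\<^sup>2) * c\<^sup>2 = c\<^sup>2 + t\<^sup>2" using assms by (simp add: power_divide algebra_simps)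
      thus ?thesis by (simp add: power2_eq_square mult_ac)
    qed
    ultimately show ?thesis by (simp add: has_real_derivative_iff_has_vector_derivative)
  qed
  have "((\<lambda>t. 1 / (c\<^sup>2 + t\<^sup>2)) has_integral (arctan (T / c) / c - arctan (-T / c) / c)) {-T..T}"
    by (rule fundamental_theorem_of_calculus) (use assms d in auto)
  hence i: "((\<lambda>t. 1 / (c\<^sup>2 + t\<^sup>2)) has_integral (2 * arctan (T / c) / c)) {-T..T}"
    by (simp add: arctan_minus)
  thus "(\<lambda>t. 1 / (c\<^sup>2 + t\<^sup>2)) integrable_on {-T..T}" by blast
  have "2 * arctan (T / c) / c \<le> pi / c"
    using arctan_ubound[of "T / c"] assms by (intro divide_right_mono) auto
  thus "integral {-T..T} (\<lambda>t. 1 / (c\<^sup>2 + t\<^sup>2)) \<le> pi / c" using i by (simp add: integral_unique)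
qed

section \<open>The resolvent kernel\<close>

lemma norm_square_diff_ge:
  fixes \<sigma> :: complex and \<kappa> :: real
  shows "norm ((of_real \<kappa>)\<^sup>2 - \<sigma>\<^sup>2) \<ge> (Re \<sigma>)\<^sup>2 + (Im \<sigma>)\<^sup>2 - \<kappa>\<^sup>2"
proof -
  have "norm (\<sigma>\<^sup>2) - norm ((complex_of_real \<kappa>)\<^sup>2) \<le> norm ((of_real \<kappa>)\<^sup>2 - \<sigma>\<^sup>2)"
    using norm_triangle_ineq2[of "\<sigma>\<^sup>2" "(of_real \<kappa>)\<^sup>2"] norm_minus_commute by metis
  thus ?thesis by (simp add: norm_power cmod_power2)
qed

text \<open>Residue theorem in quantitative form: the main term is the pole at \<kappa>, the first
  error term bounds the two horizontal sides, the second the right side.\<close>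

lemma green_contour_estimate:
  fixes N M :: nat and x y T C :: real
  defines "\<kappa> \<equiv> real N + 1/2" and "L \<equiv> real M + 1/2"
  assumes xy: "0 < x" "x \<le> y" and N: "1 \<le> N" "N < M" and T: "1 \<le> T" "\<kappa> < T" and C0: "0 \<le> C"
    and C: "\<And>\<sigma>. \<bar>Im \<sigma>\<bar> \<ge> 1 \<Longrightarrow> 0 \<le> Re \<sigma> \<Longrightarrow> Re \<sigma> \<le> real M + 1/2 \<Longrightarrow>
      norm (green_integrand x y \<sigma>) \<le> C * (1 + norm \<sigma>)"
  shows "\<bar>2 * integral {0..T} (\<lambda>t. kerA t x y / (\<kappa>\<^sup>2 + t\<^sup>2)) -
      pi / \<kappa> * Re (jost (- of_real \<kappa>) x * jost (of_real \<kappa>) y)\<bar> \<le>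
      2 * (C * (1 + L + T) / (T\<^sup>2 - \<kappa>\<^sup>2) * L) +
      (jost_bound' x + 2 * exp (3/2) * jost_bound x) * jost_bound y * (pi / sqrt (L\<^sup>2 - \<kappa>\<^sup>2))"
proof -
  have y: "y > 0" using xy by simp
  have \<kappa>0: "\<kappa> > 0" and \<kappa>L: "\<kappa> < L" using N by (auto simp: \<kappa>_def L_def)
  define S where "S = {\<sigma>. Re \<sigma> > -1/4 \<and> Re \<sigma> < real M + 1}"
  obtain g where g0: "g holomorphic_on {\<sigma>. Re \<sigma> > -1/4 \<and> Re \<sigma> < real M + 1}"
    "\<And>\<sigma>. Re \<sigma> > -1/4 \<Longrightarrow> Re \<sigma> < real M + 1 \<Longrightarrow> \<sigma> \<notin> of_nat ` {1..M} \<Longrightarrow> g \<sigma> = green_integrand x y \<sigma>"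
    by (rule green_integrand_extends[OF xy(1) y, of M]) (rule that)
  have g: "g holomorphic_on S"
    "\<And>\<sigma>. \<sigma> \<in> S \<Longrightarrow> \<sigma> \<notin> of_nat ` {1..M} \<Longrightarrow> g \<sigma> = green_integrand x y \<sigma>"
    using g0(1) by (simp add: S_def) (rule g0(2), auto simp: S_def)
  have S: "open S" "convex S"
    unfolding S_def
    by (intro open_Collect_conj open_halfspace_Re_gt open_halfspace_Re_lt)
       (auto intro!: convex_Int convex_halfspace_Re_gt convex_halfspace_Re_lt simp: Collect_conj_eq)
  define F where "F \<sigma> = g \<sigma> / ((of_real \<kappa>)\<^sup>2 - \<sigma>\<^sup>2)" for \<sigma>
  define a1 a2 a3 a4 where "a1 = Complex 0 (-T)" and "a2 = Complex L (-T)" and "a3 = Complex L T"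
    and "a4 = Complex 0 T"
  have path: "rectpath a1 a3 = linepath a1 a2 +++ linepath a2 a3 +++ linepath a3 a4 +++ linepath a4 a1"
    by (simp add: rectpath_def Let_def a1_def a2_def a3_def a4_def)
  have \<kappa>S: "complex_of_real \<kappa> \<in> S" using \<kappa>0 \<kappa>L by (simp add: S_def L_def)
  have box: "complex_of_real \<kappa> \<in> box a1 a3"
    using \<kappa>0 \<kappa>L T by (auto simp: in_box_complex_iff a1_def a3_def)
  have pi: "path_image (rectpath a1 a3) \<subseteq> cbox a1 a3 - box a1 a3"
    using T \<kappa>0 \<kappa>L by (subst path_image_rectpath_cbox_minus_box) (auto simp: a1_def a3_def)
  have cb: "cbox a1 a3 \<subseteq> S"
    using T \<kappa>0 \<kappa>L by (auto simp: in_cbox_complex_iff a1_def a3_def S_def L_def)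
  \<comment> \<open>Cauchy's formula is applied on a convex set without -\<kappa>, so that \<kappa>
    is the only pole.\<close>
  define S' where "S' = S \<inter> {\<sigma>. Re \<sigma> > - \<kappa>}"
  have S': "open S'" "convex S'"
    unfolding S'_def using S by (auto intro: open_Int open_halfspace_Re_gt convex_Int convex_halfspace_Re_gt)
  have ne': "\<sigma> + of_real \<kappa> \<noteq> 0" if "\<sigma> \<in> S'" for \<sigma>
    using that by (auto simp: complex_eq_iff S'_def)
  have cb': "cbox a1 a3 \<subseteq> S'"
    using cb \<kappa>0 by (auto simp: S'_def in_cbox_complex_iff a1_def)
  \<comment> \<open>Since \<kappa>^2 - \<sigma>^2 is minus the product of \<sigma> + \<kappa> and
    \<sigma> - \<kappa>, this is the numerator at the pole \<kappa>.\<close>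
  have hol: "(\<lambda>\<sigma>. - g \<sigma> / (\<sigma> + of_real \<kappa>)) holomorphic_on S'"
    using ne' by (intro holomorphic_intros holomorphic_on_subset[OF g(1)]) (auto simp: S'_def)
  have cauchy: "((\<lambda>\<sigma>. (- g \<sigma> / (\<sigma> + of_real \<kappa>)) / (\<sigma> - of_real \<kappa>)) has_contour_integral
      (2 * pi * \<i> * winding_number (rectpath a1 a3) (of_real \<kappa>) * (- g (of_real \<kappa>) / (of_real \<kappa> + of_real \<kappa>))))
      (rectpath a1 a3)"
  proof (rule Cauchy_integral_formula_convex_simple[OF S'(2) hol])
    show "complex_of_real \<kappa> \<in> interior S'"
      using S'(1) \<kappa>S \<kappa>0 by (simp add: interior_open) (simp add: S'_def)
    show "path_image (rectpath a1 a3) \<subseteq> S' - {complex_of_real \<kappa>}"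
      using pi cb' box by blast
  qed auto
  have Feq: "F \<sigma> = (- g \<sigma> / (\<sigma> + of_real \<kappa>)) / (\<sigma> - of_real \<kappa>)" for \<sigma>
  proof -
    have "(\<sigma> + of_real \<kappa>) * (\<sigma> - of_real \<kappa>) = - ((of_real \<kappa>)\<^sup>2 - \<sigma>\<^sup>2)"
      by (simp add: power2_eq_square algebra_simps)
    thus ?thesis unfolding F_def divide_divide_eq_left by (simp only: minus_divide_divide)
  qed
  have wn: "winding_number (rectpath a1 a3) (of_real \<kappa>) = 1"
    using box by (rule winding_number_rectpath)
  have "\<i> * (2 * pi * g (of_real \<kappa>)) / (2 * of_real \<kappa>) = \<i> * (pi * g (of_real \<kappa>) / of_real \<kappa>)"
    using \<kappa>0 by simp
  with cauchy have tot: "(F has_contour_integral (- (\<i> * (pi * g (of_real \<kappa>) / of_real \<kappa>)))) (rectpath a1 a3)"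
    unfolding wn Feq[symmetric] by (simp add: mult_ac)
  have seg: "closed_segment a1 a2 \<subseteq> cbox a1 a3" "closed_segment a2 a3 \<subseteq> cbox a1 a3"
    "closed_segment a3 a4 \<subseteq> cbox a1 a3" "closed_segment a4 a1 \<subseteq> cbox a1 a3"
    using T \<kappa>0 \<kappa>L
    by (intro closed_segment_subset convex_box; auto simp: in_cbox_complex_iff a1_def a2_def a3_def a4_def)+
  have contF: "continuous_on (cbox a1 a3 - {of_real \<kappa>}) F"
    unfolding F_def
  proof (intro continuous_intros holomorphic_on_imp_continuous_on holomorphic_on_subset[OF g(1)] ballI)
    fix \<sigma> assume s: "\<sigma> \<in> cbox a1 a3 - {of_real \<kappa>}"
    hence "\<sigma> + of_real \<kappa> \<noteq> 0" using cb' ne' by blast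
    moreover have "\<sigma> - of_real \<kappa> \<noteq> 0" using s by auto
    ultimately have "(\<sigma> + of_real \<kappa>) * (\<sigma> - of_real \<kappa>) \<noteq> 0" by simp
    thus "(complex_of_real \<kappa>)\<^sup>2 - \<sigma>\<^sup>2 \<noteq> 0" by (auto simp: power2_eq_square algebra_simps)
  qed (use cb in auto)
  have re_seg: "Re \<sigma> = L \<and> \<bar>Im \<sigma>\<bar> \<le> T" if "\<sigma> \<in> closed_segment a2 a3" for \<sigma>
    using that T by (auto simp: a2_def a3_def closed_segment_same_Re closed_segment_eq_real_ivl)
  have re_seg0: "Re \<sigma> = 0 \<and> \<bar>Im \<sigma>\<bar> \<le> T" if "\<sigma> \<in> closed_segment a4 a1" for \<sigma>
    using that T by (auto simp: a4_def a1_def closed_segment_same_Re closed_segment_eq_real_ivl)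
  have im_seg: "\<bar>Im \<sigma>\<bar> = T \<and> 0 \<le> Re \<sigma> \<and> Re \<sigma> \<le> L" if "\<sigma> \<in> closed_segment a1 a2 \<union> closed_segment a3 a4" for \<sigma>
    using that T \<kappa>0 \<kappa>L by (auto simp: a1_def a2_def a3_def a4_def closed_segment_same_Im closed_segment_eq_real_ivl)
  have nk: "of_real \<kappa> \<notin> closed_segment a1 a2" "of_real \<kappa> \<notin> closed_segment a2 a3"
    "of_real \<kappa> \<notin> closed_segment a3 a4" "of_real \<kappa> \<notin> closed_segment a4 a1"
    using re_seg[of "of_real \<kappa>"] re_seg0[of "of_real \<kappa>"] im_seg[of "of_real \<kappa>"] \<kappa>0 \<kappa>L T by auto
  have cont: "continuous_on (closed_segment a1 a2) F" "continuous_on (closed_segment a2 a3) F"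
    "continuous_on (closed_segment a3 a4) F" "continuous_on (closed_segment a4 a1) F"
    by (rule continuous_on_subset[OF contF]; use seg nk in blast)+
  note ci = cont[THEN contour_integrable_continuous_linepath]
  have "contour_integral (rectpath a1 a3) F = contour_integral (linepath a1 a2) F +
      (contour_integral (linepath a2 a3) F + (contour_integral (linepath a3 a4) F + contour_integral (linepath a4 a1) F))"
    unfolding path using ci by (simp add: contour_integrable_joinI)
  \<comment> \<open>The left side is reversed to run upwards, as in the parametrisation \<sigma> = i
    t.\<close>
  also have "contour_integral (linepath a4 a1) F = - contour_integral (linepath a1 a4) F"
    by (rule contour_integral_reverse_linepath[OF cont(4)])
  finally have sum: "contour_integral (linepath a1 a4) F - \<i> * (pi * g (of_real \<kappa>) / of_real \<kappa>) =
      contour_integral (linepath a1 a2) F + contour_integral (linepath a2 a3) F + contour_integral (linepath a3 a4) F"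
    using contour_integral_unique[OF tot] by (simp add: algebra_simps)
  have Tk: "T\<^sup>2 - \<kappa>\<^sup>2 > 0" using T \<kappa>0 by (simp add: power_strict_mono)
  have Lk: "L\<^sup>2 - \<kappa>\<^sup>2 > 0" using \<kappa>L \<kappa>0 by (simp add: power_strict_mono)
  define H where "H = C * (1 + L + T) / (T\<^sup>2 - \<kappa>\<^sup>2)"
  have H0: "H \<ge> 0" unfolding H_def using C0 Tk T \<kappa>0 \<kappa>L by (intro divide_nonneg_pos mult_nonneg_nonneg) auto
  have Hb: "norm (F \<sigma>) \<le> H" if s: "\<sigma> \<in> closed_segment a1 a2 \<union> closed_segment a3 a4" for \<sigma>
  proof -
    note im = im_seg[OF s]
    have sS: "\<sigma> \<in> S" using s seg cb by blast
    have "\<sigma> \<notin> of_nat ` {1..M}" using im T by auto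
    hence "norm (g \<sigma>) \<le> C * (1 + norm \<sigma>)"
      using g(2)[OF sS] C[of \<sigma>] im T by (simp add: L_def)
    also have "norm \<sigma> \<le> L + T" using cmod_le[of \<sigma>] im by simp
    hence "C * (1 + norm \<sigma>) \<le> C * (1 + L + T)" using C0 by (intro mult_left_mono) auto
    finally have 1: "norm (g \<sigma>) \<le> C * (1 + L + T)" .
    have "(Im \<sigma>)\<^sup>2 = T\<^sup>2" using im by (metis power2_abs)
    moreover have "(Re \<sigma>)\<^sup>2 \<ge> 0" by simp
    ultimately have 2: "norm ((of_real \<kappa>)\<^sup>2 - \<sigma>\<^sup>2) \<ge> T\<^sup>2 - \<kappa>\<^sup>2"
      using norm_square_diff_ge[of \<sigma> \<kappa>] by linarith
    show ?thesis unfolding F_def H_def norm_divide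
      using 1 2 Tk norm_ge_zero[of "g \<sigma>"] by (intro frac_le) linarith+
  qed
  have b1: "norm (contour_integral (linepath a1 a2) F) \<le> H * L"
  proof -
    have "norm (contour_integral (linepath a1 a2) F) \<le> H * norm (a2 - a1)"
      by (rule contour_integral_bound_linepath[OF ci(1) H0 Hb]) auto
    also have "a2 - a1 = of_real L" by (simp add: a2_def a1_def complex_eq_iff)
    finally show ?thesis using \<kappa>0 \<kappa>L by simp
  qed
  have b2: "norm (contour_integral (linepath a3 a4) F) \<le> H * L"
  proof -
    have "norm (contour_integral (linepath a3 a4) F) \<le> H * norm (a4 - a3)"
      by (rule contour_integral_bound_linepath[OF ci(3) H0 Hb]) auto
    also have "a4 - a3 = of_real (-L)" by (simp add: a3_def a4_def complex_eq_iff)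
    finally show ?thesis using \<kappa>0 \<kappa>L by (simp del: of_real_minus)
  qed
  define V where "V = (jost_bound' x + 2 * exp (3/2) * jost_bound x) * jost_bound y"
  define c where "c = sqrt (L\<^sup>2 - \<kappa>\<^sup>2)"
  have c: "c > 0" "c\<^sup>2 = L\<^sup>2 - \<kappa>\<^sup>2" using Lk by (auto simp: c_def)
  have b3: "norm (contour_integral (linepath a2 a3) F) \<le> V * (pi / c)"
  proof -
    \<comment> \<open>On a vertical segment d\<sigma> = i dt, hence the factor -i.\<close>
    have i: "((\<lambda>t. F (Complex L t)) has_integral (- \<i> * contour_integral (linepath a2 a3) F)) {-T..T}"
      using has_contour_integral_integral[OF ci(2)] T
      by (subst has_contour_integral_linepath_same_Re_iff[symmetric, where z = a2 and z' = a3])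
         (auto simp: a2_def a3_def)
    have bd: "norm (F (Complex L t)) \<le> V * (1 / (c\<^sup>2 + t\<^sup>2))" if "t \<in> {-T..T}" for t
    proof -
      have sS: "Complex L t \<in> S" using \<kappa>0 \<kappa>L by (simp add: S_def L_def)
      \<comment> \<open>L is a half-integer, so this side avoids the points where g and
        \<open>green_integrand\<close> may differ.\<close>
      have "Complex L t \<notin> of_nat ` {1..M}"
      proof
        assume "Complex L t \<in> of_nat ` {1..M}"
        then obtain k :: nat where "L = real k" by (auto simp: complex_eq_iff)
        hence "2 * M + 1 = 2 * k" unfolding L_def by linarith
        thus False by presburger
      qed
      hence 1: "norm (g (Complex L t)) \<le> V"
        using g(2)[OF sS] green_integrand_vertical[OF xy, of "Complex L t" M] by (simp add: V_def L_def)
      have 2: "norm ((of_real \<kappa>)\<^sup>2 - (Complex L t)\<^sup>2) \<ge> c\<^sup>2 + t\<^sup>2"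
        using norm_square_diff_ge[of "Complex L t" \<kappa>] c by simp
      have "c\<^sup>2 + t\<^sup>2 > 0" using c(1) by (simp add: add_pos_nonneg)
      hence "norm (F (Complex L t)) \<le> V / (c\<^sup>2 + t\<^sup>2)"
        unfolding F_def norm_divide using 1 2 norm_ge_zero[of "g (Complex L t)"] by (intro frac_le) linarith+
      thus ?thesis by simp
    qed
    have "norm (integral {-T..T} (\<lambda>t. F (Complex L t))) \<le> integral {-T..T} (\<lambda>t. V * (1 / (c\<^sup>2 + t\<^sup>2)))"
      using i bd integral_inverse_square_le(1)[OF c(1), of T] T
      by (intro integral_norm_bound_integral integrable_on_mult_right) auto
    also have "\<dots> = V * integral {-T..T} (\<lambda>t. 1 / (c\<^sup>2 + t\<^sup>2))"
      by (rule integral_mult_right)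
    also have "\<dots> \<le> V * (pi / c)"
      using integral_inverse_square_le(2)[OF c(1), of T] T jost_bound_nonneg[of x] jost_bound_nonneg[of y]
        jost_bound'_nonneg[of x] xy y unfolding V_def by (intro mult_left_mono) auto
    finally show ?thesis using integral_unique[OF i] by (simp add: norm_mult)
  qed
  define G where "G = g (of_real \<kappa>)"
  \<comment> \<open>At the half-integer \<kappa> the extension agrees with
    \<open>green_integrand\<close>, and there \<open>scat\<close> vanishes, so one summand
    survives.\<close>
  have G: "G = jost (- of_real \<kappa>) x * jost (of_real \<kappa>) y"
  proof -
    have "complex_of_real \<kappa> \<notin> of_nat ` {1..M}"
    proof
      assume "complex_of_real \<kappa> \<in> of_nat ` {1..M}"
      then obtain k :: nat where "\<kappa> = real k" by (auto simp: complex_eq_iff)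
      hence "2 * N + 1 = 2 * k" unfolding \<kappa>_def by linarith
      thus False by presburger
    qed
    moreover have "scat (of_real \<kappa>) = 0"
      using scat_zero[OF N(1)] by (simp add: \<kappa>_def)
    ultimately show ?thesis unfolding G_def using g(2)[OF \<kappa>S] by (simp add: green_integrand_def)
  qed
  define J where "J = contour_integral (linepath a1 a4) F"
  have iJ: "((\<lambda>t. F (Complex 0 t)) has_integral (- \<i> * J)) {-T..T}"
  proof -
    have "continuous_on (closed_segment a1 a4) F" using cont(4) by (simp add: closed_segment_commute)
    hence "(F has_contour_integral J) (linepath a1 a4)"
      unfolding J_def by (intro has_contour_integral_integral contour_integrable_continuous_linepath)
    thus ?thesis using T
      by (subst has_contour_integral_linepath_same_Re_iff[symmetric, where z = a1 and z' = a4])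
         (auto simp: a1_def a4_def)
  qed
  define k where "k t = kerA t x y / (\<kappa>\<^sup>2 + t\<^sup>2)" for t
  have kF: "Re (F (Complex 0 t)) = k t" for t
  proof -
    have e: "Complex 0 t = \<i> * of_real t" by (simp add: complex_eq_iff)
    have "Complex 0 t \<in> S" by (simp add: S_def)
    moreover have "Complex 0 t \<notin> of_nat ` {1..M}" by (auto simp: complex_eq_iff)
    ultimately have "g (Complex 0 t) = green_integrand x y (\<i> * of_real t)" using g(2) e by metis
    moreover have "(of_real \<kappa>)\<^sup>2 - (Complex 0 t)\<^sup>2 = complex_of_real (\<kappa>\<^sup>2 + t\<^sup>2)"
      by (simp add: e power_mult_distrib)
    ultimately show ?thesis
      unfolding F_def k_def kerA_eq_green_integrand[OF xy(1) y] by (simp only: Re_divide_of_real)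
  qed
  have "((\<lambda>t. k t) has_integral Re (- \<i> * J)) {-T..T}"
    using has_integral_Re[OF iJ] by (simp add: kF)
  hence ik: "k integrable_on {-T..T}" "integral {-T..T} k = Re (- \<i> * J)"
    by (auto simp: has_integral_iff)
  have "k integrable_on {-T..0}" "k integrable_on {0..T}"
    using T by (auto intro: integrable_on_subinterval[OF ik(1)])
  moreover have "integral {-T..0} k = integral {0..T} k"
  proof -
    have "integral {-T..-0} (\<lambda>t. k (-t)) = integral {0..T} k" by (rule Henstock_Kurzweil_Integration.integral_reflect_real)
    moreover have "k (-t) = k t" for t by (simp add: k_def kerA_minus[OF xy(1) y])
    ultimately show ?thesis by simp
  qed
  ultimately have I2: "2 * integral {0..T} k = Re (- \<i> * J)"
    using Henstock_Kurzweil_Integration.integral_combine[of "-T" 0 T k] ik T by simp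
  have "Re (- \<i> * J) - pi / \<kappa> * Re G = Re (- \<i> * (J - \<i> * (pi * G / of_real \<kappa>)))"
    by simp
  also have "\<bar>\<dots>\<bar> \<le> norm (- \<i> * (J - \<i> * (pi * G / of_real \<kappa>)))" by (rule abs_Re_le_cmod)
  also have "\<dots> = norm (J - \<i> * (pi * G / of_real \<kappa>))" by (simp add: norm_mult)
  also have "\<dots> \<le> H * L + V * (pi / c) + H * L"
    unfolding J_def G_def sum
    using b1 b2 b3 norm_triangle_ineq[of "contour_integral (linepath a1 a2) F + contour_integral (linepath a2 a3) F" "contour_integral (linepath a3 a4) F"]
      norm_triangle_ineq[of "contour_integral (linepath a1 a2) F" "contour_integral (linepath a2 a3) F"]
    by linarith
  finally show ?thesis
    unfolding G[symmetric] k_def[symmetric] H_def[symmetric] V_def[symmetric] c_def[symmetric] I2 by linarith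
qed

text \<open>M is chosen to make the right side small for all T, then T grows until the horizontal
  sides are small; the integral itself does not involve M.\<close>

lemma green_kernel_identity:
  fixes N :: nat and x y :: real
  assumes xy: "0 < x" "x \<le> y" and N: "1 \<le> N"
  defines "\<kappa> \<equiv> real N + 1/2"
  shows "((\<lambda>T. integral {0..T} (\<lambda>t. kerA t x y / (\<kappa>\<^sup>2 + t\<^sup>2))) \<longlongrightarrow>
      pi / (2 * \<kappa>) * Re (jost (- of_real \<kappa>) x * jost (of_real \<kappa>) y)) at_top"
proof -
  define V where "V = (jost_bound' x + 2 * exp (3/2) * jost_bound x) * jost_bound y"
  define A where "A = pi / \<kappa> * Re (jost (- of_real \<kappa>) x * jost (of_real \<kappa>) y)"
  define f where "f T = 2 * integral {0..T} (\<lambda>t. kerA t x y / (\<kappa>\<^sup>2 + t\<^sup>2))" for T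
  have "(f \<longlongrightarrow> A) at_top"
  proof (rule tendstoI)
    fix e :: real assume e: "e > 0"
    have "((\<lambda>M::nat. V * (pi / sqrt ((real M + 1/2)\<^sup>2 - \<kappa>\<^sup>2))) \<longlonglongrightarrow> 0)"
      by real_asymp
    hence "eventually (\<lambda>M::nat. V * (pi / sqrt ((real M + 1/2)\<^sup>2 - \<kappa>\<^sup>2)) < e / 2) sequentially"
      using e by (intro order_tendstoD) auto
    hence "eventually (\<lambda>M::nat. V * (pi / sqrt ((real M + 1/2)\<^sup>2 - \<kappa>\<^sup>2)) < e / 2 \<and> N < M) sequentially"
      using eventually_gt_at_top[of N] by eventually_elim auto
    then obtain M where M: "V * (pi / sqrt ((real M + 1/2)\<^sup>2 - \<kappa>\<^sup>2)) < e / 2" "N < M"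
      using eventually_happens by fastforce
    define L where "L = real M + 1/2"
    obtain C where C: "C \<ge> 0" "\<And>\<sigma>. \<bar>Im \<sigma>\<bar> \<ge> 1 \<Longrightarrow> 0 \<le> Re \<sigma> \<Longrightarrow> Re \<sigma> \<le> real M + 1/2 \<Longrightarrow>
      norm (green_integrand x y \<sigma>) \<le> C * (1 + norm \<sigma>)"
      using green_integrand_horizontal[of x y M] xy by auto
    have "((\<lambda>T. 2 * (C * (1 + L + T) / (T\<^sup>2 - \<kappa>\<^sup>2) * L)) \<longlongrightarrow> 0) at_top"
      by real_asymp
    hence "eventually (\<lambda>T. 2 * (C * (1 + L + T) / (T\<^sup>2 - \<kappa>\<^sup>2) * L) < e / 2) at_top"
      using e by (intro order_tendstoD) auto
    thus "eventually (\<lambda>T. dist (f T) A < e) at_top"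
      using eventually_ge_at_top[of 1] eventually_gt_at_top[of \<kappa>]
    proof eventually_elim
      case (elim T)
      have "\<bar>f T - A\<bar> \<le> 2 * (C * (1 + L + T) / (T\<^sup>2 - \<kappa>\<^sup>2) * L) + V * (pi / sqrt (L\<^sup>2 - \<kappa>\<^sup>2))"
        unfolding f_def A_def V_def L_def \<kappa>_def
        by (rule green_contour_estimate) (use xy N M elim C in \<open>auto simp: \<kappa>_def\<close>)
      thus ?case unfolding dist_real_def using elim(1) M(1)[folded L_def] by linarith
    qed
  qed
  hence "((\<lambda>T. f T / 2) \<longlongrightarrow> A / 2) at_top" by (intro tendsto_intros) auto
  thus ?thesis by (simp add: f_def A_def mult.commute[of \<kappa>])
qed

section \<open>Real eigenfunctions and resolvent asymptotics\<close>

text \<open>With z = Gamma (1 + i s) / Gamma (3/2 + i s) one has \<open>coef_a s\<close> = - cnj z /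
  z, so i * cnj z / |z| is an explicit unimodular square root. It is chosen without a branch cut,
  which makes measurability immediate.\<close>

definition phase :: "real \<Rightarrow> complex" where
  "phase s = \<i> * cnj (Gamma (1 + \<i> * of_real s) * rGamma (3/2 + \<i> * of_real s)) /
     of_real (norm (Gamma (1 + \<i> * of_real s) * rGamma (3/2 + \<i> * of_real s)))"

lemma phase_denom_nonzero: "Gamma (1 + \<i> * of_real s) * rGamma (3/2 + \<i> * of_real s) \<noteq> 0"
  using Gamma_mult_rGamma[of "1 + \<i> * of_real s"] Gamma_mult_rGamma[of "3/2 + \<i> * of_real s"] by auto

lemma norm_phase: "norm (phase s) = 1"
proof -
  have "norm (\<i> * cnj z / of_real (norm z)) = 1" if "z \<noteq> 0" for z
    using that by (simp add: norm_mult norm_divide)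
  thus ?thesis unfolding phase_def using phase_denom_nonzero[of s] .
qed

lemma phase_square: "phase s ^ 2 = coef_a s"
proof -
  define z where "z = Gamma (1 + \<i> * of_real s) * rGamma (3/2 + \<i> * of_real s)"
  have z: "z \<noteq> 0" unfolding z_def by (rule phase_denom_nonzero)
  have "phase s ^ 2 = - ((cnj z)\<^sup>2) / (of_real (norm z))\<^sup>2"
    unfolding phase_def z_def[symmetric] by (simp add: power_divide power_mult_distrib)
  also have "\<dots> = - ((cnj z)\<^sup>2) / (z * cnj z)"
    by (simp only: complex_norm_square[symmetric] of_real_power)
  also have "\<dots> = - cnj z / z" using z by (simp add: power2_eq_square)
  also have "cnj z = Gamma (1 - \<i> * of_real s) * rGamma (3/2 - \<i> * of_real s)"
    by (simp add: z_def cnj_Gamma cnj_rGamma)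
  finally show ?thesis
    unfolding z_def coef_a_def rGamma_inverse_Gamma divide_inverse inverse_mult_distrib inverse_inverse_eq
    by (simp only: mult_ac minus_mult_left[symmetric] minus_mult_right[symmetric])
qed

text \<open>Extension by zero turns the half-line integrals in x and in s into integrals over the
  whole line.\<close>

definition psi :: "real \<Rightarrow> real \<Rightarrow> real" where
  "psi s x = (if s \<ge> 0 \<and> x > 0 then 2 * Re (phase s * wfun s x) else 0)"

text \<open>For p and q as below, Re (p q + cnj p q) = 2 * Re p * Re q.\<close>

lemma kerA_eq_psi:
  assumes "s \<ge> 0" "x > 0" "y > 0"
  shows "kerA s x y = psi s x * psi s y / 2"
proof -
  define p q where "p = phase s * wfun s x" and "q = phase s * wfun s y"
  have 1: "coef_a s * wfun s x * wfun s y = p * q"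
    unfolding phase_square[symmetric] p_def q_def by (simp add: power2_eq_square mult_ac)
  have "cnj (phase s) * phase s = 1"
    using complex_norm_square[of "phase s"] norm_phase[of s] by (simp add: mult.commute)
  hence 2: "cnj (wfun s x) * wfun s y = cnj p * q"
  proof -
    have "cnj p * q = (cnj (phase s) * phase s) * (cnj (wfun s x) * wfun s y)"
      by (simp add: p_def q_def mult_ac)
    thus ?thesis using \<open>cnj (phase s) * phase s = 1\<close> by simp
  qed
  show ?thesis
    unfolding kerA_def 1 2 using assms by (simp add: psi_def p_def[symmetric] q_def[symmetric])
qed

lemma jost_bound_eq:
  assumes "x > 0"
  shows "jost_bound x = 1 / (1 - exp (-2*x)) / sqrt (1 - exp (-2*x))"
  using suminf_geometric[of "exp (-2*x)"] assms by (simp add: jost_bound_def)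

text \<open>\<open>jost_bound\<close> decreases, so the bound is uniform in s and in x >= \<delta>.
  It blows up as \<delta> tends to 0.\<close>

lemma abs_psi_le:
  assumes "0 < \<delta>" "\<delta> \<le> x"
  shows "\<bar>psi s x\<bar> \<le> 2 * jost_bound \<delta>"
proof (cases "s \<ge> 0")
  case True
  have x: "x > 0" using assms by simp
  have "\<bar>psi s x\<bar> \<le> 2 * norm (phase s * wfun s x)"
    using abs_Re_le_cmod[of "phase s * wfun s x"] True x by (simp add: psi_def abs_mult)
  also have "norm (phase s * wfun s x) = norm (jost (\<i> * of_real s) x)"
    using x by (simp add: norm_mult norm_phase wfun_eq_jost)
  also have "\<dots> \<le> jost_bound x"
    using norm_jost_right[of x "\<i> * of_real s"] x by simp
  also have "\<dots> \<le> jost_bound \<delta>"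
    unfolding jost_bound_eq[OF assms(1)] jost_bound_eq[OF x] using assms
    by (intro frac_le real_sqrt_le_mono) auto
  finally show ?thesis by simp
next
  case False
  thus ?thesis using jost_bound_nonneg[of \<delta>] assms by (simp add: psi_def)
qed

lemma borel_measurable_jost_coeff [measurable]: "(\<lambda>s. jost_coeff n (\<i> * of_real s)) \<in> borel_measurable borel"
proof (induction n)
  case (Suc n)
  note [measurable] = Suc
  show ?case unfolding jost_coeff_Suc by measurable
qed simp

lemma borel_measurable_phase [measurable]: "phase \<in> borel_measurable borel"
proof -
  have "continuous_on UNIV (\<lambda>s. Gamma (1 + \<i> * complex_of_real s) * rGamma (3/2 + \<i> * of_real s))"
  proof (intro continuous_intros)
    have "continuous_on {z. Re z > 0} (Gamma :: complex \<Rightarrow> complex)"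
      by (intro holomorphic_on_imp_continuous_on holomorphic_Gamma) (auto elim!: nonpos_Ints_cases)
    thus "continuous_on UNIV (\<lambda>s. Gamma (1 + \<i> * complex_of_real s))"
      by (rule continuous_on_compose2) (auto intro!: continuous_intros)
    have "continuous_on UNIV (rGamma :: complex \<Rightarrow> complex)"
      by (intro holomorphic_on_imp_continuous_on holomorphic_rGamma)
    thus "continuous_on UNIV (\<lambda>s. rGamma (3/2 + \<i> * complex_of_real s))"
      by (rule continuous_on_compose2) (auto intro!: continuous_intros)
  qed
  hence [measurable]: "(\<lambda>s. Gamma (1 + \<i> * complex_of_real s) * rGamma (3/2 + \<i> * of_real s)) \<in> borel_measurable borel"
    by (rule borel_measurable_continuous_onI)
  have [measurable]: "cnj \<in> borel_measurable borel"
    by (intro borel_measurable_continuous_onI continuous_intros)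
  show ?thesis unfolding phase_def by measurable
qed

lemma borel_measurable_psi [measurable]: "(\<lambda>p. psi (fst p) (snd p)) \<in> borel_measurable (borel \<Otimes>\<^sub>M borel)"
proof -
  have [measurable]: "(\<lambda>p. jost (\<i> * of_real (fst p)) (snd p)) \<in> borel_measurable (borel \<Otimes>\<^sub>M borel)"
    unfolding jost_def jost_series_def by measurable
  have "psi s x = (if s \<ge> 0 \<and> x > 0 then 2 * Re (phase s * jost (\<i> * of_real s) x) else 0)" for s x
    by (simp add: psi_def wfun_eq_jost)
  thus ?thesis by simp
qed

text \<open>The residue formula wants the smaller point first; \<open>min\<close> and
  \<open>max\<close> give the symmetric kernel.\<close>

definition green_kernel :: "nat \<Rightarrow> real \<Rightarrow> real \<Rightarrow> real" where
  "green_kernel N x y = Re (jost (- of_real (real N + 1/2)) (min x y) * jost (of_real (real N + 1/2)) (max x y))"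

text \<open>After removal of its exponential, each of the two Jost factors tends to 1 uniformly on
  [\<delta>, infinity), since the error series depends only on exp (-2 \<delta>).\<close>

lemma green_kernel_asymptotics:
  assumes "\<delta> > 0"
  obtains \<epsilon> :: "nat \<Rightarrow> real" where "\<epsilon> \<longlonglongrightarrow> 0"
    "\<And>N x y. \<delta> \<le> x \<Longrightarrow> \<delta> \<le> y \<Longrightarrow> \<bar>green_kernel N x y * exp ((real N + 1/2) * \<bar>x - y\<bar>) - 1\<bar> \<le> \<epsilon> N"
proof -
  define z where "z = exp (-2*\<delta>)"
  have z: "0 \<le> z" "z < 1" using assms by (auto simp: z_def)
  define k where "k N = complex_of_real (real N + 1/2)" for N
  have nk: "norm (k N) = real N + 1/2" for N unfolding k_def norm_of_real by simp
  have lim: "filterlim (\<lambda>N. norm (k N)) at_top sequentially" unfolding nk by real_asymp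
  have c1: "norm (jost_coeff n (k N)) \<le> 2 * (real n + 1)\<^sup>2" for n N
  proof -
    have "norm (jost_coeff n (k N)) \<le> 1" by (rule norm_jost_coeff_le_one) (simp add: k_def)
    also have "1 \<le> (real n + 1)\<^sup>2" by (rule one_le_power) simp
    hence "1 \<le> 2 * (real n + 1)\<^sup>2" by linarith
    finally show ?thesis .
  qed
  \<comment> \<open>-\<kappa> lies on the line halfway between poles with M = N, so the bound is
    uniform although the point moves past ever more poles.\<close>
  have c2: "norm (jost_coeff n (- k N)) \<le> 2 * (real n + 1)\<^sup>2" for n N
    by (rule norm_jost_coeff_vertical[of _ N]) (simp add: k_def)
  define p where "p N = (\<Sum>n. norm (jost_coeff n (k N) - 1) * z ^ n) / sqrt (1 - z)" for N
  define q where "q N = (\<Sum>n. norm (jost_coeff n (- k N) - 1) * z ^ n) / sqrt (1 - z)" for N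
  have p: "p \<longlonglongrightarrow> 0" unfolding p_def
    by (rule tendsto_divide_zero[OF jost_coeff_error_tendsto_0]) (use z lim c1 in auto)
  have q: "q \<longlonglongrightarrow> 0" unfolding q_def
    by (rule tendsto_divide_zero[OF jost_coeff_error_tendsto_0]) (use z lim c2 in auto)
  have est: "norm (jost \<sigma> x * exp (\<sigma> * of_real x) - 1) \<le> (\<Sum>n. norm (jost_coeff n \<sigma> - 1) * z ^ n) / sqrt (1 - z)"
    if x: "\<delta> \<le> x" and c: "\<And>n. norm (jost_coeff n \<sigma>) \<le> 2 * (real n + 1)\<^sup>2" for \<sigma> x
  proof -
    define u where "u = exp (-2*x)"
    have u: "0 \<le> u" "u \<le> z" "u < 1" using x z assms by (auto simp: u_def z_def)
    have r: "complex_of_real (sqrt (1 - u)) \<noteq> 0" using u by simp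
    have "jost \<sigma> x * exp (\<sigma> * of_real x) = (exp (- \<sigma> * of_real x) * exp (\<sigma> * of_real x)) * (jost_series \<sigma> u / of_real (sqrt (1 - u)))"
      unfolding jost_def u_def[symmetric] by (simp only: times_divide_eq_left times_divide_eq_right mult_ac)
    also have "exp (- \<sigma> * of_real x) * exp (\<sigma> * of_real x) = 1"
      by (simp flip: exp_add)
    finally have "jost \<sigma> x * exp (\<sigma> * of_real x) - 1 = (jost_series \<sigma> u - of_real (sqrt (1 - u))) / of_real (sqrt (1 - u))"
      using r by (simp add: diff_divide_distrib)
    hence "norm (jost \<sigma> x * exp (\<sigma> * of_real x) - 1) = norm (jost_series \<sigma> u - of_real (sqrt (1 - u))) / sqrt (1 - u)"
      using u by (simp add: norm_divide)
    also have "\<dots> \<le> (\<Sum>n. norm (jost_coeff n \<sigma> - 1) * z ^ n) / sqrt (1 - z)"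
      using jost_series_diff_sqrt_le[OF u(1,2) z(2) c] u z
      by (intro frac_le order_trans[OF norm_ge_zero jost_series_diff_sqrt_le[OF u(1,2) z(2) c]]) auto
    finally show ?thesis .
  qed
  define \<epsilon> where "\<epsilon> N = p N * q N + p N + q N" for N
  show ?thesis
  proof (rule that)
    have "\<epsilon> \<longlonglongrightarrow> 0 * 0 + 0 + 0" unfolding \<epsilon>_def by (intro tendsto_intros p q)
    thus "\<epsilon> \<longlonglongrightarrow> 0" by simp
    fix N x y assume xy: "\<delta> \<le> x" "\<delta> \<le> y"
    define m M where "m = min x y" and "M = max x y"
    have mM: "\<delta> \<le> m" "\<delta> \<le> M" "\<bar>x - y\<bar> = M - m" using xy by (auto simp: m_def M_def)
    define A B where "A = jost (- k N) m * exp (- k N * of_real m)" and "B = jost (k N) M * exp (k N * of_real M)"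
    have A: "norm (A - 1) \<le> q N" unfolding A_def q_def by (rule est[OF mM(1) c2])
    have B: "norm (B - 1) \<le> p N" unfolding B_def p_def by (rule est[OF mM(2) c1])
    have e: "exp (- k N * of_real m) * exp (k N * of_real M) = of_real (exp ((real N + 1/2) * \<bar>x - y\<bar>))"
    proof -
      have "- k N * of_real m + k N * of_real M = of_real ((real N + 1/2) * (M - m))"
      proof -
        have "- k N * of_real m + k N * of_real M = k N * (of_real M - of_real m)"
          by (simp add: algebra_simps)
        thus ?thesis unfolding k_def by (simp only: of_real_mult of_real_diff)
      qed
      thus ?thesis unfolding mM(3) exp_add[symmetric] by (simp only: exp_of_real)
    qed
    have "A * B = (jost (- k N) m * jost (k N) M) * (exp (- k N * of_real m) * exp (k N * of_real M))"
      unfolding A_def B_def by (simp only: mult_ac)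
    hence AB: "A * B = (jost (- k N) m * jost (k N) M) * of_real (exp ((real N + 1/2) * \<bar>x - y\<bar>))"
      unfolding e .
    have "Re (w * of_real t) = Re w * t" for w t by simp
    hence "Re (A * B) = green_kernel N x y * exp ((real N + 1/2) * \<bar>x - y\<bar>)"
      unfolding AB green_kernel_def m_def[symmetric] M_def[symmetric] k_def .
    hence "\<bar>green_kernel N x y * exp ((real N + 1/2) * \<bar>x - y\<bar>) - 1\<bar> = \<bar>Re (A * B - 1)\<bar>" by simp
    also have "\<dots> \<le> norm (A * B - 1)" by (rule abs_Re_le_cmod)
    also have "A * B - 1 = (A - 1) * (B - 1) + (A - 1) + (B - 1)" by (simp add: algebra_simps)
    also have "norm \<dots> \<le> norm (A - 1) * norm (B - 1) + norm (A - 1) + norm (B - 1)"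
      by (metis (no_types, lifting) add_mono_thms_linordered_semiring(3) norm_mult norm_triangle_ineq norm_triangle_mono order_refl)
    also have "\<dots> \<le> q N * p N + q N + p N"
      using A B order_trans[OF norm_ge_zero A] by (intro add_mono mult_mono) auto
    finally show "\<bar>green_kernel N x y * exp ((real N + 1/2) * \<bar>x - y\<bar>) - 1\<bar> \<le> \<epsilon> N"
      by (simp add: \<epsilon>_def mult.commute)
  qed
qed

section \<open>The cutoff in s and the smoothed kernel\<close>

definition cutoff :: "nat \<Rightarrow> real \<Rightarrow> real" where
  "cutoff N s = indicator {0..} s * ((real N + 1/2)\<^sup>2 / ((real N + 1/2)\<^sup>2 + s\<^sup>2))"

lemma cutoff_nonneg: "cutoff N s \<ge> 0"
  unfolding cutoff_def by (intro mult_nonneg_nonneg divide_nonneg_nonneg add_nonneg_nonneg) auto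

lemma borel_measurable_cutoff [measurable]: "cutoff N \<in> borel_measurable borel"
  unfolding cutoff_def by measurable

lemma integrable_cutoff: "integrable lborel (cutoff N)"
proof -
  define k where "k = real N + 1/2"
  have k: "k > 0" by (simp add: k_def)
  have d: "DERIV (\<lambda>s. k * arctan (s / k)) s :> k\<^sup>2 / (k\<^sup>2 + s\<^sup>2)" for s
  proof -
    have "DERIV (\<lambda>s. k * arctan (s / k)) s :> k * (1 / (1 + (s / k)\<^sup>2) * (1 / k))"
      using k by (auto intro!: derivative_eq_intros simp: inverse_eq_divide)
    moreover have "k * (1 / (1 + (s / k)\<^sup>2) * (1 / k)) = k\<^sup>2 / (k\<^sup>2 + s\<^sup>2)"
    proof -
      have "k\<^sup>2 + s\<^sup>2 = k\<^sup>2 * (1 + (s / k)\<^sup>2)" using k by (simp add: power_divide algebra_simps)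
      thus ?thesis using k by simp
    qed
    ultimately show ?thesis by simp
  qed
  have "((\<lambda>s. k * arctan (s / k)) \<longlongrightarrow> k * (pi / 2)) at_top"
    using k by real_asymp
  hence "(\<integral>\<^sup>+s. ennreal (k\<^sup>2 / (k\<^sup>2 + s\<^sup>2)) * indicator {0..} s \<partial>lborel) = k * (pi / 2) - k * arctan (0 / k)"
    by (intro nn_integral_FTC_atLeast) (use d in auto)
  moreover have "(\<integral>\<^sup>+s. ennreal (norm (cutoff N s)) \<partial>lborel) =
      (\<integral>\<^sup>+s. ennreal (k\<^sup>2 / (k\<^sup>2 + s\<^sup>2)) * indicator {0..} s \<partial>lborel)"
    by (intro nn_integral_cong) (auto simp: cutoff_def k_def indicator_def)
  ultimately show ?thesis
    by (intro integrableI_bounded) auto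
qed

lemma cutoff_mono: "s \<ge> 0 \<Longrightarrow> mono (\<lambda>N. cutoff N s)"
proof (rule monoI)
  fix N M :: nat assume NM: "N \<le> M" and s: "s \<ge> 0"
  define a b where "a = (real N + 1/2)\<^sup>2" and "b = (real M + 1/2)\<^sup>2"
  have ab: "a > 0" "a \<le> b" unfolding a_def b_def using NM by (auto intro!: power_mono)
  have "a * s\<^sup>2 \<le> b * s\<^sup>2" using ab by (intro mult_right_mono) auto
  hence "a / (a + s\<^sup>2) \<le> b / (b + s\<^sup>2)"
  proof -
    have "a + s\<^sup>2 > 0" "b + s\<^sup>2 > 0" using ab by (auto intro: add_pos_nonneg)
    thus ?thesis using \<open>a * s\<^sup>2 \<le> b * s\<^sup>2\<close> by (simp add: divide_le_eq pos_le_divide_eq) (simp add: algebra_simps)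
  qed
  thus "cutoff N s \<le> cutoff M s" using s by (simp add: cutoff_def a_def b_def)
qed

lemma cutoff_tendsto: "s \<ge> 0 \<Longrightarrow> (\<lambda>N. cutoff N s) \<longlonglongrightarrow> 1"
  unfolding cutoff_def by simp real_asymp

text \<open>Boundedness of \<open>psi\<close> and integrability of the cutoff turn the improper
  integral of \<open>green_kernel_identity\<close> into a Lebesgue integral. The constant: psi * psi
  is twice the kernel, and 2 \<kappa>^2 * pi / (2 \<kappa>) = pi \<kappa>.\<close>

lemma psi_kernel:
  assumes "0 < x" "0 < y" "1 \<le> N"
  shows "integrable lborel (\<lambda>s. psi s x * psi s y * cutoff N s)"
    and "(LINT s|lborel. psi s x * psi s y * cutoff N s) = pi * (real N + 1/2) * green_kernel N x y"
proof -
  define k where "k = real N + 1/2"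
  have k: "k > 0" by (simp add: k_def)
  have [measurable]: "(\<lambda>s. psi s u) \<in> borel_measurable borel" for u
    using measurable_compose[OF _ borel_measurable_psi, of "\<lambda>s. (s, u)" borel] by simp
  define f where "f s = psi s x * psi s y * cutoff N s" for s
  have fm [measurable]: "f \<in> borel_measurable borel" unfolding f_def by measurable
  have bd: "norm (f s) \<le> (2 * jost_bound x * (2 * jost_bound y)) * cutoff N s" for s
    unfolding f_def norm_mult using abs_psi_le[of x x s] abs_psi_le[of y y s] assms cutoff_nonneg[of N s]
      jost_bound_nonneg[of x] jost_bound_nonneg[of y]
    by (intro mult_mono) auto
  show int: "integrable lborel (\<lambda>s. psi s x * psi s y * cutoff N s)"
    unfolding f_def[symmetric]
  proof (rule Bochner_Integration.integrable_bound)
    show "integrable lborel (\<lambda>s. (2 * jost_bound x * (2 * jost_bound y)) * cutoff N s)"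
      by (intro integrable_mult_right integrable_cutoff)
    show "AE s in lborel. norm (f s) \<le> norm ((2 * jost_bound x * (2 * jost_bound y)) * cutoff N s)"
      by (intro AE_I2 order_trans[OF bd]) (simp only: real_norm_def abs_ge_self)
  qed simp
  have sym: "kerA s (min x y) (max x y) = psi s x * psi s y / 2" if "s \<ge> 0" for s
    using kerA_eq_psi[of s "min x y" "max x y"] that assms by (auto simp: min_def max_def)
  have eq: "(LINT s|lborel. indicator {..T} s *\<^sub>R f s) =
      2 * k\<^sup>2 * integral {0..T} (\<lambda>t. kerA t (min x y) (max x y) / (k\<^sup>2 + t\<^sup>2))" if "T \<ge> 0" for T
  proof -
    define h where "h s = 2 * k\<^sup>2 * (kerA s (min x y) (max x y) / (k\<^sup>2 + s\<^sup>2))" for s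
    have nz: "k\<^sup>2 + s\<^sup>2 \<noteq> 0" for s using k add_pos_nonneg[of "k\<^sup>2" "s\<^sup>2"] by simp
    have cont: "continuous_on {0..T} h"
      unfolding h_def using nz assms
      by (intro continuous_intros continuous_on_subset[OF continuous_on_kerA]) auto
    hence si: "set_integrable lborel {0..T} h"
      by (rule borel_integrable_atLeastAtMost')
    have "indicator {..T} s *\<^sub>R f s = indicator {0..T} s *\<^sub>R h s" for s
      using sym[of s] by (auto simp: indicator_def f_def cutoff_def h_def k_def)
    hence "(LINT s|lborel. indicator {..T} s *\<^sub>R f s) = (LINT s:{0..T}|lborel. h s)"
      by (simp add: set_lebesgue_integral_def)
    also have "\<dots> = integral {0..T} h" by (rule set_borel_integral_eq_integral(2)[OF si])
    also have "\<dots> = 2 * k\<^sup>2 * integral {0..T} (\<lambda>t. kerA t (min x y) (max x y) / (k\<^sup>2 + t\<^sup>2))"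
      unfolding h_def by (rule integral_mult_right)
    finally show ?thesis .
  qed
  have "((\<lambda>T. 2 * k\<^sup>2 * integral {0..T} (\<lambda>t. kerA t (min x y) (max x y) / (k\<^sup>2 + t\<^sup>2))) \<longlongrightarrow>
      2 * k\<^sup>2 * (pi / (2 * k) * green_kernel N x y)) at_top"
    unfolding green_kernel_def k_def
    by (intro tendsto_mult tendsto_const green_kernel_identity) (use assms in auto)
  moreover have "eventually (\<lambda>T. 2 * k\<^sup>2 * integral {0..T} (\<lambda>t. kerA t (min x y) (max x y) / (k\<^sup>2 + t\<^sup>2)) =
      (LINT s|lborel. indicator {..T} s *\<^sub>R f s)) at_top"
    using eventually_ge_at_top[of 0] by eventually_elim (simp only: eq)
  ultimately have "((\<lambda>T. LINT s|lborel. indicator {..T} s *\<^sub>R f s) \<longlongrightarrow>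
      2 * k\<^sup>2 * (pi / (2 * k) * green_kernel N x y)) at_top"
    by (rule Lim_transform_eventually)
  moreover have "((\<lambda>T. LINT s|lborel. indicator {..T} s *\<^sub>R f s) \<longlongrightarrow> (LINT s|lborel. f s)) at_top"
    by (rule tendsto_integral_at_top) (use int in \<open>auto simp: f_def\<close>)
  ultimately have "2 * k\<^sup>2 * (pi / (2 * k) * green_kernel N x y) = (LINT s|lborel. f s)"
    by (rule tendsto_unique[OF trivial_limit_at_top_linorder])
  hence "(LINT s|lborel. f s) = 2 * k\<^sup>2 * (pi / (2 * k) * green_kernel N x y)" ..
  also have "\<dots> = pi * k * green_kernel N x y" using k by (simp add: power2_eq_square)
  finally show "(LINT s|lborel. psi s x * psi s y * cutoff N s) = pi * (real N + 1/2) * green_kernel N x y"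
    by (simp add: f_def k_def)
qed

section \<open>Mollification by the Laplace density\<close>

lemma integrable_bounded_support:
  fixes f :: "real \<Rightarrow> complex"
  assumes [measurable]: "f \<in> borel_measurable borel" and "\<And>x. norm (f x) \<le> B" "\<And>x. x \<notin> {a..b} \<Longrightarrow> f x = 0"
  shows "integrable lborel f"
proof (rule Bochner_Integration.integrable_bound)
  show "integrable lborel (\<lambda>x. B * indicat_real {a..b} x)"
    by (intro integrable_mult_right integrable_real_indicator) (auto simp: emeasure_lborel_Icc_eq)
  show "AE x in lborel. norm (f x) \<le> norm (B * indicat_real {a..b} x)"
  proof (rule AE_I2)
    fix x
    show "norm (f x) \<le> norm (B * indicat_real {a..b} x)"
      using assms(2)[of x] assms(3)[of x] norm_ge_zero[of "f x"] by (auto simp: indicator_def)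
  qed
qed simp

lemma integrable_product_bound:
  fixes u :: "real \<Rightarrow> 'a::{banach, second_countable_topology}" and v :: "real \<Rightarrow> 'b::{banach, second_countable_topology}"
    and f :: "real \<times> real \<Rightarrow> complex"
  assumes u: "integrable lborel u" and v: "integrable lborel v"
    and f: "\<And>p. norm (f p) \<le> C * (norm (u (fst p)) * norm (v (snd p)))"
    and [measurable]: "f \<in> borel_measurable (borel \<Otimes>\<^sub>M borel)"
  shows "integrable (lborel \<Otimes>\<^sub>M lborel) f"
proof (rule Bochner_Integration.integrable_bound)
  have [measurable]: "u \<in> borel_measurable borel" "v \<in> borel_measurable borel"
    using u v by (auto dest: borel_measurable_integrable)
  have "integrable (lborel \<Otimes>\<^sub>M lborel) (\<lambda>p. norm (u (fst p)) * norm (v (snd p)))"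
  proof (rule lborel_pair.Fubini_integrable)
    show "integrable lborel (\<lambda>x. LINT y|lborel. norm (norm (u (fst (x, y))) * norm (v (snd (x, y)))))"
      using u by simp
    show "AE x in lborel. integrable lborel (\<lambda>y. norm (u (fst (x, y))) * norm (v (snd (x, y))))"
      using v by simp
  qed measurable
  thus "integrable (lborel \<Otimes>\<^sub>M lborel) (\<lambda>p. C * (norm (u (fst p)) * norm (v (snd p))))"
    by (rule integrable_mult_right)
  show "AE p in lborel \<Otimes>\<^sub>M lborel. norm (f p) \<le> norm (C * (norm (u (fst p)) * norm (v (snd p))))"
    using f by (intro AE_I2 order_trans[OF f]) (simp only: real_norm_def abs_ge_self)
qed measurable

text \<open>A measurable function is an a.e. limit of continuous ones; projecting these onto the
  ball of radius B provides the majorant for dominated convergence.\<close>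

lemma continuous_L1_approximation:
  fixes g :: "real \<Rightarrow> complex"
  assumes [measurable]: "g \<in> borel_measurable borel" and B: "\<And>x. norm (g x) \<le> B" and "e > 0"
  obtains G where "continuous_on UNIV G" "\<And>x. norm (G x) \<le> B"
    "(LINT x|lborel. indicator {a..b} x * norm (G x - g x)) < e"
proof -
  have "g \<in> borel_measurable (lebesgue_on UNIV)"
    using assms(1) by (simp add: borel_measurable_if_lebesgue_on lebesgue_on_UNIV_eq measurable_completion)
  hence "g measurable_on UNIV"
    by (simp add: measurable_on_iff_borel_measurable)
  then obtain N F where N: "negligible N" and F: "\<And>n. continuous_on UNIV (F n :: real \<Rightarrow> complex)"
    and lim: "\<And>x. x \<notin> N \<Longrightarrow> (\<lambda>n. F n x) \<longlonglongrightarrow> g x"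
    unfolding measurable_on_def by auto
  have B0: "B \<ge> 0" using order_trans[OF norm_ge_zero B] .
  \<comment> \<open>The nearest-point projection is continuous and fixes the values of g.\<close>
  define c where "c = closest_point (cball (0::complex) B)"
  have cb: "convex (cball (0::complex) B)" "closed (cball (0::complex) B)" "cball (0::complex) B \<noteq> {}"
    using B0 by auto
  have cc: "continuous_on UNIV c" unfolding c_def by (rule continuous_on_closest_point[OF cb])
  have cB: "norm (c w) \<le> B" for w
    using closest_point_in_set[OF cb(2,3), of w] by (simp add: c_def)
  have cid: "c (g x) = g x" for x
    unfolding c_def by (rule closest_point_self) (use B in auto)
  define G where "G n x = c (F n x)" for n x
  have G: "continuous_on UNIV (G n)" for n
    unfolding G_def by (rule continuous_on_compose2[OF cc F]) auto
  have [measurable]: "G n \<in> borel_measurable borel" for n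
    by (rule borel_measurable_continuous_onI[OF G])
  have AEN: "AE x in lborel. x \<notin> N"
  proof -
    have "N \<in> null_sets lebesgue" using N by (simp add: negligible_iff_null_sets)
    hence "AE x in lebesgue. x \<notin> N" by (rule AE_not_in)
    thus ?thesis by (simp add: AE_completion_iff)
  qed
  have "(\<lambda>n. LINT x|lborel. indicator {a..b} x * norm (G n x - g x)) \<longlonglongrightarrow> (LINT x|lborel. (\<lambda>_::real. 0::real) x)"
  proof (rule Bochner_Integration.integral_dominated_convergence)
    show "integrable lborel (\<lambda>x. 2 * B * indicat_real {a..b} x)"
      by (intro integrable_mult_right integrable_real_indicator) (auto simp: emeasure_lborel_Icc_eq)
    show "AE x in lborel. (\<lambda>n. indicator {a..b} x * norm (G n x - g x)) \<longlonglongrightarrow> (0::real)"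
      using AEN
    proof eventually_elim
      case (elim x)
      have "(\<lambda>n. c (F n x)) \<longlonglongrightarrow> c (g x)"
        using cc lim[OF elim] by (intro continuous_on_tendsto_compose[of UNIV c]) auto
      hence "(\<lambda>n. G n x) \<longlonglongrightarrow> g x" unfolding G_def cid .
      hence "(\<lambda>n. indicator {a..b} x * norm (G n x - g x)) \<longlonglongrightarrow> indicator {a..b} x * norm (g x - g x)"
        by (intro tendsto_intros)
      thus ?case by simp
    qed
    show "AE x in lborel. norm (indicator {a..b} x * norm (G n x - g x)) \<le> 2 * B * indicat_real {a..b} x" for n
    proof (rule AE_I2)
      fix x
      have "norm (G n x - g x) \<le> B + B"
        using norm_triangle_ineq4[of "G n x" "g x"] cB[of "F n x"] B[of x] by (simp add: G_def)
      thus "norm (indicator {a..b} x * norm (G n x - g x)) \<le> 2 * B * indicat_real {a..b} x"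
        by (auto simp: indicator_def)
    qed
  qed auto
  hence "eventually (\<lambda>n. (LINT x|lborel. indicator {a..b} x * norm (G n x - g x)) < e) sequentially"
    using \<open>e > 0\<close> by (intro order_tendstoD) auto
  then obtain n where "(LINT x|lborel. indicator {a..b} x * norm (G n x - g x)) < e"
    by (auto simp: eventually_sequentially)
  with G[of n] cB show ?thesis using that[of "G n"] by (simp add: G_def)
qed

text \<open>Continuity of translation in L1, tested against the bounded function g: the shifted
  factor is replaced by a truncated continuous function, whose translates converge a.e.\<close>

lemma autocorrelation_tendsto:
  fixes g :: "real \<Rightarrow> complex" and h :: "nat \<Rightarrow> real"
  assumes g [measurable]: "g \<in> borel_measurable borel" and B: "\<And>x. norm (g x) \<le> B"
    and supp: "\<And>x. x \<notin> {a..b} \<Longrightarrow> g x = 0" and h: "h \<longlonglongrightarrow> 0"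
  shows "(\<lambda>n. LINT y|lborel. cnj (g y) * g (y + h n)) \<longlonglongrightarrow> (LINT y|lborel. cnj (g y) * g y)"
proof -
  have B0: "B \<ge> 0" using order_trans[OF norm_ge_zero B] .
  have [measurable]: "cnj \<in> borel_measurable borel"
    by (intro borel_measurable_continuous_onI continuous_intros)
  have ig: "integrable lborel g" by (rule integrable_bounded_support[OF g B supp])
  have icg: "integrable lborel (\<lambda>y. cnj (g y) * k y)"
    if [measurable]: "k \<in> borel_measurable borel" and k: "\<And>x. norm (k x) \<le> C" for k C
    by (rule integrable_bounded_support[where B = "B * C" and a = a and b = b])
       (use supp B k B0 in \<open>auto simp: norm_mult intro!: mult_mono\<close>)
  show ?thesis
  proof (rule tendstoI)
    fix e :: real assume e: "e > 0"
    \<comment> \<open>The replacement is made twice, each time at cost B * d; together at most e/2.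
      B + 1 avoids a division by zero.\<close>
    define d where "d = e / (4 * (B + 1))"
    have d: "d > 0" using e B0 by (simp add: d_def)
    have Bd: "2 * (B * d) \<le> e / 2"
    proof -
      have "B * d \<le> (B + 1) * d" using d by simp
      also have "\<dots> = e / 4" using B0 by (simp add: d_def divide_simps)
      finally show ?thesis by simp
    qed
    obtain G where G: "continuous_on UNIV G" "\<And>x. norm (G x) \<le> B"
      "(LINT x|lborel. indicator {a..b} x * norm (G x - g x)) < d"
      using continuous_L1_approximation[OF g B d] by metis
    have [measurable]: "G \<in> borel_measurable borel"
      by (rule borel_measurable_continuous_onI[OF G(1)])
    define g' where "g' x = indicator {a..b} x * G x" for x
    have g'm [measurable]: "g' \<in> borel_measurable borel" unfolding g'_def by measurable
    have g'B: "norm (g' x) \<le> B" for x using G(2)[of x] B0 by (auto simp: g'_def indicator_def)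
    have ig': "integrable lborel g'"
      by (rule integrable_bounded_support[OF g'm g'B, of a b]) (auto simp: g'_def)
    have close: "(LINT x|lborel. norm (g x - g' x)) < d"
    proof -
      have "norm (g x - g' x) = indicator {a..b} x * norm (G x - g x)" for x
        using supp[of x] by (auto simp: g'_def indicator_def norm_minus_commute)
      thus ?thesis using G(3) by simp
    qed
    have lim': "(\<lambda>n. LINT y|lborel. cnj (g y) * g' (y + h n)) \<longlonglongrightarrow> (LINT y|lborel. cnj (g y) * g' y)"
    proof (rule Bochner_Integration.integral_dominated_convergence)
      show "integrable lborel (\<lambda>y. B * norm (g y))" using ig by auto
      show "AE y in lborel. norm (cnj (g y) * g' (y + h n)) \<le> B * norm (g y)" for n
      proof (rule AE_I2)
        fix y
        have "norm (g y) * norm (g' (y + h n)) \<le> norm (g y) * B" using g'B by (intro mult_left_mono) auto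
        thus "norm (cnj (g y) * g' (y + h n)) \<le> B * norm (g y)" by (simp add: norm_mult mult.commute)
      qed
      \<comment> \<open>The truncation may jump at the two endpoints, which form a null set.\<close>
      have "AE y in lborel. y \<noteq> a \<and> y \<noteq> b"
        using AE_lborel_singleton[of a] AE_lborel_singleton[of b] by eventually_elim auto
      thus "AE y in lborel. (\<lambda>n. cnj (g y) * g' (y + h n)) \<longlonglongrightarrow> cnj (g y) * g' y"
      proof eventually_elim
        case (elim y)
        have yh: "(\<lambda>n. y + h n) \<longlonglongrightarrow> y" using tendsto_add[OF tendsto_const h, of y] by simp
        have Gl: "(\<lambda>n. G (y + h n)) \<longlonglongrightarrow> G y"
          using G(1) yh by (intro continuous_on_tendsto_compose[of UNIV G]) auto
        have "(\<lambda>n. g' (y + h n)) \<longlonglongrightarrow> g' y"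
        proof (cases "y \<in> {a..b}")
          case True
          hence "y \<in> {a<..<b}" using elim by auto
          hence "eventually (\<lambda>n. y + h n \<in> {a<..<b}) sequentially"
            using yh by (intro topological_tendstoD) auto
          hence "eventually (\<lambda>n. G (y + h n) = g' (y + h n)) sequentially"
            by eventually_elim (auto simp: g'_def)
          from Lim_transform_eventually[OF Gl this] show ?thesis using True by (simp add: g'_def)
        next
          case False
          hence "y \<in> - {a..b}" by auto
          hence "eventually (\<lambda>n. y + h n \<in> - {a..b}) sequentially"
            using yh by (intro topological_tendstoD) auto
          hence "eventually (\<lambda>n. 0 = g' (y + h n)) sequentially"
            by eventually_elim (auto simp: g'_def indicator_def)
          from Lim_transform_eventually[OF tendsto_const this] show ?thesis using False by (simp add: g'_def)
        qed
        thus ?case by (intro tendsto_intros)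
      qed
    qed auto
    \<comment> \<open>By translation invariance the replacement error is the same for every shift
      t.\<close>
    have err: "norm ((LINT y|lborel. cnj (g y) * g (y + t)) - (LINT y|lborel. cnj (g y) * g' (y + t))) \<le> B * d" for t
    proof -
      have i1: "integrable lborel (\<lambda>y. cnj (g y) * g (y + t))" by (rule icg[where C = B]) (use B in auto)
      have i2: "integrable lborel (\<lambda>y. cnj (g y) * g' (y + t))" by (rule icg[where C = B]) (use g'B in auto)
      have id: "integrable lborel (\<lambda>y. norm (g y - g' y))" using ig ig' by auto
      have ids: "integrable lborel (\<lambda>y. norm (g (t + 1 * y) - g' (t + 1 * y)))"
        using lborel_integrable_real_affine[OF id, of 1 t] by simp
      have "(LINT y|lborel. cnj (g y) * g (y + t)) - (LINT y|lborel. cnj (g y) * g' (y + t)) =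
          (LINT y|lborel. cnj (g y) * (g (y + t) - g' (y + t)))"
        unfolding Bochner_Integration.integral_diff[OF i1 i2, symmetric] by (simp add: right_diff_distrib)
      also have "norm \<dots> \<le> (LINT y|lborel. norm (cnj (g y) * (g (y + t) - g' (y + t))))"
        by (rule integral_norm_bound)
      also have "\<dots> \<le> (LINT y|lborel. B * norm (g (t + 1 * y) - g' (t + 1 * y)))"
      proof (rule integral_mono)
        show "integrable lborel (\<lambda>y. norm (cnj (g y) * (g (y + t) - g' (y + t))))"
          using Bochner_Integration.integrable_diff[OF i1 i2] by (simp add: right_diff_distrib)
        show "integrable lborel (\<lambda>y. B * norm (g (t + 1 * y) - g' (t + 1 * y)))"
          using ids by auto
        fix y
        have "norm (g y) * norm (g (y + t) - g' (y + t)) \<le> B * norm (g (y + t) - g' (y + t))"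
          using B by (intro mult_right_mono) auto
        thus "norm (cnj (g y) * (g (y + t) - g' (y + t))) \<le> B * norm (g (t + 1 * y) - g' (t + 1 * y))"
          by (simp add: norm_mult add.commute)
      qed
      also have "\<dots> = B * (LINT y|lborel. norm (g y - g' y))"
        using lborel_integral_real_affine[of 1 "\<lambda>y. norm (g y - g' y)" t] by simp
      also have "\<dots> \<le> B * d" using close B0 by (intro mult_left_mono) auto
      finally show ?thesis .
    qed
    have "eventually (\<lambda>n. dist (LINT y|lborel. cnj (g y) * g' (y + h n)) (LINT y|lborel. cnj (g y) * g' y) < e / 2) sequentially"
      using e by (intro tendstoD[OF lim']) auto
    thus "eventually (\<lambda>n. dist (LINT y|lborel. cnj (g y) * g (y + h n)) (LINT y|lborel. cnj (g y) * g y) < e) sequentially"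
    proof eventually_elim
      case (elim n)
      have "dist (LINT y|lborel. cnj (g y) * g (y + h n)) (LINT y|lborel. cnj (g y) * g' (y + h n)) \<le> B * d"
        using err[of "h n"] by (simp add: dist_norm)
      moreover have "dist (LINT y|lborel. cnj (g y) * g' y) (LINT y|lborel. cnj (g y) * g y) \<le> B * d"
        using err[of 0] by (simp add: dist_norm norm_minus_commute)
      ultimately show ?case
        using elim Bd
          dist_triangle[of "LINT y|lborel. cnj (g y) * g (y + h n)" "LINT y|lborel. cnj (g y) * g y" "LINT y|lborel. cnj (g y) * g' (y + h n)"]
          dist_triangle[of "LINT y|lborel. cnj (g y) * g' (y + h n)" "LINT y|lborel. cnj (g y) * g y" "LINT y|lborel. cnj (g y) * g' y"]
        by linarith
    qed
  qed
qed

lemma laplace_density: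
  shows integrable_laplace: "integrable lborel (\<lambda>t::real. exp (- \<bar>t\<bar>) / 2)"
    and integral_laplace: "(LINT t|lborel. exp (- \<bar>t\<bar>) / 2 :: real) = 1"
proof -
  have half: "(\<integral>\<^sup>+t. ennreal (exp (- t) / 2) * indicator {0..} t \<partial>lborel) = ennreal (0 - - exp (- 0) / 2)"
  proof (rule nn_integral_FTC_atLeast)
    show "DERIV (\<lambda>t. - exp (- t) / 2) t :> exp (- t) / 2" for t :: real
      by (auto intro!: derivative_eq_intros)
    show "((\<lambda>t::real. - exp (- t) / 2) \<longlongrightarrow> 0) at_top" by real_asymp
  qed auto
  have "(\<integral>\<^sup>+t. ennreal (exp (- \<bar>t\<bar>) / 2) \<partial>lborel) =
      (\<integral>\<^sup>+t. ennreal (exp (- t) / 2) * indicator {0..} t + ennreal (exp t / 2) * indicator {..0} t \<partial>lborel)"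
    using AE_lborel_singleton[of "0::real"]
    by (intro nn_integral_cong_AE, eventually_elim) (auto simp: indicator_def)
  also have "\<dots> = (\<integral>\<^sup>+t. ennreal (exp (- t) / 2) * indicator {0..} t \<partial>lborel) +
      (\<integral>\<^sup>+t. ennreal (exp t / 2) * indicator {..0} t \<partial>lborel)"
    by (intro nn_integral_add) auto
  also have "(\<integral>\<^sup>+t. ennreal (exp t / 2) * indicator {..0} t \<partial>lborel) =
      (\<integral>\<^sup>+t. ennreal (exp (0 + - 1 * t) / 2) * indicator {..0} (0 + - 1 * t :: real) \<partial>lborel)"
    by (subst nn_integral_real_affine[where c = "-1" and t = 0]) auto
  also have "\<dots> = (\<integral>\<^sup>+t. ennreal (exp (- t) / 2) * indicator {0..} t \<partial>lborel)"
    by (intro nn_integral_cong) (auto simp: indicator_def)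
  also note half
  also have "ennreal (0 - - exp (- 0) / 2) + ennreal (0 - - exp (- 0) / 2) = ennreal 1"
    by (subst ennreal_plus[symmetric]) auto
  finally have nn: "(\<integral>\<^sup>+t. ennreal (exp (- \<bar>t\<bar>) / 2) \<partial>lborel) = ennreal 1"
    .
  have "has_bochner_integral lborel (\<lambda>t::real. exp (- \<bar>t\<bar>) / 2) 1"
    by (rule has_bochner_integral_nn_integral[OF _ _ _ nn]) auto
  thus "integrable lborel (\<lambda>t::real. exp (- \<bar>t\<bar>) / 2)" "(LINT t|lborel. exp (- \<bar>t\<bar>) / 2 :: real) = 1"
    by (auto simp: has_bochner_integral_iff)
qed

lemma laplace_kernel:
  fixes \<kappa> y :: real
  assumes "\<kappa> > 0"
  shows "integrable lborel (\<lambda>x. \<kappa> / 2 * exp (- \<kappa> * \<bar>x - y\<bar>))"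
    and "(LINT x|lborel. \<kappa> / 2 * exp (- \<kappa> * \<bar>x - y\<bar>)) = 1"
proof -
  have eq: "\<kappa> / 2 * exp (- \<kappa> * \<bar>x - y\<bar>) = \<kappa> * (exp (- \<bar>- \<kappa> * y + \<kappa> * x\<bar>) / 2)" for x
  proof -
    have "\<bar>- \<kappa> * y + \<kappa> * x\<bar> = \<bar>\<kappa> * (x - y)\<bar>" by (simp add: algebra_simps)
    also have "\<dots> = \<kappa> * \<bar>x - y\<bar>" using assms by (simp add: abs_mult)
    finally show ?thesis by simp
  qed
  show "integrable lborel (\<lambda>x. \<kappa> / 2 * exp (- \<kappa> * \<bar>x - y\<bar>))"
    unfolding eq using assms
    by (intro integrable_mult_right lborel_integrable_real_affine[OF integrable_laplace]) auto
  show "(LINT x|lborel. \<kappa> / 2 * exp (- \<kappa> * \<bar>x - y\<bar>)) = 1"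
    unfolding eq using assms integral_laplace
      lborel_integral_real_affine[of \<kappa> "\<lambda>t::real. exp (- \<bar>t\<bar>) / 2" "- \<kappa> * y"] by simp
qed

text \<open>The substitution x = y + t / \<kappa> and Fubini turn the form into the mean of the
  autocorrelation \<rho> (t / \<kappa>) under the Laplace density, and \<rho> is continuous at
  0.\<close>

lemma laplace_mollifier_tendsto:
  fixes g :: "real \<Rightarrow> complex" and \<kappa> :: "nat \<Rightarrow> real"
  assumes g [measurable]: "g \<in> borel_measurable borel" and B: "\<And>x. norm (g x) \<le> B"
    and supp: "\<And>x. x \<notin> {a..b} \<Longrightarrow> g x = 0" and \<kappa>: "\<And>n. \<kappa> n > 0" "filterlim \<kappa> at_top sequentially"
  shows "(\<lambda>n. LINT y|lborel. cnj (g y) * (LINT x|lborel. g x * of_real (\<kappa> n / 2 * exp (- \<kappa> n * \<bar>x - y\<bar>)))) \<longlonglongrightarrow>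
      (LINT y|lborel. cnj (g y) * g y)"
proof -
  define \<rho> where "\<rho> h = (LINT y|lborel. cnj (g y) * g (y + h))" for h
  define w where "w t = exp (- \<bar>t\<bar>) / 2" for t :: real
  have [measurable]: "w \<in> borel_measurable borel" unfolding w_def by measurable
  have [measurable]: "cnj \<in> borel_measurable borel"
    by (intro borel_measurable_continuous_onI continuous_intros)
  have ig: "integrable lborel g" by (rule integrable_bounded_support[OF g B supp])
  have iw: "integrable lborel w" unfolding w_def by (rule integrable_laplace)
  have B0: "B \<ge> 0" using order_trans[OF norm_ge_zero B] .
  have \<rho>B: "norm (\<rho> h) \<le> (LINT y|lborel. B * norm (g y))" for h
    unfolding \<rho>_def
  proof (rule Bochner_Integration.integral_norm_bound_integral)
    show "integrable lborel (\<lambda>y. cnj (g y) * g (y + h))"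
      by (rule integrable_bounded_support[where B = "B * B" and a = a and b = b])
         (use supp B B0 in \<open>auto simp: norm_mult intro!: mult_mono\<close>)
    show "integrable lborel (\<lambda>y. B * norm (g y))" using ig by auto
    show "norm (cnj (g y) * g (y + h)) \<le> B * norm (g y)" for y
      using B[of "y + h"] mult_left_mono[OF B[of "y + h"], of "norm (g y)"] by (simp add: norm_mult mult.commute)
  qed
  have [measurable]: "\<rho> \<in> borel_measurable borel" unfolding \<rho>_def by measurable
  have eq: "(LINT y|lborel. cnj (g y) * (LINT x|lborel. g x * of_real (k / 2 * exp (- k * \<bar>x - y\<bar>)))) =
      (LINT t|lborel. of_real (w t) * \<rho> (t / k))" if k: "k > 0" for k
  proof -
    have inner: "(LINT x|lborel. g x * of_real (k / 2 * exp (- k * \<bar>x - y\<bar>))) =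
        (LINT t|lborel. of_real (w t) * g (y + t / k))" for y
    proof -
      have "(LINT x|lborel. g x * of_real (k / 2 * exp (- k * \<bar>x - y\<bar>))) =
          \<bar>1/k\<bar> *\<^sub>R (LINT t|lborel. g (y + (1/k) * t) * of_real (k / 2 * exp (- k * \<bar>(y + (1/k) * t) - y\<bar>)))"
        by (rule lborel_integral_real_affine) (use k in auto)
      also have "\<dots> = (LINT t|lborel. \<bar>1/k\<bar> *\<^sub>R (g (y + (1/k) * t) * of_real (k / 2 * exp (- k * \<bar>(y + (1/k) * t) - y\<bar>))))"
        by simp
      also have "\<dots> = (LINT t|lborel. of_real (w t) * g (y + t / k))"
        using k by (intro Bochner_Integration.integral_cong) (auto simp: w_def scaleR_conv_of_real abs_mult)
      finally show ?thesis .
    qed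
    have int: "integrable (lborel \<Otimes>\<^sub>M lborel) (\<lambda>(y, t). cnj (g y) * (of_real (w t) * g (y + t / k)))"
    proof (rule integrable_product_bound[OF ig iw, of _ B])
      show "norm (case p of (y, t) \<Rightarrow> cnj (g y) * (of_real (w t) * g (y + t / k))) \<le> B * (norm (g (fst p)) * norm (w (snd p)))" for p
        using mult_left_mono[OF B[of "fst p + snd p / k"], of "norm (g (fst p)) * norm (w (snd p))"]
        by (simp add: norm_mult split_beta mult_ac)
    qed measurable
    have "(LINT y|lborel. cnj (g y) * (LINT t|lborel. of_real (w t) * g (y + t / k))) =
        (LINT y|lborel. (LINT t|lborel. cnj (g y) * (of_real (w t) * g (y + t / k))))" by simp
    also have "\<dots> = (LINT t|lborel. (LINT y|lborel. cnj (g y) * (of_real (w t) * g (y + t / k))))"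
      using lborel_pair.Fubini_integral[OF int] by simp
    also have "\<dots> = (LINT t|lborel. of_real (w t) * \<rho> (t / k))"
    proof (intro Bochner_Integration.integral_cong refl)
      fix t
      have "(LINT y|lborel. cnj (g y) * (of_real (w t) * g (y + t / k))) =
          (LINT y|lborel. of_real (w t) * (cnj (g y) * g (y + t / k)))" by (simp only: mult_ac)
      thus "(LINT y|lborel. cnj (g y) * (of_real (w t) * g (y + t / k))) = of_real (w t) * \<rho> (t / k)"
        by (simp add: \<rho>_def)
    qed
    finally show ?thesis unfolding inner .
  qed
  have "(\<lambda>n. LINT t|lborel. of_real (w t) * \<rho> (t / \<kappa> n)) \<longlonglongrightarrow> (LINT t|lborel. of_real (w t) * \<rho> 0)"
  proof (rule Bochner_Integration.integral_dominated_convergence)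
    show "integrable lborel (\<lambda>t. w t * (LINT y|lborel. B * norm (g y)))" using iw by auto
    show "AE t in lborel. norm (of_real (w t) * \<rho> (t / \<kappa> n)) \<le> w t * (LINT y|lborel. B * norm (g y))" for n
    proof (rule AE_I2)
      fix t
      show "norm (of_real (w t) * \<rho> (t / \<kappa> n)) \<le> w t * (LINT y|lborel. B * norm (g y))"
        unfolding norm_mult using \<rho>B[of "t / \<kappa> n"] by (intro mult_mono) (auto simp: w_def)
    qed
    show "AE t in lborel. (\<lambda>n. of_real (w t) * \<rho> (t / \<kappa> n)) \<longlonglongrightarrow> of_real (w t) * \<rho> 0"
    proof (rule AE_I2)
      fix t
      have "(\<lambda>n. t / \<kappa> n) \<longlonglongrightarrow> 0"
        by (rule real_tendsto_divide_at_top[OF tendsto_const \<kappa>(2)])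
      from autocorrelation_tendsto[OF g B supp this]
      have "(\<lambda>n. \<rho> (t / \<kappa> n)) \<longlonglongrightarrow> \<rho> 0" by (simp add: \<rho>_def)
      thus "(\<lambda>n. of_real (w t) * \<rho> (t / \<kappa> n)) \<longlonglongrightarrow> of_real (w t) * \<rho> 0" by (intro tendsto_intros)
    qed
  qed auto
  moreover have "(LINT t|lborel. of_real (w t) * \<rho> 0) = \<rho> 0"
    using integral_laplace by (simp add: w_def[symmetric])
  ultimately have "(\<lambda>n. LINT t|lborel. of_real (w t) * \<rho> (t / \<kappa> n)) \<longlonglongrightarrow> \<rho> 0"
    by (simp only:)
  moreover have "\<rho> 0 = (LINT y|lborel. cnj (g y) * g y)" by (simp add: \<rho>_def)
  ultimately show ?thesis unfolding eq[OF \<kappa>(1)] by (simp only:)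
qed

section \<open>The generalised Fourier transform\<close>

definition hat :: "(real \<Rightarrow> complex) \<Rightarrow> real \<Rightarrow> complex" where
  "hat g s = (LINT x|lborel. of_real (psi s x) * g x)"

text \<open>Formal adjoint of \<open>hat\<close>, since \<open>psi\<close> is real.\<close>

definition synth :: "(real \<Rightarrow> complex) \<Rightarrow> real \<Rightarrow> complex" where
  "synth k x = (LINT s|lborel. of_real (psi s x) * k s)"

lemma borel_measurable_psi1 [measurable]: "(\<lambda>s. psi s x) \<in> borel_measurable borel"
  using measurable_compose[OF _ borel_measurable_psi, of "\<lambda>s. (s, x)" borel] by simp

lemma borel_measurable_psi2 [measurable]: "(\<lambda>x. psi s x) \<in> borel_measurable borel"
  using measurable_compose[OF _ borel_measurable_psi, of "\<lambda>x. (s, x)" borel] by simp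

lemma borel_measurable_hat [measurable]:
  assumes [measurable]: "g \<in> borel_measurable borel"
  shows "hat g \<in> borel_measurable borel"
proof -
  have "(\<lambda>s. LINT x|lborel. (\<lambda>p. of_real (psi (fst p) (snd p)) * g (snd p)) (s, x)) \<in> borel_measurable borel"
    by measurable
  thus ?thesis by (simp add: hat_def[abs_def])
qed

lemma borel_measurable_psi_swap [measurable]: "(\<lambda>p. psi (snd p) (fst p)) \<in> borel_measurable (borel \<Otimes>\<^sub>M borel)"
  using measurable_compose[OF measurable_pair_swap' borel_measurable_psi] by (simp add: split_beta)

lemma borel_measurable_synth [measurable]:
  assumes [measurable]: "k \<in> borel_measurable borel"
  shows "synth k \<in> borel_measurable borel"
proof -
  have [measurable]: "(\<lambda>p. of_real (psi (snd p) (fst p)) * k (snd p)) \<in> borel_measurable (borel \<Otimes>\<^sub>M borel)"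
    by measurable
  have "(\<lambda>x. LINT s|lborel. (\<lambda>p. of_real (psi (snd p) (fst p)) * k (snd p)) (x, s)) \<in> borel_measurable borel"
    by (rule lborel.borel_measurable_lebesgue_integral) (simp add: split_beta')
  thus ?thesis by (simp add: synth_def[abs_def])
qed

lemma norm_psi_mult_le:
  assumes "\<delta> > 0" "\<forall>x. v x \<noteq> 0 \<longrightarrow> \<delta> \<le> x"
  shows "norm (of_real (psi s x) * v x :: complex) \<le> 2 * jost_bound \<delta> * norm (v x)"
proof (cases "v x = 0")
  case False
  thus ?thesis unfolding norm_mult using abs_psi_le[of \<delta> x s] assms
    by (intro mult_right_mono) auto
qed simp

lemma psi_mult_integrable:
  assumes v: "integrable lborel v" and "\<delta> > 0" "\<forall>x. v x \<noteq> 0 \<longrightarrow> \<delta> \<le> x"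
  shows "integrable lborel (\<lambda>x. of_real (psi s x) * v x :: complex)"
proof -
  have [measurable]: "v \<in> borel_measurable borel" using v by (auto dest: borel_measurable_integrable)
  have "integrable lborel (\<lambda>x. 2 * jost_bound \<delta> * norm (v x))" using v by auto
  thus ?thesis
    by (rule Bochner_Integration.integrable_bound)
       (measurable, intro AE_I2 order_trans[OF norm_psi_mult_le[OF assms(2,3)]],
        auto simp only: real_norm_def abs_ge_self)
qed

lemma norm_hat_le:
  assumes "integrable lborel v" "\<delta> > 0" "\<forall>x. v x \<noteq> 0 \<longrightarrow> \<delta> \<le> x"
  shows "norm (hat v s) \<le> 2 * jost_bound \<delta> * (LINT x|lborel. norm (v x))"
proof -
  have "norm (hat v s) \<le> (LINT x|lborel. 2 * jost_bound \<delta> * norm (v x))"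
    unfolding hat_def
    by (rule Bochner_Integration.integral_norm_bound_integral)
       (use assms psi_mult_integrable norm_psi_mult_le in auto)
  thus ?thesis by simp
qed

text \<open>Adjointness in bilinear form, without conjugation. As \<open>psi\<close> is bounded on
  the support of v, the double integral converges absolutely.\<close>

lemma psi_fubini:
  assumes u: "integrable lborel u" and v: "integrable lborel v" and \<delta>: "\<delta> > 0" "\<forall>x. v x \<noteq> 0 \<longrightarrow> \<delta> \<le> x"
  shows "integrable lborel (\<lambda>s. u s * hat v s)" "integrable lborel (\<lambda>x. v x * synth u x)"
    "(LINT s|lborel. u s * hat v s) = (LINT x|lborel. v x * synth u x)"
proof -
  have [measurable]: "u \<in> borel_measurable borel" "v \<in> borel_measurable borel"
    using u v by (auto dest: borel_measurable_integrable)
  define f where "f s x = u s * (of_real (psi s x) * v x)" for s x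
  have int: "integrable (lborel \<Otimes>\<^sub>M lborel) (case_prod f)"
  proof (rule integrable_product_bound[OF u v, of _ "2 * jost_bound \<delta>"])
    fix p :: "real \<times> real"
    have "norm (u (fst p)) * norm (of_real (psi (fst p) (snd p)) * v (snd p)) \<le>
        norm (u (fst p)) * (2 * jost_bound \<delta> * norm (v (snd p)))"
      by (intro mult_left_mono norm_psi_mult_le \<delta>) auto
    thus "norm (case p of (s, x) \<Rightarrow> f s x) \<le> 2 * jost_bound \<delta> * (norm (u (fst p)) * norm (v (snd p)))"
      by (simp add: f_def split_beta norm_mult mult_ac)
    have "(\<lambda>p. u (fst p) * (of_real (psi (fst p) (snd p)) * v (snd p))) \<in> borel_measurable (borel \<Otimes>\<^sub>M borel)"
      by measurable
    thus "case_prod f \<in> borel_measurable (borel \<Otimes>\<^sub>M borel)"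
      by (simp add: f_def split_beta')
  qed
  have 1: "(LINT x|lborel. f s x) = u s * hat v s" for s by (simp add: f_def hat_def)
  have 2: "(LINT s|lborel. f s x) = v x * synth u x" for x
  proof -
    have "(LINT s|lborel. f s x) = (LINT s|lborel. v x * (of_real (psi s x) * u s))"
      by (simp add: f_def mult_ac)
    thus ?thesis by (simp add: synth_def)
  qed
  show "integrable lborel (\<lambda>s. u s * hat v s)"
    using lborel_pair.integrable_fst'[OF int] by (simp add: 1)
  show "integrable lborel (\<lambda>x. v x * synth u x)"
    using lborel_pair.integrable_snd[OF int] by (simp add: 2)
  show "(LINT s|lborel. u s * hat v s) = (LINT x|lborel. v x * synth u x)"
    using lborel_pair.Fubini_integral[OF int] by (simp add: 1 2)
qed

lemma cnj_hat: "cnj (hat g s) = hat (\<lambda>x. cnj (g x)) s"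
proof -
  have "(LINT x|lborel. cnj (of_real (psi s x) * g x)) = cnj (LINT x|lborel. of_real (psi s x) * g x)"
    by (rule Bochner_Integration.integral_cnj)
  thus ?thesis by (simp add: hat_def)
qed

text \<open>Two exchanges of integrals expose the s-integral of psi * psi * cutoff, which
  \<open>psi_kernel\<close> evaluates. The integrability statements are kept for splitting these
  integrals later.\<close>

lemma cutoff_hat_eq:
  fixes g :: "real \<Rightarrow> complex"
  assumes g: "integrable lborel g" and \<delta>: "\<delta> > 0" "\<forall>x. g x \<noteq> 0 \<longrightarrow> \<delta> \<le> x" and N: "N \<ge> 1"
  defines "K \<equiv> \<lambda>y. LINT x|lborel. g x * of_real (pi * (real N + 1/2) * green_kernel N x y)"
  shows "integrable lborel (\<lambda>s. cutoff N s * (norm (hat g s))\<^sup>2)"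
    "complex_of_real (LINT s|lborel. cutoff N s * (norm (hat g s))\<^sup>2) = (LINT y|lborel. cnj (g y) * K y)"
    "integrable lborel (\<lambda>y. cnj (g y) * K y)"
    "\<And>y. y \<ge> \<delta> \<Longrightarrow> integrable lborel (\<lambda>x. g x * of_real (pi * (real N + 1/2) * green_kernel N x y))"
proof -
  have [measurable]: "g \<in> borel_measurable borel" using g by (auto dest: borel_measurable_integrable)
  have [measurable]: "cnj \<in> borel_measurable borel"
    by (intro borel_measurable_continuous_onI continuous_intros)
  define C where "C = 2 * jost_bound \<delta> * (LINT x|lborel. norm (g x))"
  have C: "norm (hat g s) \<le> C" for s unfolding C_def by (rule norm_hat_le[OF g \<delta>])
  have C0: "C \<ge> 0" using order_trans[OF norm_ge_zero C] .
  define u where "u s = of_real (cutoff N s) * hat g s" for s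
  have u: "integrable lborel u"
  proof (rule Bochner_Integration.integrable_bound)
    show "integrable lborel (\<lambda>s. C * cutoff N s)" by (intro integrable_mult_right integrable_cutoff)
    show "AE s in lborel. norm (u s) \<le> norm (C * cutoff N s)"
    proof (rule AE_I2)
      fix s
      have "cutoff N s * norm (hat g s) \<le> cutoff N s * C"
        by (intro mult_left_mono C cutoff_nonneg)
      thus "norm (u s) \<le> norm (C * cutoff N s)"
        using cutoff_nonneg[of N s] C0 by (simp add: u_def norm_mult mult.commute)
    qed
    show "u \<in> borel_measurable lborel" unfolding u_def by measurable
  qed
  have cg: "integrable lborel (\<lambda>x. cnj (g x))" using g by (simp add: integrable_cnj)
  have c\<delta>: "\<forall>x. cnj (g x) \<noteq> 0 \<longrightarrow> \<delta> \<le> x" using \<delta>(2) by simp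
  note F = psi_fubini[OF u cg \<delta>(1) c\<delta>]
  \<comment> \<open>As \<open>psi\<close> is real, the squared modulus of hat g is hat g times the
    transform of the conjugate of g.\<close>
  have uh: "u s * hat (\<lambda>x. cnj (g x)) s = of_real (cutoff N s * (norm (hat g s))\<^sup>2)" for s
    unfolding cnj_hat[symmetric] u_def of_real_mult complex_norm_square by (simp only: mult.assoc)
  have "integrable lborel (\<lambda>s. Re (of_real (cutoff N s * (norm (hat g s))\<^sup>2)))"
    using F(1) unfolding uh by (rule integrable_Re)
  thus "integrable lborel (\<lambda>s. cutoff N s * (norm (hat g s))\<^sup>2)" by simp
  have inner: "integrable lborel (\<lambda>x. g x * of_real (pi * (real N + 1/2) * green_kernel N x y)) \<and>
      synth u y = K y" if y: "y \<ge> \<delta>" for y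
  proof -
    have y0: "y > 0" using y \<delta> by simp
    define u' where "u' s = complex_of_real (psi s y * cutoff N s)" for s
    have u': "integrable lborel u'"
    proof (rule Bochner_Integration.integrable_bound)
      show "integrable lborel (\<lambda>s. 2 * jost_bound \<delta> * cutoff N s)" by (intro integrable_mult_right integrable_cutoff)
      show "AE s in lborel. norm (u' s) \<le> norm (2 * jost_bound \<delta> * cutoff N s)"
      proof (rule AE_I2)
        fix s
        have "\<bar>psi s y\<bar> * cutoff N s \<le> 2 * jost_bound \<delta> * cutoff N s"
          by (intro mult_right_mono abs_psi_le \<delta> y cutoff_nonneg)
        thus "norm (u' s) \<le> norm (2 * jost_bound \<delta> * cutoff N s)"
          using cutoff_nonneg[of N s] jost_bound_nonneg[OF \<delta>(1)] by (simp add: u'_def abs_mult norm_mult)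
      qed
      show "u' \<in> borel_measurable lborel" unfolding u'_def by measurable
    qed
    \<comment> \<open>Second exchange, for fixed y, with psi (s, y) * cutoff as the integrable
      function of s.\<close>
    note F' = psi_fubini[OF u' g \<delta>]
    have "g x * synth u' x = g x * of_real (pi * (real N + 1/2) * green_kernel N x y)" for x
    proof (cases "g x = 0")
      case False
      hence x: "x > 0" using \<delta> by force
      have "synth u' x = (LINT s|lborel. complex_of_real (psi s x * psi s y * cutoff N s))"
        unfolding synth_def u'_def by (simp add: mult.assoc)
      also have "\<dots> = of_real (pi * (real N + 1/2) * green_kernel N x y)"
        unfolding integral_complex_of_real psi_kernel(2)[OF x y0 N] ..
      finally show ?thesis by simp
    qed simp
    note eq = this
    have "synth u y = (LINT s|lborel. u' s * hat g s)"
      unfolding synth_def u_def u'_def by (simp add: mult.assoc)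
    also have "\<dots> = K y" using F'(3) by (simp only: K_def eq)
    finally show ?thesis using F'(2) unfolding eq by blast
  qed
  show "\<And>y. y \<ge> \<delta> \<Longrightarrow> integrable lborel (\<lambda>x. g x * of_real (pi * (real N + 1/2) * green_kernel N x y))"
    using inner by blast
  have eqK: "cnj (g y) * synth u y = cnj (g y) * K y" for y
    using inner[of y] \<delta>(2) by (cases "g y = 0") auto
  show "integrable lborel (\<lambda>y. cnj (g y) * K y)" using F(2) unfolding eqK .
  show "complex_of_real (LINT s|lborel. cutoff N s * (norm (hat g s))\<^sup>2) = (LINT y|lborel. cnj (g y) * K y)"
    using F(3) unfolding eqK uh integral_complex_of_real .
qed

text \<open>The kernel pi * \<kappa> * \<open>green_kernel\<close> equals 2 pi times the Laplace
  kernel E up to a relative error \<epsilon> N. As E has mass 1, the inner integrals differ by at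
  most 2 pi * B * \<epsilon> N, uniformly in y, and the mollifier limit applies.\<close>

lemma cutoff_hat_tendsto:
  fixes g :: "real \<Rightarrow> complex"
  assumes g [measurable]: "g \<in> borel_measurable borel" and B: "\<And>x. norm (g x) \<le> B"
    and supp: "\<And>x. x \<notin> {\<delta>..R} \<Longrightarrow> g x = 0" and \<delta>: "\<delta> > 0"
  shows "(\<lambda>N. LINT s|lborel. cutoff N s * (norm (hat g s))\<^sup>2) \<longlonglongrightarrow> 2 * pi * (LINT y|lborel. (norm (g y))\<^sup>2)"
proof -
  have [measurable]: "cnj \<in> borel_measurable borel"
    by (intro borel_measurable_continuous_onI continuous_intros)
  have B0: "B \<ge> 0" using order_trans[OF norm_ge_zero B] .
  have ig: "integrable lborel g" by (rule integrable_bounded_support[OF g B supp])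
  have \<delta>2: "\<forall>x. g x \<noteq> 0 \<longrightarrow> \<delta> \<le> x" using supp by force
  obtain \<epsilon> where \<epsilon>: "\<epsilon> \<longlonglongrightarrow> 0"
    "\<And>N x y. \<delta> \<le> x \<Longrightarrow> \<delta> \<le> y \<Longrightarrow> \<bar>green_kernel N x y * exp ((real N + 1/2) * \<bar>x - y\<bar>) - 1\<bar> \<le> \<epsilon> N"
    using green_kernel_asymptotics[OF \<delta>] by metis
  define \<kappa> where "\<kappa> N = real N + 1/2" for N
  have \<kappa>: "\<kappa> N > 0" for N by (simp add: \<kappa>_def)
  have \<kappa>lim: "filterlim \<kappa> at_top sequentially" unfolding \<kappa>_def by real_asymp
  define E where "E N x y = \<kappa> N / 2 * exp (- \<kappa> N * \<bar>x - y\<bar>)" for N x y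
  have E0: "E N x y \<ge> 0" for N x y using \<kappa>[of N] by (simp add: E_def)
  have Em: "(\<lambda>x. E N x y) \<in> borel_measurable borel" for N y unfolding E_def by measurable
  note [measurable] = Em
  have iE: "integrable lborel (\<lambda>x. E N x y)" and lE: "(LINT x|lborel. E N x y) = 1" for N y
    unfolding E_def by (rule laplace_kernel[OF \<kappa>])+
  define K where "K N y = (LINT x|lborel. g x * of_real (pi * (real N + 1/2) * green_kernel N x y))" for N y
  define K0 where "K0 N y = (LINT x|lborel. g x * of_real (E N x y))" for N y
  have igE: "integrable lborel (\<lambda>x. g x * of_real (E N x y))" for N y
  proof (rule Bochner_Integration.integrable_bound)
    show "integrable lborel (\<lambda>x. B * E N x y)" using iE by (rule integrable_mult_right)
    show "AE x in lborel. norm (g x * of_real (E N x y)) \<le> norm (B * E N x y)"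
      using B E0 B0 by (intro AE_I2) (auto simp: norm_mult intro!: mult_mono)
  qed measurable
  have K0B: "norm (K0 N y) \<le> B" for N y
  proof -
    have "norm (K0 N y) \<le> (LINT x|lborel. B * E N x y)"
      unfolding K0_def
      by (rule Bochner_Integration.integral_norm_bound_integral)
         (use igE iE B B0 E0 in \<open>auto simp: norm_mult intro!: mult_mono\<close>)
    thus ?thesis by (simp add: lE)
  qed
  have K0m [measurable]: "K0 N \<in> borel_measurable borel" for N
  proof -
    have "(\<lambda>y. LINT x|lborel. (\<lambda>p. g (snd p) * of_real (E N (snd p) (fst p))) (y, x)) \<in> borel_measurable borel"
      unfolding E_def by measurable
    thus ?thesis by (simp add: K0_def[abs_def])
  qed
  have KK: "norm (K N y - 2 * pi * K0 N y) \<le> 2 * pi * (B * \<epsilon> N)" if N: "N \<ge> 1" and y: "y \<ge> \<delta>" for N y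
  proof -
    have iK: "integrable lborel (\<lambda>x. g x * of_real (pi * (real N + 1/2) * green_kernel N x y))"
      by (rule cutoff_hat_eq(4)[OF ig \<delta> \<delta>2 N y])
    have iK0: "integrable lborel (\<lambda>x. of_real (2 * pi) * (g x * of_real (E N x y)))"
      using igE by (rule integrable_mult_right)
    have "K N y - 2 * pi * K0 N y = K N y - (LINT x|lborel. of_real (2 * pi) * (g x * of_real (E N x y)))"
      by (simp add: K0_def)
    also have "\<dots> = (LINT x|lborel. g x * of_real (pi * (real N + 1/2) * green_kernel N x y) - of_real (2 * pi) * (g x * of_real (E N x y)))"
      unfolding K_def by (rule Bochner_Integration.integral_diff[OF iK iK0, symmetric])
    also have "norm \<dots> \<le> (LINT x|lborel. 2 * pi * (B * \<epsilon> N) * E N x y)"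
    proof (rule Bochner_Integration.integral_norm_bound_integral)
      show "integrable lborel (\<lambda>x. g x * of_real (pi * (real N + 1/2) * green_kernel N x y) - of_real (2 * pi) * (g x * of_real (E N x y)))"
        by (rule Bochner_Integration.integrable_diff[OF iK iK0])
      show "integrable lborel (\<lambda>x. 2 * pi * (B * \<epsilon> N) * E N x y)" using iE by (rule integrable_mult_right)
      fix x
      have \<epsilon>0: "\<epsilon> N \<ge> 0" using order_trans[OF abs_ge_zero \<epsilon>(2)[OF y y, of N]] .
      show "norm (g x * of_real (pi * (real N + 1/2) * green_kernel N x y) - of_real (2 * pi) * (g x * of_real (E N x y))) \<le>
          2 * pi * (B * \<epsilon> N) * E N x y"
      proof (cases "g x = 0")
        case True
        thus ?thesis using B0 \<epsilon>0 E0 by simp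
      next
        case False
        define b where "b = green_kernel N x y * exp (\<kappa> N * \<bar>x - y\<bar>)"
        \<comment> \<open>A factor 1 is inserted to bring out the ratio b of
          \<open>green_kernel\<close> to its exponential.\<close>
        have "exp (\<kappa> N * \<bar>x - y\<bar>) * exp (- \<kappa> N * \<bar>x - y\<bar>) = 1" by (simp flip: exp_add)
        hence "pi * (real N + 1/2) * green_kernel N x y =
            pi * \<kappa> N * green_kernel N x y * (exp (\<kappa> N * \<bar>x - y\<bar>) * exp (- \<kappa> N * \<bar>x - y\<bar>))"
          by (simp add: \<kappa>_def)
        also have "\<dots> = 2 * pi * E N x y * b" by (simp add: E_def b_def)
        finally have e: "pi * (real N + 1/2) * green_kernel N x y = 2 * pi * E N x y * b" .
        have "g x * of_real (pi * (real N + 1/2) * green_kernel N x y) - of_real (2 * pi) * (g x * of_real (E N x y)) =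
            g x * of_real (2 * pi * E N x y * (b - 1))"
          unfolding e by (simp add: algebra_simps)
        also have "norm \<dots> = norm (g x) * (2 * pi * E N x y * \<bar>b - 1\<bar>)"
          using E0[of N x y] by (simp only: norm_mult norm_of_real abs_mult) simp
        also have "\<dots> \<le> B * (2 * pi * E N x y * \<epsilon> N)"
          using \<epsilon>(2)[OF \<delta>2[rule_format, OF False] y, of N] B E0[of N x y] B0 unfolding b_def \<kappa>_def
          by (intro mult_mono mult_left_mono) auto
        finally show ?thesis by (simp add: mult_ac)
      qed
    qed
    also have "\<dots> = 2 * pi * (B * \<epsilon> N)"
      by (simp only: integral_mult_right_zero lE mult_1_right)
    finally show ?thesis .
  qed
  define D where "D N = (LINT y|lborel. cnj (g y) * K N y) - 2 * pi * (LINT y|lborel. cnj (g y) * K0 N y)" for N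
  have DB: "norm (D N) \<le> 2 * pi * (B * \<epsilon> N) * (LINT y|lborel. norm (g y))" if N: "N \<ge> 1" for N
  proof -
    have i1: "integrable lborel (\<lambda>y. cnj (g y) * K N y)"
      unfolding K_def by (rule cutoff_hat_eq(3)[OF ig \<delta> \<delta>2 N])
    have i2: "integrable lborel (\<lambda>y. cnj (g y) * K0 N y)"
      by (rule integrable_bounded_support[where B = "B * B" and a = \<delta> and b = R])
         (use supp B K0B B0 in \<open>auto simp: norm_mult intro!: mult_mono\<close>)
    have i3: "integrable lborel (\<lambda>y. of_real (2 * pi) * (cnj (g y) * K0 N y))"
      using i2 by (rule integrable_mult_right)
    have "D N = (LINT y|lborel. cnj (g y) * K N y) - (LINT y|lborel. of_real (2 * pi) * (cnj (g y) * K0 N y))"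
      by (simp add: D_def)
    also have "\<dots> = (LINT y|lborel. cnj (g y) * K N y - of_real (2 * pi) * (cnj (g y) * K0 N y))"
      by (rule Bochner_Integration.integral_diff[OF i1 i3, symmetric])
    also have "norm \<dots> \<le> (LINT y|lborel. 2 * pi * (B * \<epsilon> N) * norm (g y))"
    proof (rule Bochner_Integration.integral_norm_bound_integral)
      show "integrable lborel (\<lambda>y. cnj (g y) * K N y - of_real (2 * pi) * (cnj (g y) * K0 N y))"
        by (rule Bochner_Integration.integrable_diff[OF i1 i3])
      show "integrable lborel (\<lambda>y. 2 * pi * (B * \<epsilon> N) * norm (g y))" using ig by auto
      fix y
      show "norm (cnj (g y) * K N y - of_real (2 * pi) * (cnj (g y) * K0 N y)) \<le> 2 * pi * (B * \<epsilon> N) * norm (g y)"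
      proof (cases "g y = 0")
        case False
        have "cnj (g y) * K N y - of_real (2 * pi) * (cnj (g y) * K0 N y) = cnj (g y) * (K N y - 2 * pi * K0 N y)"
          by (simp add: algebra_simps)
        also have "norm \<dots> \<le> norm (g y) * (2 * pi * (B * \<epsilon> N))"
          unfolding norm_mult complex_mod_cnj by (intro mult_left_mono KK N \<delta>2[rule_format] False) auto
        finally show ?thesis by (simp add: mult_ac)
      qed simp
    qed
    also have "\<dots> = 2 * pi * (B * \<epsilon> N) * (LINT y|lborel. norm (g y))" by simp
    finally show ?thesis .
  qed
  have "D \<longlonglongrightarrow> 0"
  proof (rule Lim_null_comparison)
    show "eventually (\<lambda>N. norm (D N) \<le> 2 * pi * (B * \<epsilon> N) * (LINT y|lborel. norm (g y))) sequentially"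
      using eventually_ge_at_top[of 1] by eventually_elim (rule DB)
    have "(\<lambda>N. 2 * pi * (B * \<epsilon> N) * (LINT y|lborel. norm (g y))) \<longlonglongrightarrow> 2 * pi * (B * 0) * (LINT y|lborel. norm (g y))"
      by (intro tendsto_intros \<epsilon>)
    thus "(\<lambda>N. 2 * pi * (B * \<epsilon> N) * (LINT y|lborel. norm (g y))) \<longlonglongrightarrow> 0" by simp
  qed
  moreover have "(\<lambda>N. LINT y|lborel. cnj (g y) * K0 N y) \<longlonglongrightarrow> (LINT y|lborel. cnj (g y) * g y)"
    unfolding K0_def E_def by (rule laplace_mollifier_tendsto[OF g B supp \<kappa> \<kappa>lim])
  hence "(\<lambda>N. 2 * pi * (LINT y|lborel. cnj (g y) * K0 N y)) \<longlonglongrightarrow> 2 * pi * (LINT y|lborel. cnj (g y) * g y)"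
    by (intro tendsto_intros)
  ultimately have "(\<lambda>N. D N + 2 * pi * (LINT y|lborel. cnj (g y) * K0 N y)) \<longlonglongrightarrow> 0 + 2 * pi * (LINT y|lborel. cnj (g y) * g y)"
    by (rule tendsto_add)
  hence lim: "(\<lambda>N. LINT y|lborel. cnj (g y) * K N y) \<longlonglongrightarrow> 2 * pi * (LINT y|lborel. cnj (g y) * g y)"
    by (simp add: D_def)
  have "eventually (\<lambda>N. (LINT y|lborel. cnj (g y) * K N y) = complex_of_real (LINT s|lborel. cutoff N s * (norm (hat g s))\<^sup>2)) sequentially"
    using eventually_ge_at_top[of 1]
    by eventually_elim (unfold K_def, rule cutoff_hat_eq(2)[OF ig \<delta> \<delta>2, symmetric])
  from Lim_transform_eventually[OF lim this]
  have "(\<lambda>N. complex_of_real (LINT s|lborel. cutoff N s * (norm (hat g s))\<^sup>2)) \<longlonglongrightarrow> 2 * pi * (LINT y|lborel. cnj (g y) * g y)" .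
  also have "(LINT y|lborel. cnj (g y) * g y) = (LINT y|lborel. complex_of_real ((norm (g y))\<^sup>2))"
    unfolding complex_norm_square by (simp only: mult.commute)
  also have "\<dots> = of_real (LINT y|lborel. (norm (g y))\<^sup>2)" by (rule integral_complex_of_real)
  finally have "(\<lambda>N. complex_of_real (LINT s|lborel. cutoff N s * (norm (hat g s))\<^sup>2)) \<longlonglongrightarrow>
      of_real (2 * pi * (LINT y|lborel. (norm (g y))\<^sup>2))" by simp
  thus ?thesis by (simp only: tendsto_of_real_iff)
qed

section \<open>Parseval identity and its adjoint\<close>

text \<open>Squared norm with values in [0, infinity], so that Fatou and monotone convergence apply
  before finiteness is known.\<close>

definition l2sq :: "(real \<Rightarrow> complex) \<Rightarrow> ennreal" where
  "l2sq f = (\<integral>\<^sup>+x. ennreal ((norm (f x))\<^sup>2) \<partial>lborel)"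

lemma l2sq_mono: "(\<And>x. norm (f x) \<le> norm (g x)) \<Longrightarrow> l2sq f \<le> l2sq g"
  unfolding l2sq_def by (intro nn_integral_mono ennreal_leI power_mono) auto

text \<open>Stands in for the triangle inequality of the unsquared norm, at the price of factors 2
  in the later constants.\<close>

lemma l2sq_add_le:
  assumes [measurable]: "f \<in> borel_measurable borel" "g \<in> borel_measurable borel"
  shows "l2sq (\<lambda>x. f x + g x) \<le> 2 * l2sq f + 2 * l2sq g"
proof -
  have "(norm (a + b))\<^sup>2 \<le> 2 * (norm a)\<^sup>2 + 2 * (norm b)\<^sup>2" for a b :: complex
  proof -
    have "(norm (a + b))\<^sup>2 \<le> (norm a + norm b)\<^sup>2" by (intro power_mono norm_triangle_ineq) auto
    also have "\<dots> \<le> 2 * (norm a)\<^sup>2 + 2 * (norm b)\<^sup>2"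
      using sum_squares_bound[of "norm a" "norm b"] by (simp add: power2_sum)
    finally show ?thesis .
  qed
  hence "l2sq (\<lambda>x. f x + g x) \<le> (\<integral>\<^sup>+x. 2 * ennreal ((norm (f x))\<^sup>2) + 2 * ennreal ((norm (g x))\<^sup>2) \<partial>lborel)"
    unfolding l2sq_def
    by (intro nn_integral_mono) (simp add: ennreal_leI flip: ennreal_plus ennreal_numeral ennreal_mult)
  also have "\<dots> = 2 * l2sq f + 2 * l2sq g"
    unfolding l2sq_def by (subst nn_integral_add) (auto simp: nn_integral_cmult)
  finally show ?thesis .
qed

lemma l2sq_diff_le:
  assumes [measurable]: "f \<in> borel_measurable borel" "g \<in> borel_measurable borel"
  shows "l2sq (\<lambda>x. f x - g x) \<le> 2 * l2sq f + 2 * l2sq g"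
proof -
  have "l2sq (\<lambda>x. f x + - g x) \<le> 2 * l2sq f + 2 * l2sq (\<lambda>x. - g x)" by (intro l2sq_add_le) auto
  thus ?thesis by (simp add: l2sq_def)
qed

lemma l2sq_cmult:
  assumes [measurable]: "f \<in> borel_measurable borel"
  shows "l2sq (\<lambda>x. c * f x) = ennreal ((norm c)\<^sup>2) * l2sq f"
  unfolding l2sq_def by (subst nn_integral_cmult[symmetric]) (auto simp: norm_mult power_mult_distrib ennreal_mult)

lemma l2_integrable:
  assumes [measurable]: "f \<in> borel_measurable borel" and fin: "l2sq f < \<infinity>"
  shows "integrable lborel (\<lambda>x. (norm (f x))\<^sup>2)" "ennreal (LINT x|lborel. (norm (f x))\<^sup>2) = l2sq f"
proof -
  show i: "integrable lborel (\<lambda>x. (norm (f x))\<^sup>2)"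
    using fin unfolding l2sq_def by (intro integrableI_bounded) auto
  show "ennreal (LINT x|lborel. (norm (f x))\<^sup>2) = l2sq f"
    unfolding l2sq_def by (rule nn_integral_eq_integral[OF i, symmetric]) auto
qed

text \<open>On the interval r <= 1 + r^2 is used with r the modulus of f, in place of
  Cauchy-Schwarz.\<close>

lemma l2_compact_support_integrable:
  assumes [measurable]: "f \<in> borel_measurable borel" and fin: "l2sq f < \<infinity>" and supp: "\<And>x. x \<notin> {a..b} \<Longrightarrow> f x = 0"
  shows "integrable lborel f"
proof (rule Bochner_Integration.integrable_bound)
  show "integrable lborel (\<lambda>x. indicat_real {a..b} x + (norm (f x))\<^sup>2)"
    by (intro Bochner_Integration.integrable_add l2_integrable fin integrable_real_indicator) (auto simp: emeasure_lborel_Icc_eq)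
  show "AE x in lborel. norm (f x) \<le> norm (indicat_real {a..b} x + (norm (f x))\<^sup>2)"
  proof (rule AE_I2)
    fix x
    have "norm (f x) \<le> 1 + (norm (f x))\<^sup>2"
      using zero_le_power2[of "norm (f x) - 1/2"] by (simp add: power2_eq_square algebra_simps)
    thus "norm (f x) \<le> norm (indicat_real {a..b} x + (norm (f x))\<^sup>2)"
      using supp[of x] by (cases "x \<in> {a..b}") auto
  qed
qed measurable

lemma l2sq_bounded_support_finite:
  fixes g :: "real \<Rightarrow> complex"
  assumes [measurable]: "g \<in> borel_measurable borel" and B: "\<And>x. norm (g x) \<le> B" and supp: "\<And>x. x \<notin> {a..b} \<Longrightarrow> g x = 0"
  shows "l2sq g < \<infinity>"
proof -
  have "l2sq g \<le> (\<integral>\<^sup>+x. ennreal (B\<^sup>2) * indicator {a..b} x \<partial>lborel)"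
    unfolding l2sq_def
  proof (rule nn_integral_mono)
    fix x
    have "(norm (g x))\<^sup>2 \<le> B\<^sup>2" by (intro power_mono B) auto
    thus "ennreal ((norm (g x))\<^sup>2) \<le> ennreal (B\<^sup>2) * indicator {a..b} x"
      using supp[of x] by (cases "x \<in> {a..b}") (auto intro: ennreal_leI)
  qed
  also have "\<dots> < \<infinity>"
    by (simp add: nn_integral_cmult_indicator emeasure_lborel_Icc_eq ennreal_mult_less_top)
  finally show ?thesis .
qed

lemma hat_negative: "s < 0 \<Longrightarrow> hat g s = 0"
  by (simp add: hat_def psi_def)

text \<open>The cutoff increases to 1, so monotone convergence and \<open>cutoff_hat_tendsto\<close>
  compute two limits of the same sequence.\<close>

lemma parseval:
  fixes g :: "real \<Rightarrow> complex"
  assumes g [measurable]: "g \<in> borel_measurable borel" and B: "\<And>x. norm (g x) \<le> B"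
    and supp: "\<And>x. x \<notin> {\<delta>..R} \<Longrightarrow> g x = 0" and \<delta>: "\<delta> > 0"
  shows "l2sq (hat g) = ennreal (2 * pi) * l2sq g"
proof -
  have ig: "integrable lborel g" by (rule integrable_bounded_support[OF g B supp])
  have \<delta>2: "\<forall>x. g x \<noteq> 0 \<longrightarrow> \<delta> \<le> x" using supp by force
  define X where "X N = (\<integral>\<^sup>+s. ennreal (cutoff N s * (norm (hat g s))\<^sup>2) \<partial>lborel)" for N
  have "X \<longlonglongrightarrow> l2sq (hat g)"
    unfolding X_def l2sq_def
  proof (rule nn_integral_LIMSEQ)
    show "incseq (\<lambda>N s. ennreal (cutoff N s * (norm (hat g s))\<^sup>2))"
    proof (intro incseq_SucI le_funI ennreal_leI mult_right_mono)
      fix N s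
      show "cutoff N s \<le> cutoff (Suc N) s"
      proof (cases "s \<ge> 0")
        case True
        show ?thesis by (rule monoD[OF cutoff_mono[OF True]]) simp
      qed (simp add: cutoff_def)
    qed auto
    fix s
    show "(\<lambda>N. ennreal (cutoff N s * (norm (hat g s))\<^sup>2)) \<longlonglongrightarrow> ennreal ((norm (hat g s))\<^sup>2)"
    proof (cases "s \<ge> 0")
      case True
      have "(\<lambda>N. cutoff N s * (norm (hat g s))\<^sup>2) \<longlonglongrightarrow> 1 * (norm (hat g s))\<^sup>2"
        by (intro tendsto_intros cutoff_tendsto True)
      thus ?thesis by (simp add: tendsto_ennrealI)
    qed (simp add: hat_negative)
  qed measurable
  moreover have "X \<longlonglongrightarrow> ennreal (2 * pi * (LINT y|lborel. (norm (g y))\<^sup>2))"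
  proof (rule Lim_transform_eventually)
    show "(\<lambda>N. ennreal (LINT s|lborel. cutoff N s * (norm (hat g s))\<^sup>2)) \<longlonglongrightarrow> ennreal (2 * pi * (LINT y|lborel. (norm (g y))\<^sup>2))"
      by (intro tendsto_ennrealI cutoff_hat_tendsto[OF g B supp \<delta>])
    show "eventually (\<lambda>N. ennreal (LINT s|lborel. cutoff N s * (norm (hat g s))\<^sup>2) = X N) sequentially"
      using eventually_ge_at_top[of 1]
    proof eventually_elim
      case (elim N)
      show ?case unfolding X_def
        by (rule nn_integral_eq_integral[OF cutoff_hat_eq(1)[OF ig \<delta> \<delta>2 elim], symmetric])
           (auto intro!: mult_nonneg_nonneg cutoff_nonneg)
    qed
  qed
  ultimately have "l2sq (hat g) = ennreal (2 * pi * (LINT y|lborel. (norm (g y))\<^sup>2))"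
    by (rule LIMSEQ_unique)
  also have "\<dots> = ennreal (2 * pi) * ennreal (LINT y|lborel. (norm (g y))\<^sup>2)"
    by (rule ennreal_mult) auto
  also have "ennreal (LINT y|lborel. (norm (g y))\<^sup>2) = l2sq g"
    by (rule l2_integrable(2)[OF g l2sq_bounded_support_finite[OF g B supp]])
  finally show ?thesis .
qed

text \<open>Passage to unbounded g: large values are cut off, the transforms converge pointwise, and
  Fatou keeps the upper bound.\<close>

lemma bessel:
  fixes g :: "real \<Rightarrow> complex"
  assumes g [measurable]: "g \<in> borel_measurable borel" and fin: "l2sq g < \<infinity>"
    and supp: "\<And>x. x \<notin> {\<delta>..R} \<Longrightarrow> g x = 0" and \<delta>: "\<delta> > 0"
  shows "l2sq (hat g) \<le> ennreal (2 * pi) * l2sq g"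
proof -
  have ig: "integrable lborel g" by (rule l2_compact_support_integrable[OF g fin supp])
  have \<delta>2: "\<forall>x. g x \<noteq> 0 \<longrightarrow> \<delta> \<le> x" using supp by force
  define G where "G n x = (if norm (g x) \<le> real n then g x else 0)" for n x
  have Gm [measurable]: "G n \<in> borel_measurable borel" for n unfolding G_def by measurable
  have lim: "(\<lambda>n. hat (G n) s) \<longlonglongrightarrow> hat g s" for s
    unfolding hat_def
  proof (rule Bochner_Integration.integral_dominated_convergence)
    show "integrable lborel (\<lambda>x. 2 * jost_bound \<delta> * norm (g x))" using ig by auto
    show "AE x in lborel. norm (of_real (psi s x) * G n x) \<le> 2 * jost_bound \<delta> * norm (g x)" for n
    proof (rule AE_I2)
      fix x
      have "norm (of_real (psi s x) * G n x) \<le> norm (of_real (psi s x) * g x)"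
        by (simp add: G_def norm_mult)
      also have "\<dots> \<le> 2 * jost_bound \<delta> * norm (g x)"
        by (rule norm_psi_mult_le[OF \<delta> \<delta>2])
      finally show "norm (of_real (psi s x) * G n x) \<le> 2 * jost_bound \<delta> * norm (g x)" .
    qed
    show "AE x in lborel. (\<lambda>n. of_real (psi s x) * G n x) \<longlonglongrightarrow> of_real (psi s x) * g x"
    proof (intro AE_I2 tendsto_mult tendsto_const)
      fix x
      obtain m :: nat where m: "norm (g x) \<le> real m" using real_arch_simple by blast
      have "eventually (\<lambda>n. g x = G n x) sequentially"
        using eventually_ge_at_top[of m] by eventually_elim (use m in \<open>auto simp: G_def\<close>)
      thus "(\<lambda>n. G n x) \<longlonglongrightarrow> g x" by (rule Lim_transform_eventually[OF tendsto_const])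
    qed
  qed measurable
  have "l2sq (hat g) = (\<integral>\<^sup>+s. liminf (\<lambda>n. ennreal ((norm (hat (G n) s))\<^sup>2)) \<partial>lborel)"
    unfolding l2sq_def
  proof (rule nn_integral_cong)
    fix s
    have "(\<lambda>n. ennreal ((norm (hat (G n) s))\<^sup>2)) \<longlonglongrightarrow> ennreal ((norm (hat g s))\<^sup>2)"
      by (intro tendsto_ennrealI tendsto_intros lim)
    thus "ennreal ((norm (hat g s))\<^sup>2) = liminf (\<lambda>n. ennreal ((norm (hat (G n) s))\<^sup>2))"
      by (rule lim_imp_Liminf[OF trivial_limit_sequentially, symmetric])
  qed
  also have "\<dots> \<le> liminf (\<lambda>n. l2sq (hat (G n)))"
    unfolding l2sq_def by (intro nn_integral_liminf) measurable
  also have "\<dots> \<le> liminf (\<lambda>n::nat. ennreal (2 * pi) * l2sq g)"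
  proof (rule Liminf_mono, rule always_eventually, rule allI)
    fix n
    have "l2sq (hat (G n)) = ennreal (2 * pi) * l2sq (G n)"
      by (rule parseval[where B = "real n" and \<delta> = \<delta> and R = R]) (use supp \<delta> in \<open>auto simp: G_def\<close>)
    also have "\<dots> \<le> ennreal (2 * pi) * l2sq g"
      by (intro mult_left_mono l2sq_mono) (auto simp: G_def)
    finally show "l2sq (hat (G n)) \<le> ennreal (2 * pi) * l2sq g" .
  qed
  also have "\<dots> = ennreal (2 * pi) * l2sq g" by (simp add: Liminf_const)
  finally show ?thesis .
qed

section \<open>Boundedness of the adjoint and inversion for bounded functions\<close>

lemma synth_nonpos: "x \<le> 0 \<Longrightarrow> synth k x = 0"
  by (simp add: synth_def psi_def)

lemma interval_exhaustion:
  fixes h :: "real \<Rightarrow> complex"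
  assumes "\<And>x. x \<le> 0 \<Longrightarrow> h x = 0"
  shows "eventually (\<lambda>n. indicator {1 / (real n + 1)..real n + 1} x * h x = h x) sequentially"
proof (cases "x > 0")
  case True
  obtain m :: nat where m: "max x (1 / x) \<le> real m" using real_arch_simple by blast
  show ?thesis using eventually_ge_at_top[of m]
  proof eventually_elim
    case (elim n)
    have "x \<le> real n + 1" "1 / x \<le> real n + 1" using m elim by auto
    hence "1 / (real n + 1) \<le> x" using True by (simp add: field_simps)
    with \<open>x \<le> real n + 1\<close> show ?case by simp
  qed
qed (use assms in auto)

text \<open>Duality: \<open>synth k\<close> is paired with its own truncation U n. The pairing
  equals the squared norm of U n on one side and is controlled by k and \<open>hat (U n)\<close> on
  the other; Parseval for U n lets half of it be absorbed. Fatou removes the truncation.\<close>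

lemma adjoint_bound:
  fixes k :: "real \<Rightarrow> complex"
  assumes k [measurable]: "k \<in> borel_measurable borel" and fin: "l2sq k < \<infinity>"
    and supp: "\<And>s. s \<notin> {0..S} \<Longrightarrow> k s = 0"
  shows "l2sq (synth k) \<le> ennreal (2 * pi) * l2sq k"
proof -
  have [measurable]: "cnj \<in> borel_measurable borel"
    by (intro borel_measurable_continuous_onI continuous_intros)
  have ik: "integrable lborel k" by (rule l2_compact_support_integrable[OF k fin supp])
  define U where "U n x = indicator {1 / (real n + 1)..real n + 1} x * synth k x" for n x
  have Um [measurable]: "U n \<in> borel_measurable borel" for n unfolding U_def by measurable
  have bound: "l2sq (U n) \<le> ennreal (2 * pi) * l2sq k" for n
  proof -
    define \<delta> where "\<delta> = 1 / (real n + 1)"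
    have \<delta>: "\<delta> > 0" by (simp add: \<delta>_def)
    define B where "B = (LINT s|lborel. 2 * jost_bound \<delta> * norm (k s))"
    have UB: "norm (U n x) \<le> B" for x
    proof (cases "x \<in> {\<delta>..real n + 1}")
      case True
      have "norm (synth k x) \<le> B"
        unfolding synth_def B_def
      proof (rule Bochner_Integration.integral_norm_bound_integral)
        have le: "norm (of_real (psi s x) * k s) \<le> 2 * jost_bound \<delta> * norm (k s)" for s
          unfolding norm_mult using abs_psi_le[of \<delta> x s] \<delta> True by (intro mult_right_mono) auto
        thus "norm (of_real (psi s x) * k s) \<le> 2 * jost_bound \<delta> * norm (k s)" for s .
        show i: "integrable lborel (\<lambda>s. 2 * jost_bound \<delta> * norm (k s))" using ik by auto
        show "integrable lborel (\<lambda>s. of_real (psi s x) * k s)"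
          by (rule Bochner_Integration.integrable_bound[OF i])
             (measurable, intro AE_I2 order_trans[OF le], auto simp only: real_norm_def abs_ge_self)
      qed
      thus ?thesis using True by (simp add: U_def \<delta>_def)
    next
      case False
      have "B \<ge> 0" unfolding B_def using jost_bound_nonneg[OF \<delta>] by (intro integral_nonneg_AE AE_I2) auto
      thus ?thesis using False by (simp add: U_def \<delta>_def)
    qed
    have Us: "U n x = 0" if "x \<notin> {\<delta>..real n + 1}" for x using that by (simp add: U_def \<delta>_def)
    have finU: "l2sq (U n) < \<infinity>" by (rule l2sq_bounded_support_finite[OF Um UB Us])
    have P: "l2sq (hat (U n)) = ennreal (2 * pi) * l2sq (U n)" by (rule parseval[OF Um UB Us \<delta>])
    have finH: "l2sq (hat (U n)) < \<infinity>" unfolding P using finU by (simp add: ennreal_mult_less_top)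
    have iU: "integrable lborel (U n)" by (rule integrable_bounded_support[OF Um UB Us])
    have icU: "integrable lborel (\<lambda>x. cnj (U n x))" using iU by (simp add: integrable_cnj)
    have c\<delta>: "\<forall>x. cnj (U n x) \<noteq> 0 \<longrightarrow> \<delta> \<le> x" using Us by force
    note F = psi_fubini[OF ik icU \<delta> c\<delta>]
    define a where "a = (LINT x|lborel. (norm (U n x))\<^sup>2)"
    define b where "b = (LINT s|lborel. (norm (k s))\<^sup>2)"
    have ab: "a \<ge> 0" "b \<ge> 0" unfolding a_def b_def by (auto intro!: integral_nonneg_AE)
    have ea: "ennreal a = l2sq (U n)" and eb: "ennreal b = l2sq k"
      and ec: "ennreal (LINT s|lborel. (norm (hat (U n) s))\<^sup>2) = l2sq (hat (U n))"
      unfolding a_def b_def by (rule l2_integrable(2), measurable, rule finU fin finH)+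
    have "ennreal (LINT s|lborel. (norm (hat (U n) s))\<^sup>2) = ennreal (2 * pi * a)"
      unfolding ec P ea[symmetric] by (rule ennreal_mult[symmetric]) (use ab in auto)
    hence c: "(LINT s|lborel. (norm (hat (U n) s))\<^sup>2) = 2 * pi * a"
      using ab by (subst (asm) ennreal_inj) (auto intro!: integral_nonneg_AE)
    have "cnj (U n x) * synth k x = of_real ((norm (U n x))\<^sup>2)" for x
      unfolding complex_norm_square by (auto simp: U_def indicator_def)
    hence "(LINT x|lborel. cnj (U n x) * synth k x) = of_real a"
      unfolding a_def by (simp only: integral_complex_of_real)
    hence "a = norm (LINT s|lborel. k s * hat (\<lambda>x. cnj (U n x)) s)"
      using F(3) ab by simp
    also have "\<dots> \<le> (LINT s|lborel. pi * (norm (k s))\<^sup>2 + (norm (hat (U n) s))\<^sup>2 / (4 * pi))"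
    proof (rule Bochner_Integration.integral_norm_bound_integral[OF F(1)])
      show "integrable lborel (\<lambda>s. pi * (norm (k s))\<^sup>2 + (norm (hat (U n) s))\<^sup>2 / (4 * pi))"
        by (intro Bochner_Integration.integrable_add integrable_mult_right integrable_divide l2_integrable fin finH) measurable
      fix s
      \<comment> \<open>The weights are chosen so that, after the norm of the transform is replaced
        by 2 pi * a, the second term is a / 2.\<close>
      have "p * q \<le> pi * p\<^sup>2 + q\<^sup>2 / (4 * pi)" for p q :: real
      proof -
        have "0 \<le> (2 * pi * p - q)\<^sup>2 / (4 * pi)" by simp
        also have "(2 * pi * p - q)\<^sup>2 / (4 * pi) = pi * p\<^sup>2 + q\<^sup>2 / (4 * pi) - p * q"
          by (simp add: power2_eq_square field_simps)
        finally show ?thesis by simp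
      qed
      thus "norm (k s * hat (\<lambda>x. cnj (U n x)) s) \<le> pi * (norm (k s))\<^sup>2 + (norm (hat (U n) s))\<^sup>2 / (4 * pi)"
        unfolding cnj_hat[symmetric] norm_mult complex_mod_cnj .
    qed
    also have "\<dots> = pi * b + (2 * pi * a) / (4 * pi)"
    proof -
      have i1: "integrable lborel (\<lambda>s. pi * (norm (k s))\<^sup>2)"
        by (intro integrable_mult_right l2_integrable fin) measurable
      have i2: "integrable lborel (\<lambda>s. (norm (hat (U n) s))\<^sup>2 / (4 * pi))"
        by (intro integrable_divide l2_integrable finH) measurable
      show ?thesis unfolding b_def c[symmetric] Bochner_Integration.integral_add[OF i1 i2] by simp
    qed
    also have "(2 * pi * a) / (4 * pi) = a / 2" by simp
    finally have "a \<le> 2 * pi * b" by simp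
    hence "ennreal a \<le> ennreal (2 * pi * b)" by (rule ennreal_leI)
    also have "\<dots> = ennreal (2 * pi) * ennreal b" by (rule ennreal_mult) (use ab in auto)
    finally show ?thesis unfolding ea eb .
  qed
  have "l2sq (synth k) = (\<integral>\<^sup>+x. liminf (\<lambda>n. ennreal ((norm (U n x))\<^sup>2)) \<partial>lborel)"
    unfolding l2sq_def
  proof (rule nn_integral_cong)
    fix x
    have "(\<lambda>n. U n x) \<longlonglongrightarrow> synth k x"
    proof (rule Lim_transform_eventually[OF tendsto_const])
      have "eventually (\<lambda>n. indicator {1 / (real n + 1)..real n + 1} x * synth k x = synth k x) sequentially"
        by (rule interval_exhaustion) (rule synth_nonpos)
      thus "eventually (\<lambda>n. synth k x = U n x) sequentially" by eventually_elim (simp add: U_def)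
    qed
    hence "(\<lambda>n. ennreal ((norm (U n x))\<^sup>2)) \<longlonglongrightarrow> ennreal ((norm (synth k x))\<^sup>2)"
      by (intro tendsto_ennrealI tendsto_intros)
    thus "ennreal ((norm (synth k x))\<^sup>2) = liminf (\<lambda>n. ennreal ((norm (U n x))\<^sup>2))"
      by (rule lim_imp_Liminf[OF trivial_limit_sequentially, symmetric])
  qed
  also have "\<dots> \<le> liminf (\<lambda>n. l2sq (U n))"
    unfolding l2sq_def by (intro nn_integral_liminf) measurable
  also have "\<dots> \<le> liminf (\<lambda>n::nat. ennreal (2 * pi) * l2sq k)"
    by (rule Liminf_mono, rule always_eventually, rule allI, rule bound)
  also have "\<dots> = ennreal (2 * pi) * l2sq k" by (simp add: Liminf_const)
  finally show ?thesis .
qed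

text \<open>With k = \<open>hat g\<close> cut to [0, S], \<beta> its squared norm and v =
  \<open>synth k\<close> / (2 pi), the cross term is 2 \<beta> / (2 pi) and the squared norm of v is
  at most \<beta> / (2 pi). So the error is at most a - \<beta> / (2 pi), which tends to 0 by
  Parseval.\<close>

lemma inversion_bounded:
  fixes g :: "real \<Rightarrow> complex"
  assumes g [measurable]: "g \<in> borel_measurable borel" and B: "\<And>x. norm (g x) \<le> B"
    and supp: "\<And>x. x \<notin> {\<delta>..R} \<Longrightarrow> g x = 0" and \<delta>: "\<delta> > 0"
  shows "((\<lambda>S. l2sq (\<lambda>x. g x - of_real (1 / (2 * pi)) * synth (\<lambda>s. indicator {0..S} s * hat g s) x)) \<longlongrightarrow> 0) at_top"
proof -
  have [measurable]: "cnj \<in> borel_measurable borel"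
    by (intro borel_measurable_continuous_onI continuous_intros)
  have ig: "integrable lborel g" by (rule integrable_bounded_support[OF g B supp])
  have fing: "l2sq g < \<infinity>" by (rule l2sq_bounded_support_finite[OF g B supp])
  have P: "l2sq (hat g) = ennreal (2 * pi) * l2sq g" by (rule parseval[OF g B supp \<delta>])
  have finH: "l2sq (hat g) < \<infinity>" unfolding P using fing by (simp add: ennreal_mult_less_top)
  have iH: "integrable lborel (\<lambda>s. (norm (hat g s))\<^sup>2)" by (rule l2_integrable(1)[OF _ finH]) measurable
  define a where "a = (LINT x|lborel. (norm (g x))\<^sup>2)"
  have a0: "a \<ge> 0" unfolding a_def by (auto intro!: integral_nonneg_AE)
  define \<beta> where "\<beta> S = (LINT s|lborel. indicator {..S} s *\<^sub>R (norm (hat g s))\<^sup>2)" for S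
  have tot: "(LINT s|lborel. (norm (hat g s))\<^sup>2) = 2 * pi * a"
  proof -
    have "ennreal (LINT s|lborel. (norm (hat g s))\<^sup>2) = l2sq (hat g)"
      by (rule l2_integrable(2)[OF _ finH]) measurable
    also have "\<dots> = ennreal (2 * pi) * ennreal a"
      unfolding P a_def l2_integrable(2)[OF g fing] ..
    also have "\<dots> = ennreal (2 * pi * a)" by (rule ennreal_mult[symmetric]) (use a0 in auto)
    finally show ?thesis using a0 by (subst (asm) ennreal_inj) (auto intro!: integral_nonneg_AE)
  qed
  have \<beta>lim: "(\<beta> \<longlongrightarrow> 2 * pi * a) at_top"
    unfolding \<beta>_def tot[symmetric] by (rule tendsto_integral_at_top[OF _ iH]) simp
  have est: "l2sq (\<lambda>x. g x - of_real (1 / (2 * pi)) * synth (\<lambda>s. indicator {0..S} s * hat g s) x) \<le>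
      ennreal (a - \<beta> S / (2 * pi))" for S
  proof -
    define k where "k s = indicator {0..S} s * hat g s" for s
    have km [measurable]: "k \<in> borel_measurable borel" unfolding k_def by measurable
    have kle: "l2sq k \<le> l2sq (hat g)" by (rule l2sq_mono) (auto simp: k_def indicator_def)
    have fink: "l2sq k < \<infinity>" using kle finH by (rule le_less_trans)
    have ks: "k s = 0" if "s \<notin> {0..S}" for s using that by (simp add: k_def)
    have ik: "integrable lborel k" by (rule l2_compact_support_integrable[OF km fink ks])
    have k2: "(LINT s|lborel. (norm (k s))\<^sup>2) = \<beta> S"
      unfolding \<beta>_def
      by (intro Bochner_Integration.integral_cong) (auto simp: k_def indicator_def hat_negative)
    define v where "v x = of_real (1 / (2 * pi)) * synth k x" for x
    have vm [measurable]: "v \<in> borel_measurable borel" unfolding v_def by measurable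
    have "l2sq v = ennreal ((norm (complex_of_real (1 / (2 * pi))))\<^sup>2) * l2sq (synth k)"
      unfolding v_def by (rule l2sq_cmult) measurable
    also have "\<dots> \<le> ennreal ((1 / (2 * pi))\<^sup>2) * (ennreal (2 * pi) * l2sq k)"
      by (intro mult_mono adjoint_bound[OF km fink ks]) (auto simp: norm_divide)
    also have "l2sq k = ennreal (\<beta> S)" unfolding k2[symmetric] by (rule l2_integrable(2)[OF km fink, symmetric])
    also have "ennreal ((1 / (2 * pi))\<^sup>2) * (ennreal (2 * pi) * ennreal (\<beta> S)) = ennreal (\<beta> S / (2 * pi))"
    proof -
      have "\<beta> S \<ge> 0" unfolding k2[symmetric] by (auto intro!: integral_nonneg_AE)
      hence "ennreal ((1 / (2 * pi))\<^sup>2) * (ennreal (2 * pi) * ennreal (\<beta> S)) = ennreal ((1 / (2 * pi))\<^sup>2 * (2 * pi * \<beta> S))"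
        by (simp add: ennreal_mult)
      also have "(1 / (2 * pi))\<^sup>2 * (2 * pi * \<beta> S) = \<beta> S / (2 * pi)" by (simp add: power2_eq_square field_simps)
      finally show ?thesis .
    qed
    finally have v2: "l2sq v \<le> ennreal (\<beta> S / (2 * pi))" .
    have finv: "l2sq v < \<infinity>" using v2 by (rule le_less_trans) simp
    have \<beta>0: "\<beta> S \<ge> 0" unfolding k2[symmetric] by (auto intro!: integral_nonneg_AE)
    have v3: "(LINT x|lborel. (norm (v x))\<^sup>2) \<le> \<beta> S / (2 * pi)"
      using v2 unfolding l2_integrable(2)[OF vm finv, symmetric] using \<beta>0 by (subst (asm) ennreal_le_iff) auto
    have icg: "integrable lborel (\<lambda>x. cnj (g x))" using ig by (simp add: integrable_cnj)
    have c\<delta>: "\<forall>x. cnj (g x) \<noteq> 0 \<longrightarrow> \<delta> \<le> x" using supp by force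
    note F = psi_fubini[OF ik icg \<delta> c\<delta>]
    \<comment> \<open>k either equals \<open>hat g\<close> or vanishes, so the pairing is again a
      squared modulus.\<close>
    have kh: "k s * hat (\<lambda>x. cnj (g x)) s = of_real ((norm (k s))\<^sup>2)" for s
      unfolding cnj_hat[symmetric] complex_norm_square by (auto simp: k_def indicator_def)
    have "(LINT x|lborel. cnj (g x) * synth k x) = of_real (\<beta> S)"
      using F(3) unfolding kh integral_complex_of_real k2 by simp
    hence cv: "(LINT x|lborel. cnj (g x) * v x) = of_real (\<beta> S / (2 * pi))"
    proof -
      assume *: "(LINT x|lborel. cnj (g x) * synth k x) = of_real (\<beta> S)"
      have "(LINT x|lborel. cnj (g x) * v x) = (LINT x|lborel. of_real (1 / (2 * pi)) * (cnj (g x) * synth k x))"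
        by (intro Bochner_Integration.integral_cong refl) (simp only: v_def mult_ac)
      also have "\<dots> = of_real (1 / (2 * pi)) * of_real (\<beta> S)"
        unfolding integral_mult_right_zero * ..
      finally show ?thesis by simp
    qed
    have icv: "integrable lborel (\<lambda>x. cnj (g x) * v x)"
    proof -
      have "cnj (g x) * v x = of_real (1 / (2 * pi)) * (cnj (g x) * synth k x)" for x
        by (simp only: v_def mult_ac)
      thus ?thesis by (simp only: integrable_mult_right[OF F(2)])
    qed
    have pt: "(norm (g x - v x))\<^sup>2 = (norm (g x))\<^sup>2 - 2 * Re (cnj (g x) * v x) + (norm (v x))\<^sup>2" for x
      unfolding cmod_power2 by (simp add: power2_eq_square algebra_simps)
    have i1: "integrable lborel (\<lambda>x. (norm (g x))\<^sup>2)" by (rule l2_integrable(1)[OF g fing])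
    have i2: "integrable lborel (\<lambda>x. 2 * Re (cnj (g x) * v x))" using integrable_Re[OF icv] by (rule integrable_mult_right)
    have i3: "integrable lborel (\<lambda>x. (norm (v x))\<^sup>2)" by (rule l2_integrable(1)[OF vm finv])
    have "(LINT x|lborel. (norm (g x - v x))\<^sup>2) = a - 2 * Re (of_real (\<beta> S / (2 * pi))) + (LINT x|lborel. (norm (v x))\<^sup>2)"
      unfolding pt a_def cv[symmetric] integral_Re[OF icv, symmetric]
        Bochner_Integration.integral_add[OF Bochner_Integration.integrable_diff[OF i1 i2] i3]
        Bochner_Integration.integral_diff[OF i1 i2] integral_mult_right_zero ..
    also have "\<dots> \<le> a - \<beta> S / (2 * pi)" using v3 by simp
    finally have le: "(LINT x|lborel. (norm (g x - v x))\<^sup>2) \<le> a - \<beta> S / (2 * pi)" .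
    have "l2sq (\<lambda>x. g x - v x) \<le> 2 * l2sq g + 2 * l2sq v" by (rule l2sq_diff_le) measurable
    also have "\<dots> < \<infinity>" using fing finv by (simp add: ennreal_mult_less_top)
    finally have "l2sq (\<lambda>x. g x - v x) = ennreal (LINT x|lborel. (norm (g x - v x))\<^sup>2)"
      by (intro l2_integrable(2)[symmetric]) measurable
    also have "\<dots> \<le> ennreal (a - \<beta> S / (2 * pi))" by (rule ennreal_leI[OF le])
    finally show ?thesis by (simp only: v_def k_def[abs_def])
  qed
  have "((\<lambda>S. ennreal (a - \<beta> S / (2 * pi))) \<longlongrightarrow> ennreal (a - 2 * pi * a / (2 * pi))) at_top"
    by (intro tendsto_ennrealI tendsto_intros \<beta>lim) auto
  hence "((\<lambda>S. ennreal (a - \<beta> S / (2 * pi))) \<longlongrightarrow> 0) at_top" by simp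
  thus ?thesis
    by (rule tendsto_sandwich[OF _ _ tendsto_const, rotated 2]) (use est in \<open>auto intro!: always_eventually\<close>)
qed

section \<open>Inversion on the half line\<close>

lemma tendsto_ennreal_0I:
  fixes f :: "'a \<Rightarrow> ennreal"
  assumes "\<And>r::real. r > 0 \<Longrightarrow> eventually (\<lambda>x. f x \<le> ennreal r) F"
  shows "(f \<longlongrightarrow> 0) F"
proof (rule order_tendstoI)
  fix a :: ennreal assume "0 < a"
  then obtain b where b: "0 < b" "b < a" using dense by blast
  then obtain r where r: "b = ennreal r" "r \<ge> 0" by (cases b) auto
  hence "r > 0" using b by (auto simp: ennreal_less_zero_iff)
  hence "eventually (\<lambda>x. f x \<le> ennreal r) F" by (rule assms)
  thus "eventually (\<lambda>x. f x < a) F" by eventually_elim (use b r in auto)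
qed simp

lemma tendsto_ennreal_0D:
  fixes f :: "'a \<Rightarrow> ennreal"
  assumes "(f \<longlongrightarrow> 0) F" "r > 0"
  shows "eventually (\<lambda>x. f x \<le> ennreal r) F"
  using order_tendstoD(2)[OF assms(1), of "ennreal r"] assms(2)
  by (auto elim!: eventually_mono simp: less_imp_le)

lemma l2sq_dominated:
  fixes h :: "real \<Rightarrow> complex"
  assumes [measurable]: "h \<in> borel_measurable borel" "\<And>n. f n \<in> borel_measurable borel"
    and fin: "l2sq h < \<infinity>" and bd: "\<And>n x. norm (f n x) \<le> norm (h x)" and lim: "\<And>x. (\<lambda>n. f n x) \<longlonglongrightarrow> h x"
  shows "(\<lambda>n. l2sq (\<lambda>x. h x - f n x)) \<longlonglongrightarrow> 0"
proof -
  have "(\<lambda>n. \<integral>\<^sup>+x. ennreal ((norm (h x - f n x))\<^sup>2) \<partial>lborel) \<longlonglongrightarrow> (\<integral>\<^sup>+(x::real). 0 \<partial>lborel)"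
  proof (rule nn_integral_dominated_convergence)
    show "AE x in lborel. ennreal ((norm (h x - f n x))\<^sup>2) \<le> 4 * ennreal ((norm (h x))\<^sup>2)" for n
    proof (rule AE_I2)
      fix x
      have "norm (h x - f n x) \<le> 2 * norm (h x)"
        using norm_triangle_ineq4[of "h x" "f n x"] bd[of n x] by linarith
      hence "(norm (h x - f n x))\<^sup>2 \<le> (2 * norm (h x))\<^sup>2" by (intro power_mono) auto
      hence "ennreal ((norm (h x - f n x))\<^sup>2) \<le> ennreal (4 * (norm (h x))\<^sup>2)"
        by (intro ennreal_leI) (simp add: power_mult_distrib)
      also have "\<dots> = 4 * ennreal ((norm (h x))\<^sup>2)" by (simp add: ennreal_mult)
      finally show "ennreal ((norm (h x - f n x))\<^sup>2) \<le> 4 * ennreal ((norm (h x))\<^sup>2)" .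
    qed
    have "(\<integral>\<^sup>+x. 4 * ennreal ((norm (h x))\<^sup>2) \<partial>lborel) = 4 * l2sq h"
      unfolding l2sq_def by (rule nn_integral_cmult) measurable
    thus "(\<integral>\<^sup>+x. 4 * ennreal ((norm (h x))\<^sup>2) \<partial>lborel) < \<infinity>"
      using fin by (simp add: ennreal_mult_less_top)
    show "AE x in lborel. (\<lambda>n. ennreal ((norm (h x - f n x))\<^sup>2)) \<longlonglongrightarrow> 0"
    proof (rule AE_I2)
      fix x
      have "(\<lambda>n. ennreal ((norm (h x - f n x))\<^sup>2)) \<longlonglongrightarrow> ennreal ((norm (h x - h x))\<^sup>2)"
        by (intro tendsto_ennrealI tendsto_intros lim)
      thus "(\<lambda>n. ennreal ((norm (h x - f n x))\<^sup>2)) \<longlonglongrightarrow> 0" by simp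
    qed
  qed measurable
  thus ?thesis by (simp add: l2sq_def)
qed

lemma hat_diff:
  assumes "integrable lborel f" "integrable lborel g" "\<delta> > 0"
    "\<forall>x. f x \<noteq> 0 \<longrightarrow> \<delta> \<le> x" "\<forall>x. g x \<noteq> 0 \<longrightarrow> \<delta> \<le> x"
  shows "hat (\<lambda>x. f x - g x) s = hat f s - hat g s"
  unfolding hat_def right_diff_distrib
  by (rule Bochner_Integration.integral_diff; rule psi_mult_integrable; fact assms)

text \<open>The two supports may differ; the hull of the intervals still stays away from 0.\<close>

lemma hat_diff_bessel:
  fixes f g :: "real \<Rightarrow> complex"
  assumes f [measurable]: "f \<in> borel_measurable borel" and g [measurable]: "g \<in> borel_measurable borel"
    and fin: "l2sq f < \<infinity>" "l2sq g < \<infinity>"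
    and supp: "\<And>x. x \<notin> {a..b} \<Longrightarrow> f x = 0" "\<And>x. x \<notin> {c..d} \<Longrightarrow> g x = 0" and pos: "a > 0" "c > 0"
  shows "l2sq (\<lambda>s. hat f s - hat g s) \<le> ennreal (2 * pi) * l2sq (\<lambda>x. f x - g x)"
proof -
  define \<delta> R where "\<delta> = min a c" and "R = max b d"
  have \<delta>: "\<delta> > 0" using pos by (simp add: \<delta>_def)
  have sf: "f x = 0" if "x \<notin> {\<delta>..R}" for x by (rule supp(1)) (use that in \<open>auto simp: \<delta>_def R_def\<close>)
  have sg: "g x = 0" if "x \<notin> {\<delta>..R}" for x by (rule supp(2)) (use that in \<open>auto simp: \<delta>_def R_def\<close>)
  have "hat (\<lambda>x. f x - g x) s = hat f s - hat g s" for s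
    by (rule hat_diff[OF l2_compact_support_integrable[OF f fin(1) sf] l2_compact_support_integrable[OF g fin(2) sg] \<delta>])
       (use sf sg in force)+
  hence eq: "(\<lambda>s. hat f s - hat g s) = hat (\<lambda>x. f x - g x)" by auto
  have "l2sq (\<lambda>x. f x - g x) \<le> 2 * l2sq f + 2 * l2sq g" by (rule l2sq_diff_le) measurable
  also have "\<dots> < \<infinity>" using fin by (simp add: ennreal_mult_less_top)
  finally have "l2sq (\<lambda>x. f x - g x) < \<infinity>" .
  thus ?thesis unfolding eq
    by (intro bessel[where \<delta> = \<delta> and R = R] \<delta>) (use sf sg in auto)
qed

text \<open>Completeness of L2 by hand: a fast subsequence of transforms of truncations converges
  a.e. to H. The estimate, valid for every truncation, follows by Fatou and expresses that H is the
  L2-limit.\<close>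

lemma l2_transform_exists:
  fixes h :: "real \<Rightarrow> complex"
  assumes h [measurable]: "h \<in> borel_measurable borel" and fin: "l2sq h < \<infinity>" and pos: "\<And>x. x \<le> 0 \<Longrightarrow> h x = 0"
  obtains H where "H \<in> borel_measurable borel"
    "\<And>\<alpha> \<beta>. 0 < \<alpha> \<Longrightarrow> l2sq (\<lambda>s. H s - hat (\<lambda>x. indicator {\<alpha>..\<beta>} x * h x) s) \<le>
       ennreal (2 * pi) * l2sq (\<lambda>x. h x - indicator {\<alpha>..\<beta>} x * h x)"
proof -
  define hn where "hn n x = indicator {1 / (real n + 1)..real n + 1} x * h x" for n x
  have hnm [measurable]: "hn n \<in> borel_measurable borel" for n unfolding hn_def by measurable
  have hnle: "norm (hn n x) \<le> norm (h x)" for n x by (auto simp: hn_def indicator_def)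
  have hnfin: "l2sq (hn n) < \<infinity>" for n using l2sq_mono[of "hn n" h] hnle fin by (auto intro: le_less_trans)
  have hnsupp: "hn n x = 0" if "x \<notin> {1 / (real n + 1)..real n + 1}" for n x using that by (simp add: hn_def)
  have hnlim: "(\<lambda>n. hn n x) \<longlonglongrightarrow> h x" for x
    by (rule Lim_transform_eventually[OF tendsto_const])
       (use interval_exhaustion[where h = h and x = x, OF pos] in \<open>auto elim!: eventually_mono simp: hn_def\<close>)
  have r: "(\<lambda>n. l2sq (\<lambda>x. h x - hn n x)) \<longlonglongrightarrow> 0"
    by (rule l2sq_dominated[OF h hnm fin hnle hnlim])
  \<comment> \<open>The rate 8^-k leaves room for the weight 2^k below: their product 4^-k is
    summable.\<close>
  have "\<exists>n\<ge>k. l2sq (\<lambda>x. h x - hn n x) \<le> ennreal ((1/8) ^ k)" for k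
  proof -
    have "eventually (\<lambda>n. l2sq (\<lambda>x. h x - hn n x) \<le> ennreal ((1/8) ^ k)) sequentially"
      by (rule tendsto_ennreal_0D[OF r]) simp
    hence "eventually (\<lambda>n. n \<ge> k \<and> l2sq (\<lambda>x. h x - hn n x) \<le> ennreal ((1/8) ^ k)) sequentially"
      using eventually_ge_at_top[of k] by eventually_elim auto
    thus ?thesis by (auto simp: eventually_sequentially)
  qed
  then obtain m where m: "\<And>k. m k \<ge> k" "\<And>k. l2sq (\<lambda>x. h x - hn (m k) x) \<le> ennreal ((1/8) ^ k)"
    by metis
  define d where "d k s = hat (hn (m (Suc k))) s - hat (hn (m k)) s" for k s
  have dm [measurable]: "d k \<in> borel_measurable borel" for k unfolding d_def by measurable
  have d2: "l2sq (d k) \<le> ennreal (8 * pi * (1/8) ^ k)" for k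
  proof -
    have "l2sq (d k) \<le> ennreal (2 * pi) * l2sq (\<lambda>x. hn (m (Suc k)) x - hn (m k) x)"
      unfolding d_def by (rule hat_diff_bessel[OF _ _ hnfin hnfin hnsupp hnsupp]) auto
    also have "l2sq (\<lambda>x. hn (m (Suc k)) x - hn (m k) x) =
        l2sq (\<lambda>x. (h x - hn (m k) x) - (h x - hn (m (Suc k)) x))" by simp
    also have "\<dots> \<le> 2 * l2sq (\<lambda>x. h x - hn (m k) x) + 2 * l2sq (\<lambda>x. h x - hn (m (Suc k)) x)"
      by (rule l2sq_diff_le) measurable
    also have "\<dots> \<le> 2 * ennreal ((1/8) ^ k) + 2 * ennreal ((1/8) ^ k)"
    proof (intro add_mono mult_left_mono m)
      have "ennreal ((1/8) ^ Suc k) \<le> ennreal ((1/8) ^ k)" by (intro ennreal_leI) simp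
      thus "l2sq (\<lambda>x. h x - hn (m (Suc k)) x) \<le> ennreal ((1/8) ^ k)" using m(2)[of "Suc k"] by (rule order_trans[rotated])
    qed auto
    also have "\<dots> = ennreal (4 * (1/8) ^ k)"
      by (simp add: ennreal_mult flip: distrib_right)
    also have "ennreal (2 * pi) * ennreal (4 * (1/8) ^ k) = ennreal (8 * pi * (1/8) ^ k)"
      by (subst ennreal_mult[symmetric]) (auto simp: mult_ac)
    finally show ?thesis by (simp add: mult_left_mono)
  qed
  have "(\<integral>\<^sup>+s. (\<Sum>k. ennreal (2 ^ k * (norm (d k s))\<^sup>2)) \<partial>lborel) = (\<Sum>k. \<integral>\<^sup>+s. ennreal (2 ^ k * (norm (d k s))\<^sup>2) \<partial>lborel)"
    by (rule nn_integral_suminf) measurable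
  also have "\<dots> \<le> (\<Sum>k. ennreal (8 * pi * (1/4) ^ k))"
  proof (rule suminf_le)
    fix k
    have "(\<integral>\<^sup>+s. ennreal (2 ^ k * (norm (d k s))\<^sup>2) \<partial>lborel) = ennreal (2 ^ k) * l2sq (d k)"
      unfolding l2sq_def by (subst nn_integral_cmult[symmetric]) (auto simp: ennreal_mult)
    also have "\<dots> \<le> ennreal (2 ^ k) * ennreal (8 * pi * (1/8) ^ k)" by (intro mult_left_mono d2) auto
    also have "\<dots> = ennreal (2 ^ k * (8 * pi * (1/8) ^ k))" by (rule ennreal_mult[symmetric]) auto
    also have "(2::real) ^ k * (8 * pi * (1/8) ^ k) = 8 * pi * (1/4) ^ k"
      by (simp add: power_divide) (simp add: divide_simps flip: power_mult_distrib)
    finally show "(\<integral>\<^sup>+s. ennreal (2 ^ k * (norm (d k s))\<^sup>2) \<partial>lborel) \<le> ennreal (8 * pi * (1/4) ^ k)" .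
  qed auto
  also have "\<dots> < \<infinity>"
  proof -
    have "summable (\<lambda>k. 8 * pi * (1/4::real) ^ k)" by (intro summable_mult summable_geometric) auto
    hence "(\<Sum>k. ennreal (8 * pi * (1/4) ^ k)) = ennreal (\<Sum>k. 8 * pi * (1/4) ^ k)"
      by (intro suminf_ennreal2) auto
    thus ?thesis by simp
  qed
  finally have "AE s in lborel. (\<Sum>k. ennreal (2 ^ k * (norm (d k s))\<^sup>2)) \<noteq> \<infinity>"
    by (intro nn_integral_PInf_AE) auto
  hence conv: "AE s in lborel. convergent (\<lambda>k. hat (hn (m k)) s)"
  proof eventually_elim
    case (elim s)
    have "summable (\<lambda>k. 2 ^ k * (norm (d k s))\<^sup>2)"
      by (rule summable_suminf_not_top) (use elim in auto)
    hence s: "summable (\<lambda>k. 2 ^ k * (norm (d k s))\<^sup>2 + (1/2) ^ k)"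
      by (intro summable_add summable_geometric) auto
    have "norm (d k s) \<le> 2 ^ k * (norm (d k s))\<^sup>2 + (1/2) ^ k" for k
    proof -
      define q where "q = (2::real) ^ k"
      have q: "q > 0" by (simp add: q_def)
      define u where "u = norm (d k s)"
      \<comment> \<open>This yields u <= q * u^2 + 1/q, so the weighted square sum and the geometric
        series control the plain sum of the increments.\<close>
      have "0 \<le> (q * u - 1)\<^sup>2 + q * u" using q by (intro add_nonneg_nonneg) (auto simp: u_def)
      hence "q * u \<le> q * (q * u\<^sup>2 + 1 / q)" using q by (simp add: power2_eq_square algebra_simps)
      hence "u \<le> q * u\<^sup>2 + 1 / q" using q by (simp add: mult_le_cancel_left_pos)
      thus ?thesis by (simp add: q_def u_def power_one_over)
    qed
    hence "summable (\<lambda>k. d k s)"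
      by (rule summable_comparison_test'[OF s, where N = 0])
    hence "convergent (\<lambda>n. \<Sum>k<n. d k s)" by (simp add: summable_iff_convergent)
    hence "convergent (\<lambda>n. hat (hn (m n)) s - hat (hn (m 0)) s)"
      unfolding d_def sum_lessThan_telescope[of "\<lambda>k. hat (hn (m k)) s"] .
    thus ?case by (simp add: convergent_diff_const_right_iff)
  qed
  \<comment> \<open>Where the sequence diverges \<open>lim\<close> is a default value, on a null set
    only.\<close>
  define H where "H s = lim (\<lambda>k. hat (hn (m k)) s)" for s
  have Hm [measurable]: "H \<in> borel_measurable borel" unfolding H_def by measurable
  show ?thesis
  proof (rule that[OF Hm])
    fix \<alpha> \<beta> :: real assume \<alpha>: "0 < \<alpha>"
    define hc where "hc x = indicator {\<alpha>..\<beta>} x * h x" for x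
    have hcm [measurable]: "hc \<in> borel_measurable borel" unfolding hc_def by measurable
    have hcfin: "l2sq hc < \<infinity>"
      by (rule le_less_trans[OF l2sq_mono fin]) (auto simp: hc_def indicator_def)
    have hcs: "hc x = 0" if "x \<notin> {\<alpha>..\<beta>}" for x using that by (simp add: hc_def)
    have "l2sq (\<lambda>s. H s - hat hc s) = (\<integral>\<^sup>+s. liminf (\<lambda>k. ennreal ((norm (hat (hn (m k)) s - hat hc s))\<^sup>2)) \<partial>lborel)"
      unfolding l2sq_def
    proof (rule nn_integral_cong_AE, use conv in eventually_elim)
      case (elim s)
      hence "(\<lambda>k. hat (hn (m k)) s) \<longlonglongrightarrow> H s" by (simp add: H_def convergent_LIMSEQ_iff)
      hence "(\<lambda>k. ennreal ((norm (hat (hn (m k)) s - hat hc s))\<^sup>2)) \<longlonglongrightarrow> ennreal ((norm (H s - hat hc s))\<^sup>2)"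
        by (intro tendsto_ennrealI tendsto_intros)
      thus ?case by (rule lim_imp_Liminf[OF trivial_limit_sequentially, symmetric])
    qed
    also have "\<dots> \<le> liminf (\<lambda>k. l2sq (\<lambda>s. hat (hn (m k)) s - hat hc s))"
      unfolding l2sq_def by (intro nn_integral_liminf) measurable
    also have "\<dots> \<le> liminf (\<lambda>k::nat. ennreal (2 * pi) * l2sq (\<lambda>x. h x - hc x))"
    proof (rule Liminf_mono)
      \<comment> \<open>Once [\<alpha>, \<beta>] lies in the exhausting interval, the truncation
        minus hc is dominated by h - hc.\<close>
      obtain K :: nat where K: "max \<beta> (1 / \<alpha>) \<le> real K" using real_arch_simple by blast
      show "eventually (\<lambda>k. l2sq (\<lambda>s. hat (hn (m k)) s - hat hc s) \<le> ennreal (2 * pi) * l2sq (\<lambda>x. h x - hc x)) sequentially"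
        using eventually_ge_at_top[of K]
      proof eventually_elim
        case (elim k)
        have "real K \<le> real (m k)" using elim m(1)[of k] by simp
        hence "\<beta> \<le> real (m k) + 1" "1 / \<alpha> \<le> real (m k) + 1" using K by auto
        hence sub: "{\<alpha>..\<beta>} \<subseteq> {1 / (real (m k) + 1)..real (m k) + 1}" using \<alpha> by (auto simp: field_simps intro: order_trans)
        have "l2sq (\<lambda>s. hat (hn (m k)) s - hat hc s) \<le> ennreal (2 * pi) * l2sq (\<lambda>x. hn (m k) x - hc x)"
          by (rule hat_diff_bessel[OF hnm hcm hnfin hcfin hnsupp hcs _ \<alpha>]) auto
        also have "\<dots> \<le> ennreal (2 * pi) * l2sq (\<lambda>x. h x - hc x)"
          using sub by (intro mult_left_mono l2sq_mono) (auto simp: hn_def hc_def indicator_def)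
        finally show ?case .
      qed
    qed
    also have "\<dots> = ennreal (2 * pi) * l2sq (\<lambda>x. h x - hc x)" by (simp add: Liminf_const)
    finally show "l2sq (\<lambda>s. H s - hat (\<lambda>x. indicator {\<alpha>..\<beta>} x * h x) s) \<le>
       ennreal (2 * pi) * l2sq (\<lambda>x. h x - indicator {\<alpha>..\<beta>} x * h x)"
      by (simp only: hc_def[abs_def])
  qed
qed

lemma synth_diff:
  assumes k1: "integrable lborel k1" and k2: "integrable lborel k2"
  shows "synth (\<lambda>s. k1 s - k2 s) x = synth k1 x - synth k2 x"
proof (cases "x > 0")
  case True
  have i: "integrable lborel (\<lambda>s. of_real (psi s x) * k s)" if k: "integrable lborel k" for k :: "real \<Rightarrow> complex"
  proof -
    have [measurable]: "k \<in> borel_measurable borel" using k by (auto dest: borel_measurable_integrable)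
    have le: "norm (of_real (psi s x) * k s) \<le> 2 * jost_bound x * norm (k s)" for s
      unfolding norm_mult using abs_psi_le[of x x s] True by (intro mult_right_mono) auto
    have "integrable lborel (\<lambda>s. 2 * jost_bound x * norm (k s))" using k by auto
    thus ?thesis
      by (rule Bochner_Integration.integrable_bound)
         (measurable, intro AE_I2 order_trans[OF le], auto simp only: real_norm_def abs_ge_self)
  qed
  show ?thesis
    unfolding synth_def right_diff_distrib by (rule Bochner_Integration.integral_diff[OF i[OF k1] i[OF k2]])
qed (simp add: synth_nonpos)

text \<open>Density argument: h is replaced by bounded G n with support away from 0. H and
  \<open>hat (G n)\<close> differ by at most 8 pi * e n in squared norm, so by
  \<open>adjoint_bound\<close> the syntheses divided by 2 pi differ by at most 4 * e n, uniformly in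
  S.\<close>

lemma inversion:
  fixes h :: "real \<Rightarrow> complex"
  assumes h [measurable]: "h \<in> borel_measurable borel" and fin: "l2sq h < \<infinity>" and pos: "\<And>x. x \<le> 0 \<Longrightarrow> h x = 0"
    and H [measurable]: "H \<in> borel_measurable borel"
    and HB: "\<And>\<alpha> \<beta>. 0 < \<alpha> \<Longrightarrow> l2sq (\<lambda>s. H s - hat (\<lambda>x. indicator {\<alpha>..\<beta>} x * h x) s) \<le>
       ennreal (2 * pi) * l2sq (\<lambda>x. h x - indicator {\<alpha>..\<beta>} x * h x)"
  shows "((\<lambda>S. l2sq (\<lambda>x. h x - of_real (1 / (2 * pi)) * synth (\<lambda>s. indicator {0..S} s * H s) x)) \<longlongrightarrow> 0) at_top"
proof -
  define hn where "hn n x = indicator {1 / (real n + 1)..real n + 1} x * h x" for n x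
  \<comment> \<open>Both the domain and the values are truncated, so that
    \<open>inversion_bounded\<close> applies.\<close>
  define G where "G n x = (if norm (hn n x) \<le> real n then hn n x else 0)" for n x
  have hnm [measurable]: "hn n \<in> borel_measurable borel" for n unfolding hn_def by measurable
  have Gm [measurable]: "G n \<in> borel_measurable borel" for n unfolding G_def by measurable
  have hnle: "norm (hn n x) \<le> norm (h x)" for n x by (auto simp: hn_def indicator_def)
  have Gle: "norm (G n x) \<le> norm (h x)" for n x using hnle[of n x] by (simp add: G_def)
  have hnfin: "l2sq (hn n) < \<infinity>" for n using l2sq_mono[of "hn n" h] hnle fin by (auto intro: le_less_trans)
  have Gfin: "l2sq (G n) < \<infinity>" for n using l2sq_mono[of "G n" h] Gle fin by (auto intro: le_less_trans)
  have hns: "hn n x = 0" if "x \<notin> {1 / (real n + 1)..real n + 1}" for n x using that by (simp add: hn_def)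
  have Gs: "G n x = 0" if "x \<notin> {1 / (real n + 1)..real n + 1}" for n x using hns[OF that] by (simp add: G_def)
  have Gb: "norm (G n x) \<le> real n" for n x by (simp add: G_def)
  have Glim: "(\<lambda>n. G n x) \<longlonglongrightarrow> h x" for x
  proof (rule Lim_transform_eventually[OF tendsto_const])
    obtain K :: nat where K: "norm (h x) \<le> real K" using real_arch_simple by blast
    have "eventually (\<lambda>n. indicator {1 / (real n + 1)..real n + 1} x * h x = h x) sequentially"
      by (rule interval_exhaustion) (rule pos)
    thus "eventually (\<lambda>n. h x = G n x) sequentially"
      using eventually_ge_at_top[of K]
      by eventually_elim (use K in \<open>auto simp: G_def hn_def\<close>)
  qed
  define e where "e n = l2sq (\<lambda>x. h x - G n x)" for n
  have e: "e \<longlonglongrightarrow> 0" unfolding e_def by (rule l2sq_dominated[OF h Gm fin Gle Glim])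
  define t where "t n S = l2sq (\<lambda>x. G n x - of_real (1 / (2 * pi)) * synth (\<lambda>s. indicator {0..S} s * hat (G n) s) x)" for n S
  have t: "(t n \<longlongrightarrow> 0) at_top" for n
    unfolding t_def by (rule inversion_bounded[OF Gm Gb Gs]) auto
  have HG: "l2sq (\<lambda>s. hat (G n) s - H s) \<le> ennreal (8 * pi) * e n" for n
  proof -
    have "l2sq (\<lambda>s. hat (G n) s - H s) = l2sq (\<lambda>s. (hat (G n) s - hat (hn n) s) - (H s - hat (hn n) s))" by simp
    also have "\<dots> \<le> 2 * l2sq (\<lambda>s. hat (G n) s - hat (hn n) s) + 2 * l2sq (\<lambda>s. H s - hat (hn n) s)"
      by (rule l2sq_diff_le) measurable
    also have "\<dots> \<le> 2 * (ennreal (2 * pi) * e n) + 2 * (ennreal (2 * pi) * e n)"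
    proof (intro add_mono mult_left_mono)
      have "l2sq (\<lambda>s. hat (G n) s - hat (hn n) s) \<le> ennreal (2 * pi) * l2sq (\<lambda>x. G n x - hn n x)"
        by (rule hat_diff_bessel[OF Gm hnm Gfin hnfin Gs hns]) auto
      also have "l2sq (\<lambda>x. G n x - hn n x) \<le> e n"
        unfolding e_def by (rule l2sq_mono) (use hnle in \<open>auto simp: G_def\<close>)
      finally show "l2sq (\<lambda>s. hat (G n) s - hat (hn n) s) \<le> ennreal (2 * pi) * e n"
        by (simp add: mult_left_mono)
      have "l2sq (\<lambda>s. H s - hat (hn n) s) \<le> ennreal (2 * pi) * l2sq (\<lambda>x. h x - hn n x)"
        unfolding hn_def by (rule HB) simp
      also have "l2sq (\<lambda>x. h x - hn n x) \<le> e n"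
        unfolding e_def by (rule l2sq_mono) (auto simp: G_def hn_def indicator_def)
      finally show "l2sq (\<lambda>s. H s - hat (hn n) s) \<le> ennreal (2 * pi) * e n"
        by (simp add: mult_left_mono)
    qed auto
    also have "\<dots> = (2 * ennreal (2 * pi) + 2 * ennreal (2 * pi)) * e n" by (simp add: distrib_right mult.assoc)
    also have "2 * ennreal (2 * pi) + 2 * ennreal (2 * pi) = ennreal (8 * pi)"
      by (simp flip: ennreal_numeral ennreal_mult ennreal_plus)
    finally show ?thesis .
  qed
  have est: "l2sq (\<lambda>x. h x - of_real (1 / (2 * pi)) * synth (\<lambda>s. indicator {0..S} s * H s) x) \<le> 18 * e n + 4 * t n S"
    if efin: "e n < \<infinity>" for n S
  proof -
    define k1 where "k1 s = indicator {0..S} s * hat (G n) s" for s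
    define k2 where "k2 s = indicator {0..S} s * H s" for s
    define k where "k s = k1 s - k2 s" for s
    have [measurable]: "k1 \<in> borel_measurable borel" "k2 \<in> borel_measurable borel"
      unfolding k1_def k2_def by measurable
    have km [measurable]: "k \<in> borel_measurable borel" unfolding k_def by measurable
    have HGfin: "l2sq (\<lambda>s. hat (G n) s - H s) < \<infinity>"
      using HG[of n] efin by (auto simp: ennreal_mult_less_top intro: le_less_trans)
    have kle: "l2sq k \<le> l2sq (\<lambda>s. hat (G n) s - H s)"
      by (rule l2sq_mono) (auto simp: k_def k1_def k2_def indicator_def)
    have kfin: "l2sq k < \<infinity>" using kle HGfin by (rule le_less_trans)
    have ks: "k s = 0" if "s \<notin> {0..S}" for s using that by (simp add: k_def k1_def k2_def)
    have "l2sq (hat (G n)) \<le> ennreal (2 * pi) * l2sq (G n)" by (rule bessel[OF Gm Gfin Gs]) auto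
    also have "\<dots> < \<infinity>" using Gfin[of n] by (simp add: ennreal_mult_less_top)
    finally have "l2sq (hat (G n)) < \<infinity>" .
    moreover have "l2sq k1 \<le> l2sq (hat (G n))" by (rule l2sq_mono) (auto simp: k1_def indicator_def)
    ultimately have k1fin: "l2sq k1 < \<infinity>" by (rule le_less_trans[rotated])
    have i1: "integrable lborel k1"
      by (rule l2_compact_support_integrable[OF _ k1fin, of 0 S]) (measurable, simp add: k1_def)
    have ik: "integrable lborel k" by (rule l2_compact_support_integrable[OF km kfin ks])
    \<comment> \<open>Integrability of k2 is inherited from k1 and k, whose norms are already
      bounded.\<close>
    have "integrable lborel (\<lambda>s. k1 s - k s)" using i1 ik by (rule Bochner_Integration.integrable_diff)
    hence i2: "integrable lborel k2" by (simp add: k_def)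
    define c where "c = complex_of_real (1 / (2 * pi))"
    have "l2sq (\<lambda>x. c * synth k x) = ennreal ((norm c)\<^sup>2) * l2sq (synth k)"
      by (rule l2sq_cmult) measurable
    also have "\<dots> \<le> ennreal ((1 / (2 * pi))\<^sup>2) * (ennreal (2 * pi) * (ennreal (8 * pi) * e n))"
    proof (intro mult_mono)
      show "ennreal ((norm c)\<^sup>2) \<le> ennreal ((1 / (2 * pi))\<^sup>2)" unfolding c_def norm_of_real by simp
      have "l2sq (synth k) \<le> ennreal (2 * pi) * l2sq k" by (rule adjoint_bound[OF km kfin ks])
      also have "\<dots> \<le> ennreal (2 * pi) * (ennreal (8 * pi) * e n)"
        by (intro mult_left_mono order_trans[OF kle HG]) auto
      finally show "l2sq (synth k) \<le> ennreal (2 * pi) * (ennreal (8 * pi) * e n)" .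
    qed auto
    also have "\<dots> = ennreal ((1 / (2 * pi))\<^sup>2 * (2 * pi) * (8 * pi)) * e n"
    proof -
      have "ennreal p * (ennreal q * (ennreal u * w)) = ennreal (p * q * u) * w" if "p \<ge> 0" "q \<ge> 0" "u \<ge> 0" for p q u w
        using that by (simp add: ennreal_mult mult.assoc)
      thus ?thesis by simp
    qed
    also have "(1 / (2 * pi))\<^sup>2 * (2 * pi) * (8 * pi) = 4" by (simp add: power2_eq_square)
    finally have 3: "l2sq (\<lambda>x. c * synth k x) \<le> 4 * e n" by simp
    have "h x - c * synth k2 x = (h x - G n x) + ((G n x - c * synth k1 x) + c * synth k x)" for x
      unfolding k_def synth_diff[OF i1 i2] by (simp add: algebra_simps)
    hence "l2sq (\<lambda>x. h x - c * synth k2 x) = l2sq (\<lambda>x. (h x - G n x) + ((G n x - c * synth k1 x) + c * synth k x))"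
      by (rule arg_cong[where f = l2sq, OF ext])
    also have "\<dots> \<le> 2 * e n + 2 * l2sq (\<lambda>x. (G n x - c * synth k1 x) + c * synth k x)"
      unfolding e_def by (rule l2sq_add_le) measurable
    also have "l2sq (\<lambda>x. (G n x - c * synth k1 x) + c * synth k x) \<le>
        2 * l2sq (\<lambda>x. G n x - c * synth k1 x) + 2 * l2sq (\<lambda>x. c * synth k x)"
      by (rule l2sq_add_le) measurable
    also have "l2sq (\<lambda>x. G n x - c * synth k1 x) = t n S"
      by (simp only: t_def c_def k1_def[abs_def])
    also have "2 * t n S + 2 * l2sq (\<lambda>x. c * synth k x) \<le> 2 * t n S + 2 * (4 * e n)"
      by (intro add_mono mult_left_mono 3) auto
    \<comment> \<open>Two uses of the factor-2 inequality: 2 e + 2 * (2 t + 2 * 4 e) = 18 e + 4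
      t.\<close>
    finally have "l2sq (\<lambda>x. h x - c * synth k2 x) \<le> 2 * e n + 2 * (2 * t n S + 2 * (4 * e n))"
      by (simp add: add_left_mono mult_left_mono)
    also have "\<dots> = 18 * e n + 4 * t n S"
      by (simp add: distrib_left mult.assoc[symmetric] add_ac distrib_right[symmetric])
    finally show ?thesis by (simp only: c_def k2_def[abs_def])
  qed
  show ?thesis
  proof (rule tendsto_ennreal_0I)
    fix r :: real assume r: "r > 0"
    \<comment> \<open>18 * (r/36) and 4 * (r/8) are both r/2.\<close>
    have "eventually (\<lambda>n. e n \<le> ennreal (r / 36)) sequentially"
      by (rule tendsto_ennreal_0D[OF e]) (use r in simp)
    then obtain n where n: "e n \<le> ennreal (r / 36)" by (auto simp: eventually_sequentially)
    have efin: "e n < \<infinity>" using n by (rule le_less_trans) simp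
    have "eventually (\<lambda>S. t n S \<le> ennreal (r / 8)) at_top"
      by (rule tendsto_ennreal_0D[OF t]) (use r in simp)
    thus "eventually (\<lambda>S. l2sq (\<lambda>x. h x - of_real (1 / (2 * pi)) * synth (\<lambda>s. indicator {0..S} s * H s) x) \<le> ennreal r) at_top"
    proof eventually_elim
      case (elim S)
      have "18 * e n + 4 * t n S \<le> 18 * ennreal (r / 36) + 4 * ennreal (r / 8)"
        by (intro add_mono mult_left_mono n elim) auto
      also have "\<dots> = ennreal (18 * (r / 36) + 4 * (r / 8))"
      proof -
        have "18 * ennreal u + 4 * ennreal v = ennreal (18 * u + 4 * v)" if "u \<ge> 0" "v \<ge> 0" for u v
          using that by (simp add: ennreal_plus ennreal_mult)
        from this[of "r / 36" "r / 8"] show ?thesis using r by (simp only: divide_nonneg_nonneg less_imp_le zero_le_numeral)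
      qed
      also have "18 * (r / 36) + 4 * (r / 8) = r" by simp
      finally show ?case using est[OF efin, of S] by (rule order_trans[rotated])
    qed
  qed
qed

text \<open>I is a representative of the inner integral, which exists as an L2-limit in s on each
  [0, S]. Because the kernel factorises, I (s, x) = psi (s, x) / 2 * H s with a single transform H
  serves every x.\<close>

theorem theoremA2:
  fixes h :: "real \<Rightarrow> complex"
  assumes "h \<in> borel_measurable lborel"
    and "(\<integral>\<^sup>+ x \<in> {0<..}. ennreal ((cmod (h x))^2) \<partial>lborel) < \<infinity>"
  shows "\<exists>I :: real \<Rightarrow> real \<Rightarrow> complex.
    (\<lambda>(s, x). I s x) \<in> borel_measurable borel \<and>
    (\<forall>x>0. \<forall>S>0.
       ((\<lambda>(\<alpha>, \<beta>). \<integral>\<^sup>+ s \<in> {0..S}.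
           ennreal ((cmod (I s x - (LINT y:{\<alpha>..\<beta>}|lborel. complex_of_real (kerA s x y) * h y)))^2)
         \<partial>lborel) \<longlongrightarrow> 0) (at_right 0 \<times>\<^sub>F at_top)) \<and>
    ((\<lambda>S. \<integral>\<^sup>+ x \<in> {0<..}.
        ennreal ((cmod (h x - complex_of_real (1/pi) * (LINT s:{0..S}|lborel. I s x)))^2)
      \<partial>lborel) \<longlongrightarrow> 0) at_top"
proof -
  have hm [measurable]: "h \<in> borel_measurable borel" using assms(1) by simp
  \<comment> \<open>Extension by zero to the whole line, where \<open>hat\<close> and
    \<open>l2sq\<close> live.\<close>
  define h0 where "h0 x = indicator {0<..} x * h x" for x
  have h0m [measurable]: "h0 \<in> borel_measurable borel" unfolding h0_def by measurable
  have "l2sq h0 = (\<integral>\<^sup>+ x \<in> {0<..}. ennreal ((cmod (h x))^2) \<partial>lborel)"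
    unfolding l2sq_def by (intro nn_integral_cong) (auto simp: h0_def indicator_def)
  hence fin: "l2sq h0 < \<infinity>" using assms(2) by simp
  have pos: "h0 x = 0" if "x \<le> 0" for x using that by (simp add: h0_def)
  obtain H where Hm [measurable]: "H \<in> borel_measurable borel"
    and HB: "\<And>\<alpha> \<beta>. 0 < \<alpha> \<Longrightarrow> l2sq (\<lambda>s. H s - hat (\<lambda>x. indicator {\<alpha>..\<beta>} x * h0 x) s) \<le>
       ennreal (2 * pi) * l2sq (\<lambda>x. h0 x - indicator {\<alpha>..\<beta>} x * h0 x)"
    using l2_transform_exists[OF h0m fin pos] by metis
  define I where "I s x = of_real (psi s x / 2) * H s" for s x
  have "(\<lambda>p. of_real (psi (fst p) (snd p) / 2) * H (fst p)) \<in> borel_measurable (borel \<Otimes>\<^sub>M borel)"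
    by measurable
  hence 1: "(\<lambda>(s, x). I s x) \<in> borel_measurable borel"
    by (simp add: I_def split_beta' borel_prod)
  have 2: "((\<lambda>(\<alpha>, \<beta>). \<integral>\<^sup>+ s \<in> {0..S}.
           ennreal ((cmod (I s x - (LINT y:{\<alpha>..\<beta>}|lborel. complex_of_real (kerA s x y) * h y)))^2)
         \<partial>lborel) \<longlongrightarrow> 0) (at_right 0 \<times>\<^sub>F at_top)" if x: "x > 0" and S: "S > 0" for x S
  proof (rule tendsto_ennreal_0I)
    fix r :: real assume r: "r > 0"
    \<comment> \<open>The squared bound of psi / 2 times the Bessel constant; the summand 1 makes C
      positive.\<close>
    define C where "C = (jost_bound x)\<^sup>2 * (2 * pi) + 1"
    have C: "C > 0" unfolding C_def by (intro add_nonneg_pos mult_nonneg_nonneg) auto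
    define hn where "hn n x = indicator {1 / (real n + 1)..real n + 1} x * h0 x" for n x
    have [measurable]: "hn n \<in> borel_measurable borel" for n unfolding hn_def by measurable
    have lim: "(\<lambda>n. l2sq (\<lambda>x. h0 x - hn n x)) \<longlonglongrightarrow> 0"
    proof (rule l2sq_dominated[OF h0m _ fin])
      show "(\<lambda>n. hn n x) \<longlonglongrightarrow> h0 x" for x
        by (rule Lim_transform_eventually[OF tendsto_const])
           (use interval_exhaustion[where h = h0 and x = x, OF pos] in \<open>auto elim!: eventually_mono simp: hn_def\<close>)
    qed (auto simp: hn_def indicator_def)
    have "eventually (\<lambda>n. l2sq (\<lambda>x. h0 x - hn n x) \<le> ennreal (r / C)) sequentially"
      by (rule tendsto_ennreal_0D[OF lim]) (use r C in simp)
    then obtain n where n: "l2sq (\<lambda>x. h0 x - hn n x) \<le> ennreal (r / C)" by (auto simp: eventually_sequentially)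
    \<comment> \<open>Enlarging the interval only shrinks the tail of h0, so one n serves for all
      \<alpha> near 0 and all large \<beta>.\<close>
    have bound: "(\<integral>\<^sup>+ s \<in> {0..S}.
           ennreal ((cmod (I s x - (LINT y:{\<alpha>..\<beta>}|lborel. complex_of_real (kerA s x y) * h y)))^2)
         \<partial>lborel) \<le> ennreal r" if \<alpha>: "0 < \<alpha>" "\<alpha> \<le> 1 / (real n + 1)" and \<beta>: "real n + 1 \<le> \<beta>" for \<alpha> \<beta>
    proof -
      define hc where "hc y = indicator {\<alpha>..\<beta>} y * h0 y" for y
      have [measurable]: "hc \<in> borel_measurable borel" unfolding hc_def by measurable
      have ker: "(LINT y:{\<alpha>..\<beta>}|lborel. complex_of_real (kerA s x y) * h y) = of_real (psi s x / 2) * hat hc s" if "s \<ge> 0" for s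
      proof -
        have "indicator {\<alpha>..\<beta>} y *\<^sub>R (complex_of_real (kerA s x y) * h y) = of_real (psi s x / 2) * (of_real (psi s y) * hc y)" for y
          using \<alpha>(1) by (cases "y \<in> {\<alpha>..\<beta>}") (auto simp: hc_def h0_def kerA_eq_psi[OF that x])
        note eq = this
        show ?thesis unfolding set_lebesgue_integral_def hat_def eq by (rule integral_mult_right_zero)
      qed
      have "(\<integral>\<^sup>+ s \<in> {0..S}.
           ennreal ((cmod (I s x - (LINT y:{\<alpha>..\<beta>}|lborel. complex_of_real (kerA s x y) * h y)))^2) \<partial>lborel) \<le>
         (\<integral>\<^sup>+ s. ennreal ((jost_bound x)\<^sup>2) * ennreal ((cmod (H s - hat hc s))\<^sup>2) \<partial>lborel)"
      proof (rule nn_integral_mono)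
        fix s
        show "ennreal ((cmod (I s x - (LINT y:{\<alpha>..\<beta>}|lborel. complex_of_real (kerA s x y) * h y)))^2) * indicator {0..S} s \<le>
            ennreal ((jost_bound x)\<^sup>2) * ennreal ((cmod (H s - hat hc s))\<^sup>2)"
        proof (cases "s \<in> {0..S}")
          case True
          hence s: "s \<ge> 0" by simp
          have "I s x - of_real (psi s x / 2) * hat hc s = of_real (psi s x / 2) * (H s - hat hc s)"
            by (simp add: I_def right_diff_distrib)
          hence "cmod (I s x - of_real (psi s x / 2) * hat hc s) = \<bar>psi s x / 2\<bar> * cmod (H s - hat hc s)"
            by (simp only: norm_mult norm_of_real)
          also have "\<dots> \<le> jost_bound x * cmod (H s - hat hc s)"
            using abs_psi_le[of x x s] x by (intro mult_right_mono) auto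
          finally have "(cmod (I s x - of_real (psi s x / 2) * hat hc s))\<^sup>2 \<le> (jost_bound x * cmod (H s - hat hc s))\<^sup>2"
            by (intro power_mono) auto
          hence "ennreal ((cmod (I s x - of_real (psi s x / 2) * hat hc s))\<^sup>2) \<le> ennreal ((jost_bound x)\<^sup>2 * (cmod (H s - hat hc s))\<^sup>2)"
            by (intro ennreal_leI) (simp add: power_mult_distrib)
          thus ?thesis unfolding ker[OF s] using True by (simp add: ennreal_mult)
        qed simp
      qed
      also have "\<dots> = ennreal ((jost_bound x)\<^sup>2) * l2sq (\<lambda>s. H s - hat hc s)"
        unfolding l2sq_def by (rule nn_integral_cmult) measurable
      also have "\<dots> \<le> ennreal ((jost_bound x)\<^sup>2) * (ennreal (2 * pi) * l2sq (\<lambda>x. h0 x - hc x))"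
        unfolding hc_def by (intro mult_left_mono HB \<alpha>) auto
      also have "\<dots> = ennreal ((jost_bound x)\<^sup>2 * (2 * pi)) * l2sq (\<lambda>x. h0 x - hc x)"
        by (simp add: ennreal_mult mult.assoc)
      also have "\<dots> \<le> ennreal C * ennreal (r / C)"
      proof (intro mult_mono ennreal_leI)
        have "l2sq (\<lambda>x. h0 x - hc x) \<le> l2sq (\<lambda>x. h0 x - hn n x)"
          by (rule l2sq_mono) (use \<alpha> \<beta> in \<open>auto simp: hc_def hn_def indicator_def\<close>)
        thus "l2sq (\<lambda>x. h0 x - hc x) \<le> ennreal (r / C)" using n by (rule order_trans)
      qed (auto simp: C_def)
      also have "\<dots> = ennreal r" using C r by (simp flip: ennreal_mult)
      finally show ?thesis .
    qed
    have "eventually (\<lambda>\<alpha>::real. \<alpha> \<in> {0<..<1 / (real n + 1)}) (at_right 0)"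
      by (rule eventually_at_right_real) simp
    hence "eventually (\<lambda>p. fst p \<in> {0<..<1 / (real n + 1)} \<and> snd p \<ge> real n + 1) (at_right (0::real) \<times>\<^sub>F at_top)"
      using eventually_ge_at_top[of "real n + 1"] unfolding eventually_prod_filter by fastforce
    thus "eventually (\<lambda>p. (case p of (\<alpha>, \<beta>) \<Rightarrow> \<integral>\<^sup>+ s \<in> {0..S}.
           ennreal ((cmod (I s x - (LINT y:{\<alpha>..\<beta>}|lborel. complex_of_real (kerA s x y) * h y)))^2)
         \<partial>lborel) \<le> ennreal r) (at_right 0 \<times>\<^sub>F at_top)"
    proof eventually_elim
      case (elim p)
      thus ?case using bound[of "fst p" "snd p"] by (simp only: split_beta) auto
    qed
  qed
  have "(\<integral>\<^sup>+ x \<in> {0<..}. ennreal ((cmod (h x - complex_of_real (1/pi) * (LINT s:{0..S}|lborel. I s x)))^2) \<partial>lborel) =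
      l2sq (\<lambda>x. h0 x - of_real (1 / (2 * pi)) * synth (\<lambda>s. indicator {0..S} s * H s) x)" for S
    unfolding l2sq_def
  proof (rule nn_integral_cong)
    fix x
    show "ennreal ((cmod (h x - complex_of_real (1/pi) * (LINT s:{0..S}|lborel. I s x)))^2) * indicator {0<..} x =
        ennreal ((cmod (h0 x - of_real (1 / (2 * pi)) * synth (\<lambda>s. indicator {0..S} s * H s) x))\<^sup>2)"
    proof (cases "x > 0")
      case True
      \<comment> \<open>The 1/2 in I turns the factor 1/pi of the statement into the 1/(2 pi) of
        \<open>inversion\<close>.\<close>
      have "(LINT s:{0..S}|lborel. I s x) = (LINT s|lborel. (1/2) * (of_real (psi s x) * (indicator {0..S} s * H s)))"
        unfolding set_lebesgue_integral_def I_def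
        by (intro Bochner_Integration.integral_cong) (auto simp: indicator_def)
      also have "\<dots> = (1/2) * synth (\<lambda>s. indicator {0..S} s * H s) x"
        unfolding synth_def by (rule integral_mult_right_zero)
      finally have eq: "(LINT s:{0..S}|lborel. I s x) = (1/2) * synth (\<lambda>s. indicator {0..S} s * H s) x" .
      show ?thesis unfolding eq using True by (simp add: h0_def mult.commute)
    qed (simp add: h0_def synth_nonpos)
  qed
  hence 3: "((\<lambda>S. \<integral>\<^sup>+ x \<in> {0<..}.
        ennreal ((cmod (h x - complex_of_real (1/pi) * (LINT s:{0..S}|lborel. I s x)))^2)
      \<partial>lborel) \<longlongrightarrow> 0) at_top"
    using inversion[OF h0m fin pos Hm HB] by simp
  show ?thesis using 1 2 3 by blast
qed

end
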